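(* Let $m\in\mathbb N$ be even, let $\tau,\nu\in S_m$ be permutations of $\{1,\ldots,m\}$, and let $r\in\{\rho,\hat\rho\}$. Given sets $\Psi_1,\ldots,\Psi_m$ as in (i) or (ii) below, denote, for $j=1,\ldots,\frac m2$, $\Sigma_j=\Psi_{\tau(2j-1)}^*\Psi_{\tau(2j)}$ and $\Sigma_{\frac m2+j}=\Psi_{\tau(2j)}^*\Psi_{\tau(2j-1)}=\Sigma_j^*$, and, for $i=1,\ldots,m$, $\Omega_i=\Sigma_{\nu(i)}\cdots\Sigma_{\nu(m)}\Sigma_{\nu(1)}\cdots\Sigma_{\nu(i-1)}$. (i) If $\Psi_1,\ldots,\Psi_m$ are bounded sets of positive kernel operators on $L^2(X,\mu)$, then $$\big\|\Psi_1^{(\frac1m)}\circ\cdots\circ\Psi_m^{(\frac1m)}\big\|\le r\big(\Sigma_1^{(\frac1m)}\circ\cdots\circ\Sigma_m^{(\frac1m)}\big)^{\frac12}\le r\big(\Omega_1^{(\frac1m)}\circ\cdots\circ\Omega_m^{(\frac1m)}\big)^{\frac1{2m}}\le r\big(\Sigma_{\nu(1)}\cdots\Sigma_{\nu(m)}\big)^{\frac1{2m}}.$$ (ii) If $\Psi_1,\ldots,\Psi_m$ are bounded sets of nonnegative matrices that define operators on $l^2(R)$ and $\alpha\ge\frac1m$, then $$\big\|\Psi_1^{(\alpha)}\circ\cdots\circ\Psi_m^{(\alpha)}\big\|\le r\big(\Sigma_1^{(\alpha)}\circ\cdots\circ\Sigma_m^{(\alpha)}\big)^{\frac12}\le r\big(\Omega_1^{(\alpha)}\circ\cdots\circ\Omega_m^{(\alpha)}\big)^{\frac1{2m}}\le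 r\big(\Sigma_{\nu(1)}\cdots\Sigma_{\nu(m)}\big)^{\frac\alpha2}.$$
   Context: $(X,\mathfrak M,\mu)$ is a nonempty set with a $\sigma$-finite positive measure and $L^2(X,\mu)$ is the complex Hilbert space. A linear operator $A$ on it is positive if it maps a.e. nonnegative functions to a.e. nonnegative functions (then it is bounded). It is a kernel operator if there is a $\mu\times\mu$-measurable $a$ on $X\times X$ such that for all $f\in L^2(X,\mu)$ and almost all $x$, $\int_X|a(x,y)f(y)|\,d\mu(y)<\infty$ and $(Af)(x)=\int_X a(x,y)f(y)\,d\mu(y)$. For positive kernel operators $A_1,\ldots,A_m$ with kernels $a_1,\ldots,a_m$ and positive $\alpha_j$ with $\sum_j\alpha_j=1$, $A_1^{(\alpha_1)}\circ\cdots\circ A_m^{(\alpha_m)}$ is the positive kernel operator with kernel $a_1(x,y)^{\alpha_1}\cdots a_m(x,y)^{\alpha_m}$. $R$ is $\mathbb N$ or $\{1,\ldots,N\}$ for some $N\in\mathbb N$, and $l^2(R)$ is the complex Hilbert space. A matrix $A=[a_{ij}]_{i,j\in R}$ is nonnegative if all $a_{ij}\ge0$; it defines an operator on $l^2(R)$ if $Ax\in l^2(R)$ for all $x\in l^2(R)$, where $(Ax)_i=\sum_j a_{ij}x_j$ (the operator is then positive and bounded). Matrices are identified with the operators they define. For nonnegative matrices $A_j=[a^{(j)}_{ik}]$ and positive $\alpha_j$, $A_1^{(\alpha_1)}\circ\cdots\circ A_m^{(\alpha_m)}$ is the matrix with entries $\prod_j (a^{(j)}_{ik})^{\alpha_j}$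 (if $\sum_j\alpha_j\ge1$ and the $A_j$ define operators on $l^2(R)$, it defines an operator on $l^2(R)$). For bounded (in operator norm) sets of operators: $\Psi_1\cdots\Psi_k=\{A_1\cdots A_k: A_i\in\Psi_i\}$, $\Sigma^k=\{A_1\cdots A_k:A_i\in\Sigma\}$, $\Psi^*=\{A^*:A\in\Psi\}$ ($A^*$ the adjoint), $\|\Psi\|=\sup_{A\in\Psi}\|A\|$, and $\Psi_1^{(\alpha_1)}\circ\cdots\circ\Psi_m^{(\alpha_m)}=\{A_1^{(\alpha_1)}\circ\cdots\circ A_m^{(\alpha_m)}:A_j\in\Psi_j\}$ (elements chosen independently from each factor). With $\rho(A)$ the spectral radius of an operator, for a bounded set $\Sigma$ of bounded operators: $\rho(\Sigma)=\limsup_{k\to\infty}[\sup_{A\in\Sigma^k}\rho(A)]^{1/k}$ and $\hat\rho(\Sigma)=\lim_{k\to\infty}[\sup_{A\in\Sigma^k}\|A\|]^{1/k}$. *)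

theory Defs
  imports "HOL-Analysis.Analysis" "HOL-Combinatorics.Permutations"
begin

section \<open>The complex Hilbert space of square-integrable functions\<close>

text \<open>
  Elements are equivalence classes of square-integrable functions modulo equality almost
  everywhere.  The values of a function outside \<open>space M\<close> are irrelevant, so for
  \<open>M = count_space R\<close> a class is the same thing as a square-summable family on \<open>R\<close>.
\<close>

definition sq_integrable :: "'a measure \<Rightarrow> ('a \<Rightarrow> complex) set" where
  "sq_integrable M = {f \<in> borel_measurable M. integrable M (\<lambda>x. (cmod (f x))\<^sup>2)}"

definition ae_rel :: "'a measure \<Rightarrow> (('a \<Rightarrow> complex) \<times> ('a \<Rightarrow> complex)) set" where
  "ae_rel M = {(f, g). f \<in> sq_integrable M \<and> g \<in> sq_integrable M \<and> (AE x in M. f x = g x)}"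

definition L2 :: "'a measure \<Rightarrow> ('a \<Rightarrow> complex) set set" where
  "L2 M = sq_integrable M // ae_rel M"

definition L2_class :: "'a measure \<Rightarrow> ('a \<Rightarrow> complex) \<Rightarrow> ('a \<Rightarrow> complex) set" where
  "L2_class M f = ae_rel M `` {f}"

definition L2_rep :: "('a \<Rightarrow> complex) set \<Rightarrow> 'a \<Rightarrow> complex" where
  "L2_rep F = (SOME f. f \<in> F)"

definition L2_norm :: "'a measure \<Rightarrow> ('a \<Rightarrow> complex) set \<Rightarrow> real" where
  "L2_norm M F = sqrt (\<integral>x. (cmod (L2_rep F x))\<^sup>2 \<partial>M)"

definition L2_inner :: "'a measure \<Rightarrow> ('a \<Rightarrow> complex) set \<Rightarrow> ('a \<Rightarrow> complex) set \<Rightarrow> complex" where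
  "L2_inner M F G = (\<integral>x. L2_rep F x * cnj (L2_rep G x) \<partial>M)"

definition L2_lincomb ::
  "'a measure \<Rightarrow> complex \<Rightarrow> ('a \<Rightarrow> complex) set \<Rightarrow> complex \<Rightarrow> ('a \<Rightarrow> complex) set \<Rightarrow> ('a \<Rightarrow> complex) set"
  where "L2_lincomb M c F d G = L2_class M (\<lambda>x. c * L2_rep F x + d * L2_rep G x)"


section \<open>Operators\<close>

text \<open>
  An operator is taken to be extensional (\<open>undefined\<close> outside \<open>L2 M\<close>), so that equality of
  operators is equality of their actions on \<open>L2 M\<close>.
\<close>

type_synonym 'a L2_op = "('a \<Rightarrow> complex) set \<Rightarrow> ('a \<Rightarrow> complex) set"

definition L2_operator :: "'a measure \<Rightarrow> 'a L2_op \<Rightarrow> bool" where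
  "L2_operator M A \<longleftrightarrow>
     A \<in> L2 M \<rightarrow>\<^sub>E L2 M \<and>
     (\<forall>F\<in>L2 M. \<forall>G\<in>L2 M. \<forall>c d. A (L2_lincomb M c F d G) = L2_lincomb M c (A F) d (A G))"

definition bounded_op_set :: "'a measure \<Rightarrow> 'a L2_op set \<Rightarrow> bool" where
  "bounded_op_set M \<Psi> \<longleftrightarrow> (\<exists>C. \<forall>A\<in>\<Psi>. \<forall>F\<in>L2 M. L2_norm M (A F) \<le> C * L2_norm M F)"

definition positive_operator :: "'a measure \<Rightarrow> 'a L2_op \<Rightarrow> bool" where
  "positive_operator M A \<longleftrightarrow>
     L2_operator M A \<and>
     (\<forall>F\<in>L2 M. \<forall>f\<in>F. \<forall>g\<in>A F.
        (AE x in M. f x \<in> \<real>\<^sub>\<ge>\<^sub>0) \<longrightarrow> (AE x in M. g x \<in> \<real>\<^sub>\<ge>\<^sub>0))"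

definition has_kernel :: "'a measure \<Rightarrow> 'a L2_op \<Rightarrow> ('a \<times> 'a \<Rightarrow> complex) \<Rightarrow> bool" where
  "has_kernel M A a \<longleftrightarrow>
     a \<in> borel_measurable (M \<Otimes>\<^sub>M M) \<and>
     (\<forall>F\<in>L2 M. \<forall>f\<in>F. \<forall>g\<in>A F. AE x in M.
        integrable M (\<lambda>y. a (x, y) * f y) \<and> g x = (\<integral>y. a (x, y) * f y \<partial>M))"

definition positive_kernel_operator :: "'a measure \<Rightarrow> 'a L2_op \<Rightarrow> bool" where
  "positive_kernel_operator M A \<longleftrightarrow> positive_operator M A \<and> (\<exists>a. has_kernel M A a)"

definition has_matrix :: "nat set \<Rightarrow> nat L2_op \<Rightarrow> (nat \<Rightarrow> nat \<Rightarrow> real) \<Rightarrow> bool" where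
  "has_matrix R A a \<longleftrightarrow>
     (\<forall>F\<in>L2 (count_space R). \<forall>f\<in>F. \<forall>g\<in>A F. \<forall>i\<in>R.
        (\<lambda>j. of_real (a i j) * f j) summable_on R \<and>
        g i = (\<Sum>\<^sub>\<infinity>j\<in>R. of_real (a i j) * f j))"

definition nonneg_matrix :: "nat set \<Rightarrow> (nat \<Rightarrow> nat \<Rightarrow> real) \<Rightarrow> bool" where
  "nonneg_matrix R a \<longleftrightarrow> (\<forall>i\<in>R. \<forall>j\<in>R. 0 \<le> a i j)"

text \<open>Matrices that define operators on \<open>L2 (count_space R)\<close> are identified with these operators.\<close>

definition nonneg_matrix_operator :: "nat set \<Rightarrow> nat L2_op \<Rightarrow> bool" where
  "nonneg_matrix_operator R A \<longleftrightarrow>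
     L2_operator (count_space R) A \<and> (\<exists>a. nonneg_matrix R a \<and> has_matrix R A a)"


section \<open>Norm and spectral radius\<close>

text \<open>
  Suprema of sets of nonnegative reals are taken in \<open>[0, \<infinity>)\<close>, so that the supremum of the
  empty set is \<open>0\<close>.
\<close>

definition Sup_nonneg :: "real set \<Rightarrow> real" where
  "Sup_nonneg S = Sup (insert 0 S)"

definition op_norm :: "'a measure \<Rightarrow> 'a L2_op \<Rightarrow> real" where
  "op_norm M A = Sup_nonneg {L2_norm M (A F) | F. F \<in> L2 M \<and> L2_norm M F \<le> 1}"

definition op_spectrum :: "'a measure \<Rightarrow> 'a L2_op \<Rightarrow> complex set" where
  "op_spectrum M A = {z. \<not> (\<exists>B. L2_operator M B \<and> bounded_op_set M {B} \<and>
     (\<forall>F\<in>L2 M. B (L2_lincomb M z F (-1) (A F)) = F \<and>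
                L2_lincomb M z (B F) (-1) (A (B F)) = F))}"

definition op_spectral_radius :: "'a measure \<Rightarrow> 'a L2_op \<Rightarrow> real" where
  "op_spectral_radius M A = Sup_nonneg (cmod ` op_spectrum M A)"


section \<open>Sets of operators\<close>

definition ops_norm :: "'a measure \<Rightarrow> 'a L2_op set \<Rightarrow> real" where
  "ops_norm M \<Psi> = Sup_nonneg (op_norm M ` \<Psi>)"

definition ops_prod :: "'a measure \<Rightarrow> 'a L2_op set list \<Rightarrow> 'a L2_op set" where
  "ops_prod M \<Psi>s =
     {foldr (compose (L2 M)) As (restrict id (L2 M)) | As. list_all2 (\<in>) As \<Psi>s}"

definition ops_power :: "'a measure \<Rightarrow> 'a L2_op set \<Rightarrow> nat \<Rightarrow> 'a L2_op set" where
  "ops_power M \<Psi> k = ops_prod M (replicate k \<Psi>)"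

definition ops_adjoint :: "'a measure \<Rightarrow> 'a L2_op set \<Rightarrow> 'a L2_op set" where
  "ops_adjoint M \<Psi> = {B. L2_operator M B \<and>
     (\<exists>A\<in>\<Psi>. \<forall>F\<in>L2 M. \<forall>G\<in>L2 M. L2_inner M (A F) G = L2_inner M F (B G))}"

text \<open>
  Detour through \<open>ereal\<close> because \<open>limsup\<close> needs a complete lattice; for a bounded set of
  operators the value is finite.
\<close>

definition gen_spectral_radius :: "'a measure \<Rightarrow> 'a L2_op set \<Rightarrow> real" where
  "gen_spectral_radius M \<Psi> = real_of_ereal (limsup (\<lambda>k.
     ereal (Sup_nonneg (op_spectral_radius M ` ops_power M \<Psi> k) powr (1 / real k))))"

definition joint_spectral_radius :: "'a measure \<Rightarrow> 'a L2_op set \<Rightarrow> real" where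
  "joint_spectral_radius M \<Psi> = lim (\<lambda>k. ops_norm M (ops_power M \<Psi> k) powr (1 / real k))"

text \<open>
  Hadamard weighted geometric means of \<open>\<Psi> 1, \<dots>, \<Psi> m\<close>.  The kernel of a positive kernel
  operator is determined, and nonnegative, only almost everywhere with respect to the product
  measure; it is represented here by an everywhere nonnegative kernel.
\<close>

definition kernel_hadamard ::
  "'a measure \<Rightarrow> nat \<Rightarrow> (nat \<Rightarrow> real) \<Rightarrow> (nat \<Rightarrow> 'a L2_op set) \<Rightarrow> 'a L2_op set" where
  "kernel_hadamard M m \<alpha> \<Psi> = {C. L2_operator M C \<and> (\<exists>A a.
     (\<forall>j\<in>{1..m}. A j \<in> \<Psi> j \<and> (\<forall>z. 0 \<le> a j z) \<and> has_kernel M (A j) (\<lambda>z. of_real (a j z))) \<and>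
     has_kernel M C (\<lambda>z. of_real (\<Prod>j=1..m. a j z powr \<alpha> j)))}"

definition matrix_hadamard ::
  "nat set \<Rightarrow> nat \<Rightarrow> (nat \<Rightarrow> real) \<Rightarrow> (nat \<Rightarrow> nat L2_op set) \<Rightarrow> nat L2_op set" where
  "matrix_hadamard R m \<alpha> \<Psi> = {C. L2_operator (count_space R) C \<and> (\<exists>A a.
     (\<forall>j\<in>{1..m}. A j \<in> \<Psi> j \<and> nonneg_matrix R (a j) \<and> has_matrix R (A j) (a j)) \<and>
     has_matrix R C (\<lambda>i k. \<Prod>j=1..m. a j i k powr \<alpha> j))}"

definition adjoint_prods ::
  "'a measure \<Rightarrow> nat \<Rightarrow> (nat \<Rightarrow> nat) \<Rightarrow> (nat \<Rightarrow> 'a L2_op set) \<Rightarrow> nat \<Rightarrow> 'a L2_op set" where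
  "adjoint_prods M m \<tau> \<Psi> j =
     (if j \<le> m div 2
      then ops_prod M [ops_adjoint M (\<Psi> (\<tau> (2 * j - 1))), \<Psi> (\<tau> (2 * j))]
      else let i = j - m div 2
           in ops_prod M [ops_adjoint M (\<Psi> (\<tau> (2 * i))), \<Psi> (\<tau> (2 * i - 1))])"

definition cyclic_prods ::
  "'a measure \<Rightarrow> nat \<Rightarrow> (nat \<Rightarrow> nat) \<Rightarrow> (nat \<Rightarrow> 'a L2_op set) \<Rightarrow> nat \<Rightarrow> 'a L2_op set" where
  "cyclic_prods M m \<nu> S i = ops_prod M (map (\<lambda>l. S (\<nu> l)) ([i..<m + 1] @ [1..<i]))"

end

theory Submission
  imports Defs "HOL-Complex_Analysis.Cauchy_Integral_Formula"
begin

text \<open>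
  By Hoelder's inequality a composition of Hadamard means is dominated pointwise by the Hadamard
  mean of the compositions, and a Hadamard mean may be rewritten by permuting its arguments. Hence
  \<open>C* C\<close>, for \<open>C\<close> in the mean of the \<open>\<Psi>\<^sub>j\<close>, is dominated by an element of the mean of the \<open>\<Sigma>\<^sub>j\<close>,
  and a product of \<open>m\<close> elements of the latter by an element of the mean of the \<open>\<Omega>\<^sub>i\<close>. Domination is
  monotone for norms of powers, so by Gelfand's formula also for spectral radii. The last inequality
  combines the submultiplicativity of norms and radii under Hadamard means with their invariance
  under cyclic permutations.

  Matrices are kernels with respect to counting measure; there the exponents may add up to more
  than one because \<open>\<ell>\<^sup>p\<close> norms decrease in \<open>p\<close>.
\<close>

section \<open>The Hilbert space of square-integrable functions\<close>

text \<open>The spectral radius is defined through the spectrum, while domination controls only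
  norms. Hence both halves of Gelfand's formula are needed, in this form: for every t above the
  radius there is a C such that the n-th power has norm at most C * t ^ n. Constants disappear in
  n-th roots, so a comparison of radii reduces to a comparison of words up to a factor, with t
  tending to the radius by \<open>dense_ge\<close>. For the first inequality, the equality of norm
  and spectral radius of a self-adjoint operator is replaced by repeated squaring: the norm of C to
  the power 2 * 2 ^ k is at most the norm of the 2 ^ k-th power of the product of the adjoint with
  C, and this lower bound on norms of powers passes directly through domination. Kernels take values
  in [0, \<infinity>], which makes composition and means total operations; convergence matters only
  when an operator is recovered from a kernel. The empty product is the identity, which in general
  has no kernel, so growth is compared for positive exponents. Evenness of m enters through the
  pairing of indices: the left factors of the Sigma_j, and likewise the right ones, use every index
  exactly once.\<close>

lemma borel_measurable_cnj [measurable]: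
  assumes [measurable]: "f \<in> borel_measurable M" shows "(\<lambda>x. cnj (f x)) \<in> borel_measurable M"
proof -
  have "cnj \<in> borel_measurable borel" by (intro borel_measurable_continuous_onI continuous_intros)
  then show ?thesis using assms by measurable
qed

lemma sq_integrable_measurable [measurable_dest]:
  "f \<in> sq_integrable M \<Longrightarrow> f \<in> borel_measurable M"
  by (simp add: sq_integrable_def)

lemma integrable_sq_integrable: "f \<in> sq_integrable M \<Longrightarrow> integrable M (\<lambda>x. (cmod (f x))\<^sup>2)"
  by (simp add: sq_integrable_def)

lemma cmod_lincomb_sq: "(cmod (c * a + d * b))\<^sup>2 \<le> 2 * (cmod c)\<^sup>2 * (cmod a)\<^sup>2 + 2 * (cmod d)\<^sup>2 * (cmod b)\<^sup>2"
proof -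
  have "(cmod (c * a + d * b))\<^sup>2 \<le> (cmod c * cmod a + cmod d * cmod b)\<^sup>2"
    by (intro power_mono) (auto simp: norm_mult intro: norm_triangle_le)
  also have "\<dots> \<le> 2 * (cmod c * cmod a)\<^sup>2 + 2 * (cmod d * cmod b)\<^sup>2"
    using sum_squares_bound[of "cmod c * cmod a" "cmod d * cmod b"] by (simp add: power2_sum)
  finally show ?thesis by (simp add: power_mult_distrib mult.assoc)
qed

lemma sq_integrable_lincomb:
  assumes "f \<in> sq_integrable M" "g \<in> sq_integrable M"
  shows "(\<lambda>x. c * f x + d * g x) \<in> sq_integrable M"
proof -
  note [measurable] = assms[THEN sq_integrable_measurable]
  have "integrable M (\<lambda>x. (cmod (c * f x + d * g x))\<^sup>2)"
  proof (rule Bochner_Integration.integrable_bound)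
    show "integrable M (\<lambda>x. 2 * (cmod c)\<^sup>2 * (cmod (f x))\<^sup>2 + 2 * (cmod d)\<^sup>2 * (cmod (g x))\<^sup>2)"
      using assms[THEN integrable_sq_integrable] by auto
    show "AE x in M. norm ((cmod (c * f x + d * g x))\<^sup>2) \<le> norm (2 * (cmod c)\<^sup>2 * (cmod (f x))\<^sup>2 + 2 * (cmod d)\<^sup>2 * (cmod (g x))\<^sup>2)"
      using cmod_lincomb_sq by (intro AE_I2) (simp add: abs_of_nonneg)
  qed measurable
  then show ?thesis by (simp add: sq_integrable_def)
qed

lemma integrable_sq_prod:
  assumes "f \<in> sq_integrable M" "g \<in> sq_integrable M"
  shows "integrable M (\<lambda>x. f x * cnj (g x))"
proof (rule Bochner_Integration.integrable_bound)
  note [measurable] = assms[THEN sq_integrable_measurable]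
  show "integrable M (\<lambda>x. (cmod (f x))\<^sup>2 + (cmod (g x))\<^sup>2)"
    using assms[THEN integrable_sq_integrable] by auto
  show "(\<lambda>x. f x * cnj (g x)) \<in> borel_measurable M" by measurable
  have "cmod a * cmod b \<le> (cmod a)\<^sup>2 + (cmod b)\<^sup>2" for a b
    using sum_squares_bound[of "cmod a" "cmod b"] mult_nonneg_nonneg[of "cmod a" "cmod b"] by (simp del: mult_nonneg_nonneg zero_le_mult_iff)
  then show "AE x in M. norm (f x * cnj (g x)) \<le> norm ((cmod (f x))\<^sup>2 + (cmod (g x))\<^sup>2)"
    by (intro AE_I2) (simp add: norm_mult abs_of_nonneg)
qed

lemma equiv_ae_rel: "equiv (sq_integrable M) (ae_rel M)"
proof (rule equivI)
  show "refl_on (sq_integrable M) (ae_rel M)" by (auto simp: refl_on_def ae_rel_def)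
  show "sym (ae_rel M)" by (auto simp: sym_def ae_rel_def)
  show "trans (ae_rel M)" by (auto simp: trans_def ae_rel_def)
  show "ae_rel M \<subseteq> sq_integrable M \<times> sq_integrable M" by (auto simp: ae_rel_def)
qed

lemma L2_class_in: "f \<in> sq_integrable M \<Longrightarrow> L2_class M f \<in> L2 M"
  by (simp add: L2_class_def L2_def quotientI)

lemma mem_L2_class: "f \<in> sq_integrable M \<Longrightarrow> g \<in> L2_class M f \<longleftrightarrow> g \<in> sq_integrable M \<and> (AE x in M. f x = g x)"
  by (auto simp: L2_class_def ae_rel_def)

lemma L2_class_eq_iff:
  "f \<in> sq_integrable M \<Longrightarrow> g \<in> sq_integrable M \<Longrightarrow> L2_class M f = L2_class M g \<longleftrightarrow> (AE x in M. f x = g x)"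
  unfolding L2_class_def by (subst eq_equiv_class_iff[OF equiv_ae_rel]) (auto simp: ae_rel_def)

lemma L2_cases:
  assumes "F \<in> L2 M" obtains f where "f \<in> sq_integrable M" "F = L2_class M f"
  using assms by (auto simp: L2_def L2_class_def elim: quotientE)

lemma L2_class_memD:
  assumes "F \<in> L2 M" "f \<in> F" shows "f \<in> sq_integrable M" "L2_class M f = F"
  using assms by (auto elim!: L2_cases simp: mem_L2_class L2_class_eq_iff)

lemma L2_rep_in: assumes "F \<in> L2 M" shows "L2_rep F \<in> F"
proof -
  obtain f where "f \<in> sq_integrable M" "F = L2_class M f" using assms by (rule L2_cases)
  then have "f \<in> F" by (simp add: mem_L2_class)
  then show ?thesis unfolding L2_rep_def by (metis someI)
qed

lemma L2_rep_sq: "F \<in> L2 M \<Longrightarrow> L2_rep F \<in> sq_integrable M"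
  using L2_rep_in L2_class_memD by blast

lemma L2_class_rep [simp]: "F \<in> L2 M \<Longrightarrow> L2_class M (L2_rep F) = F"
  using L2_rep_in L2_class_memD by blast

lemma L2_rep_class:
  "f \<in> sq_integrable M \<Longrightarrow> AE x in M. L2_rep (L2_class M f) x = f x"
  by (subst L2_class_eq_iff[symmetric]) (auto simp: L2_class_in L2_rep_sq)

lemma L2_norm_class:
  assumes "f \<in> sq_integrable M"
  shows "L2_norm M (L2_class M f) = sqrt (\<integral>x. (cmod (f x))\<^sup>2 \<partial>M)"
proof -
  note [measurable] = assms[THEN sq_integrable_measurable] L2_rep_sq[OF L2_class_in[OF assms], THEN sq_integrable_measurable]
  have "(\<integral>x. (cmod (L2_rep (L2_class M f) x))\<^sup>2 \<partial>M) = (\<integral>x. (cmod (f x))\<^sup>2 \<partial>M)"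
    by (rule integral_cong_AE) (use L2_rep_class[OF assms] in auto)
  then show ?thesis by (simp add: L2_norm_def)
qed

lemma L2_inner_class:
  assumes "f \<in> sq_integrable M" "g \<in> sq_integrable M"
  shows "L2_inner M (L2_class M f) (L2_class M g) = (\<integral>x. f x * cnj (g x) \<partial>M)"
proof -
  note [measurable] = assms[THEN sq_integrable_measurable] assms[THEN L2_class_in, THEN L2_rep_sq, THEN sq_integrable_measurable]
  show ?thesis unfolding L2_inner_def
    by (rule integral_cong_AE) (use L2_rep_class[OF assms(1)] L2_rep_class[OF assms(2)] in auto)
qed

lemma L2_lincomb_class:
  assumes "f \<in> sq_integrable M" "g \<in> sq_integrable M"
  shows "L2_lincomb M c (L2_class M f) d (L2_class M g) = L2_class M (\<lambda>x. c * f x + d * g x)"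
  unfolding L2_lincomb_def
  by (subst L2_class_eq_iff) (use L2_rep_class[OF assms(1)] L2_rep_class[OF assms(2)] in
      \<open>auto intro!: sq_integrable_lincomb L2_rep_sq L2_class_in assms\<close>)

lemma L2_lincomb_in [simp, intro]: "F \<in> L2 M \<Longrightarrow> G \<in> L2 M \<Longrightarrow> L2_lincomb M c F d G \<in> L2 M"
  unfolding L2_lincomb_def by (intro L2_class_in sq_integrable_lincomb L2_rep_sq)

lemma L2_inner_lincomb_left:
  assumes "F \<in> L2 M" "G \<in> L2 M" "H \<in> L2 M"
  shows "L2_inner M (L2_lincomb M c F d G) H = c * L2_inner M F H + d * L2_inner M G H"
proof -
  obtain f g h where *: "f \<in> sq_integrable M" "g \<in> sq_integrable M" "h \<in> sq_integrable M"
    "F = L2_class M f" "G = L2_class M g" "H = L2_class M h"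
    using assms by (metis L2_cases)
  have "(\<integral>x. (c * f x + d * g x) * cnj (h x) \<partial>M) = (\<integral>x. c * (f x * cnj (h x)) + d * (g x * cnj (h x)) \<partial>M)"
    by (simp add: algebra_simps)
  also have "\<dots> = c * (\<integral>x. f x * cnj (h x) \<partial>M) + d * (\<integral>x. g x * cnj (h x) \<partial>M)"
    using integrable_sq_prod[OF *(1,3)] integrable_sq_prod[OF *(2,3)] by simp
  finally show ?thesis using * by (simp add: L2_inner_class L2_lincomb_class sq_integrable_lincomb)
qed

lemma L2_inner_commute: "L2_inner M G F = cnj (L2_inner M F G)"
  unfolding L2_inner_def Bochner_Integration.integral_cnj[symmetric] by (simp add: mult.commute)

lemma L2_inner_lincomb_right:
  assumes "F \<in> L2 M" "G \<in> L2 M" "H \<in> L2 M"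
  shows "L2_inner M H (L2_lincomb M c F d G) = cnj c * L2_inner M H F + cnj d * L2_inner M H G"
  by (subst (1 2 3) L2_inner_commute) (simp add: L2_inner_lincomb_left assms)

lemma L2_norm_nonneg [simp]: "L2_norm M F \<ge> 0"
  by (simp add: L2_norm_def)

lemma L2_inner_self: "L2_inner M F F = of_real ((L2_norm M F)\<^sup>2)"
proof -
  have "L2_rep F x * cnj (L2_rep F x) = complex_of_real ((cmod (L2_rep F x))\<^sup>2)" for x
    by (simp add: complex_norm_square flip: of_real_power)
  then show ?thesis by (simp add: L2_inner_def L2_norm_def del: of_real_power)
qed

lemma L2_Cauchy_Schwarz:
  assumes "F \<in> L2 M" "G \<in> L2 M"
  shows "cmod (L2_inner M F G) \<le> L2_norm M F * L2_norm M G"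
proof -
  let ?f = "L2_rep F" and ?g = "L2_rep G"
  note sq = assms[THEN L2_rep_sq]
  note [measurable] = sq[THEN sq_integrable_measurable]
  have i: "integrable M (\<lambda>x. cmod (?f x) * cmod (?g x))"
    using integrable_norm[OF integrable_sq_prod[OF sq]] by (simp add: norm_mult)
  have 1: "(\<integral>\<^sup>+x. ennreal (cmod (?f x)) * ennreal (cmod (?g x)) \<partial>M) = ennreal (\<integral>x. cmod (?f x) * cmod (?g x) \<partial>M)"
    using nn_integral_eq_integral[OF i] by (simp add: ennreal_mult)
  have 2: "(\<integral>\<^sup>+x. (ennreal (cmod (h x)))\<^sup>2 \<partial>M) = ennreal (\<integral>x. (cmod (h x))\<^sup>2 \<partial>M)" if "h \<in> sq_integrable M" for h
    using nn_integral_eq_integral[OF integrable_sq_integrable[OF that]] by (simp add: ennreal_power)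
  have "ennreal ((\<integral>x. cmod (?f x) * cmod (?g x) \<partial>M)\<^sup>2) \<le> ennreal ((\<integral>x. (cmod (?f x))\<^sup>2 \<partial>M) * (\<integral>x. (cmod (?g x))\<^sup>2 \<partial>M))"
    using Cauchy_Schwarz_nn_integral[of "\<lambda>x. ennreal (cmod (?f x))" M "\<lambda>x. ennreal (cmod (?g x))"]
    unfolding 1 2[OF sq(1)] 2[OF sq(2)]
    by (subst ennreal_mult) (auto simp: ennreal_power Bochner_Integration.integral_nonneg)
  then have "(\<integral>x. cmod (?f x) * cmod (?g x) \<partial>M)\<^sup>2 \<le> (\<integral>x. (cmod (?f x))\<^sup>2 \<partial>M) * (\<integral>x. (cmod (?g x))\<^sup>2 \<partial>M)"
    by (simp add: ennreal_le_iff)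
  then have "(\<integral>x. cmod (?f x) * cmod (?g x) \<partial>M) \<le> sqrt ((\<integral>x. (cmod (?f x))\<^sup>2 \<partial>M) * (\<integral>x. (cmod (?g x))\<^sup>2 \<partial>M))"
    by (rule real_le_rsqrt)
  moreover have "cmod (L2_inner M F G) \<le> (\<integral>x. cmod (?f x) * cmod (?g x) \<partial>M)"
    unfolding L2_inner_def using integral_norm_bound[of M "\<lambda>x. ?f x * cnj (?g x)"] by (simp add: norm_mult)
  ultimately show ?thesis by (simp add: L2_norm_def real_sqrt_mult)
qed

text \<open>Both the triangle inequality and the parallelogram argument in
  \<open>Riesz_representation\<close> are read off from this expansion.\<close>

lemma L2_norm_lincomb_sq:
  assumes "F \<in> L2 M" "G \<in> L2 M"
  shows "(L2_norm M (L2_lincomb M c F d G))\<^sup>2 =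
    (cmod c * L2_norm M F)\<^sup>2 + (cmod d * L2_norm M G)\<^sup>2 + 2 * Re (c * cnj d * L2_inner M F G)"
proof -
  have "complex_of_real ((L2_norm M (L2_lincomb M c F d G))\<^sup>2) =
     c * cnj c * of_real ((L2_norm M F)\<^sup>2) + d * cnj d * of_real ((L2_norm M G)\<^sup>2)
     + (c * cnj d * L2_inner M F G + cnj (c * cnj d * L2_inner M F G))"
    using assms unfolding L2_inner_self[symmetric]
    by (simp add: L2_inner_lincomb_left L2_inner_lincomb_right L2_inner_commute[of M F G] algebra_simps)
  also have "\<dots> = complex_of_real ((cmod c * L2_norm M F)\<^sup>2 + (cmod d * L2_norm M G)\<^sup>2 + 2 * Re (c * cnj d * L2_inner M F G))"
    by (simp only: complex_add_cnj) (simp add: complex_norm_square[symmetric] power_mult_distrib)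
  finally show ?thesis by (simp only: of_real_eq_iff)
qed

lemma L2_norm_lincomb:
  assumes "F \<in> L2 M" "G \<in> L2 M"
  shows "L2_norm M (L2_lincomb M c F d G) \<le> cmod c * L2_norm M F + cmod d * L2_norm M G"
proof (rule power2_le_imp_le)
  have "Re (c * cnj d * L2_inner M F G) \<le> cmod (c * cnj d * L2_inner M F G)" by (rule complex_Re_le_cmod)
  also have "\<dots> = cmod c * cmod d * cmod (L2_inner M F G)" by (simp add: norm_mult)
  also have "\<dots> \<le> cmod c * cmod d * (L2_norm M F * L2_norm M G)"
    by (intro mult_left_mono L2_Cauchy_Schwarz assms) auto
  finally show "(L2_norm M (L2_lincomb M c F d G))\<^sup>2 \<le> (cmod c * L2_norm M F + cmod d * L2_norm M G)\<^sup>2"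
    by (simp add: L2_norm_lincomb_sq assms power2_sum algebra_simps)
qed auto

lemma L2_eqI_norm:
  assumes "F \<in> L2 M" "G \<in> L2 M" "L2_norm M (L2_lincomb M 1 F (-1) G) = 0"
  shows "F = G"
proof -
  obtain f g where *: "f \<in> sq_integrable M" "g \<in> sq_integrable M" "F = L2_class M f" "G = L2_class M g"
    using assms by (metis L2_cases)
  let ?h = "\<lambda>x. 1 * f x + (-1) * g x"
  have h: "?h \<in> sq_integrable M" by (intro sq_integrable_lincomb *)
  have "(\<integral>x. (cmod (?h x))\<^sup>2 \<partial>M) = 0"
    using assms(3) h by (simp add: * L2_lincomb_class L2_norm_class)
  then have "AE x in M. (cmod (?h x))\<^sup>2 = 0"
    by (subst (asm) integral_nonneg_eq_0_iff_AE) (use integrable_sq_integrable[OF h] in auto)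
  then show ?thesis using * by (auto simp: L2_class_eq_iff)
qed

text \<open>Take H to be the difference of the two sides. Since \<open>L2_lincomb\<close> chooses
  representatives, vector identities are awkward to compute with; tested against all H they become
  identities of complex numbers.\<close>

lemma L2_eqI:
  assumes FG: "F \<in> L2 M" "G \<in> L2 M" and e: "\<And>H. H \<in> L2 M \<Longrightarrow> L2_inner M F H = L2_inner M G H"
  shows "F = G"
proof (rule L2_eqI_norm[OF FG])
  let ?D = "L2_lincomb M 1 F (-1) G"
  have "L2_inner M ?D ?D = 0" using e[of ?D] FG by (subst L2_inner_lincomb_left) auto
  then show "L2_norm M ?D = 0" unfolding L2_inner_self by simp
qed

definition L2_zero :: "'a measure \<Rightarrow> ('a \<Rightarrow> complex) set" where
  "L2_zero M = L2_class M (\<lambda>_. 0)"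

lemma zero_sq: "(\<lambda>_. 0) \<in> sq_integrable M" by (simp add: sq_integrable_def)

lemma L2_zero_in [simp, intro]: "L2_zero M \<in> L2 M"
  unfolding L2_zero_def by (intro L2_class_in zero_sq)

lemma L2_norm_zero [simp]: "L2_norm M (L2_zero M) = 0"
  unfolding L2_zero_def by (subst L2_norm_class[OF zero_sq]) simp

lemma L2_inner_zero [simp]:
  assumes "G \<in> L2 M" shows "L2_inner M (L2_zero M) G = 0" "L2_inner M G (L2_zero M) = 0"
  using L2_Cauchy_Schwarz[OF L2_zero_in assms] L2_Cauchy_Schwarz[OF assms L2_zero_in] by auto

section \<open>Completeness: the Riesz-Fischer theorem\<close>

lemma L2_norm_sum_bound:
  assumes "\<And>i. u i \<in> sq_integrable M"
  shows "(\<lambda>x. complex_of_real (\<Sum>i<n. cmod (u i x))) \<in> sq_integrable M \<and>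
    L2_norm M (L2_class M (\<lambda>x. complex_of_real (\<Sum>i<n. cmod (u i x)))) \<le> (\<Sum>i<(n::nat). L2_norm M (L2_class M (u i)))"
proof (induction n)
  case 0
  then show ?case using L2_norm_zero[of M] zero_sq by (simp add: L2_zero_def)
next
  case (Suc n)
  let ?s = "\<lambda>x. complex_of_real (\<Sum>i<n. cmod (u i x))" and ?v = "\<lambda>x. complex_of_real (cmod (u n x))"
  note [measurable] = assms[of n, THEN sq_integrable_measurable]
  have v: "?v \<in> sq_integrable M" using integrable_sq_integrable[OF assms[of n]] by (simp add: sq_integrable_def)
  have eq: "(\<lambda>x. complex_of_real (\<Sum>i<Suc n. cmod (u i x))) = (\<lambda>x. 1 * ?s x + 1 * ?v x)" by simp
  have nv: "L2_norm M (L2_class M ?v) = L2_norm M (L2_class M (u n))"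
    by (simp add: L2_norm_class v assms)
  have "L2_norm M (L2_class M (\<lambda>x. 1 * ?s x + 1 * ?v x)) \<le> L2_norm M (L2_class M ?s) + L2_norm M (L2_class M ?v)"
    using L2_norm_lincomb[of "L2_class M ?s" M "L2_class M ?v" 1 1] Suc v
    by (simp add: L2_lincomb_class L2_class_in)
  moreover have "(\<lambda>x. 1 * ?s x + 1 * ?v x) \<in> sq_integrable M"
    by (rule sq_integrable_lincomb) (use Suc v in auto)
  ultimately show ?case unfolding eq using Suc nv by auto
qed

lemma nn_integral_sq_class:
  assumes "f \<in> sq_integrable M"
  shows "(\<integral>\<^sup>+x. (ennreal (cmod (f x)))\<^sup>2 \<partial>M) = ennreal ((L2_norm M (L2_class M f))\<^sup>2)"
  using nn_integral_eq_integral[OF integrable_sq_integrable[OF assms]]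
  by (simp add: ennreal_power L2_norm_class[OF assms] Bochner_Integration.integral_nonneg)

lemma sq_integrableI:
  assumes [measurable]: "f \<in> borel_measurable M" and "(\<integral>\<^sup>+x. (ennreal (cmod (f x)))\<^sup>2 \<partial>M) < \<infinity>"
  shows "f \<in> sq_integrable M"
proof -
  have "integrable M (\<lambda>x. (cmod (f x))\<^sup>2)"
    by (rule integrableI_nonneg) (use assms(2) in \<open>auto simp: ennreal_power\<close>)
  then show ?thesis by (simp add: sq_integrable_def)
qed

text \<open>The triangle inequality for finite partial sums of moduli, followed by Fatou's
  lemma.\<close>

lemma nn_integral_suminf_sq:
  assumes u: "\<And>i::nat. u i \<in> sq_integrable M" and s: "summable (\<lambda>i. L2_norm M (L2_class M (u i)))"
  shows "(\<integral>\<^sup>+x. (\<Sum>i. ennreal (cmod (u i x)))\<^sup>2 \<partial>M) \<le> ennreal ((\<Sum>i. L2_norm M (L2_class M (u i)))\<^sup>2)"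
proof -
  note [measurable] = u[THEN sq_integrable_measurable]
  let ?s = "\<lambda>n x. (\<Sum>i<n. ennreal (cmod (u i x)))\<^sup>2"
  let ?C = "(\<Sum>i. L2_norm M (L2_class M (u i)))"
  have "(\<Sum>i. ennreal (cmod (u i x)))\<^sup>2 = liminf (\<lambda>n. ?s n x)" for x
  proof -
    have "(\<lambda>n. \<Sum>i<n. ennreal (cmod (u i x))) \<longlonglongrightarrow> (\<Sum>i. ennreal (cmod (u i x)))"
      by (rule summable_LIMSEQ) simp
    then have "(\<lambda>n. (\<Sum>i<n. ennreal (cmod (u i x))) * (\<Sum>i<n. ennreal (cmod (u i x)))) \<longlonglongrightarrow> (\<Sum>i. ennreal (cmod (u i x))) * (\<Sum>i. ennreal (cmod (u i x)))"
      by (intro tendsto_mult_ennreal) auto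
    then have "(\<lambda>n. ?s n x) \<longlonglongrightarrow> (\<Sum>i. ennreal (cmod (u i x)))\<^sup>2"
      by (simp add: power2_eq_square)
    then show ?thesis by (rule lim_imp_Liminf[OF sequentially_bot, symmetric])
  qed
  then have "(\<integral>\<^sup>+x. (\<Sum>i. ennreal (cmod (u i x)))\<^sup>2 \<partial>M) = (\<integral>\<^sup>+x. liminf (\<lambda>n. ?s n x) \<partial>M)" by simp
  also have "\<dots> \<le> liminf (\<lambda>n. \<integral>\<^sup>+x. ?s n x \<partial>M)" by (rule nn_integral_liminf) measurable
  also have "\<dots> \<le> liminf (\<lambda>n::nat. ennreal (?C\<^sup>2))"
  proof (intro Liminf_mono always_eventually allI)
    fix n
    note b = L2_norm_sum_bound[where u=u and n=n, OF u]
    have "(\<integral>\<^sup>+x. ?s n x \<partial>M) = (\<integral>\<^sup>+x. (ennreal (cmod (complex_of_real (\<Sum>i<n. cmod (u i x)))))\<^sup>2 \<partial>M)"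
      by (simp add: sum_ennreal sum_nonneg del: of_real_sum)
    also have "\<dots> = ennreal ((L2_norm M (L2_class M (\<lambda>x. complex_of_real (\<Sum>i<n. cmod (u i x)))))\<^sup>2)"
      by (rule nn_integral_sq_class) (use b in blast)
    also have "\<dots> \<le> ennreal (?C\<^sup>2)"
      by (intro ennreal_leI power_mono order_trans[OF conjunct2[OF b]] sum_le_suminf s) auto
    finally show "(\<integral>\<^sup>+x. ?s n x \<partial>M) \<le> ennreal (?C\<^sup>2)" .
  qed
  also have "\<dots> = ennreal (?C\<^sup>2)" by (simp add: Liminf_const)
  finally show ?thesis .
qed

text \<open>The bound \<open>nn_integral_suminf_sq\<close>, applied to the shifted sequences,
  controls all tails; its finiteness for the shift 0 gives absolute convergence almost
  everywhere.\<close>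

lemma L2_suminf:
  assumes u: "\<And>i::nat. u i \<in> sq_integrable M" and s: "summable (\<lambda>i. L2_norm M (L2_class M (u i)))"
  obtains f where "f \<in> sq_integrable M"
    "\<And>n. L2_norm M (L2_class M (\<lambda>x. f x - (\<Sum>i<n. u i x))) \<le> (\<Sum>i. L2_norm M (L2_class M (u (i + n))))"
    "\<And>n. (\<lambda>x. f x - (\<Sum>i<n. u i x)) \<in> sq_integrable M"
proof -
  note [measurable] = u[THEN sq_integrable_measurable]
  \<comment> \<open>On the null set where the series diverges the value is unspecified, but f is
    still measurable.\<close>
  define f where "f = (\<lambda>x. \<Sum>i. u i x)"
  have [measurable]: "f \<in> borel_measurable M" unfolding f_def by measurable
  let ?g = "\<lambda>n x. \<Sum>i. ennreal (cmod (u (i + n) x))"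
  have g: "(\<integral>\<^sup>+x. (?g n x)\<^sup>2 \<partial>M) \<le> ennreal ((\<Sum>i. L2_norm M (L2_class M (u (i + n))))\<^sup>2)" for n
    by (rule nn_integral_suminf_sq[where u = "\<lambda>i. u (i + n)"]) (use u summable_ignore_initial_segment[OF s] in auto)
  have "(\<integral>\<^sup>+x. (?g 0 x)\<^sup>2 \<partial>M) \<noteq> \<infinity>" using g[of 0] by (auto simp: top_unique)
  then have "AE x in M. (?g 0 x)\<^sup>2 \<noteq> \<infinity>" by (intro nn_integral_PInf_AE) auto
  then have fin: "AE x in M. summable (\<lambda>i. cmod (u i x))"
  proof eventually_elim
    case (elim x)
    then have "?g 0 x \<noteq> \<infinity>" by (auto simp: power_eq_top_ennreal)
    then show ?case by (intro summable_suminf_not_top) auto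
  qed
  have le: "(\<integral>\<^sup>+x. (ennreal (cmod (f x - (\<Sum>i<n. u i x))))\<^sup>2 \<partial>M) \<le> ennreal ((\<Sum>i. L2_norm M (L2_class M (u (i + n))))\<^sup>2)" for n
  proof (rule order_trans[OF nn_integral_mono_AE g])
    show "AE x in M. (ennreal (cmod (f x - (\<Sum>i<n. u i x))))\<^sup>2 \<le> (?g n x)\<^sup>2"
      using fin
    proof eventually_elim
      case (elim x)
      then have s': "summable (\<lambda>i. cmod (u (i + n) x))" by (rule summable_ignore_initial_segment)
      have "f x - (\<Sum>i<n. u i x) = (\<Sum>i. u (i + n) x)"
        using suminf_split_initial_segment[OF summable_norm_cancel[OF elim], of n] by (simp add: f_def)
      then have "cmod (f x - (\<Sum>i<n. u i x)) \<le> (\<Sum>i. cmod (u (i + n) x))"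
        using summable_norm[OF s'] by simp
      then have "ennreal (cmod (f x - (\<Sum>i<n. u i x))) \<le> ?g n x"
        by (subst suminf_ennreal2) (use s' in \<open>auto intro: ennreal_leI\<close>)
      then show ?case by (rule power_mono) simp
    qed
  qed
  have sq: "(\<lambda>x. f x - (\<Sum>i<n. u i x)) \<in> sq_integrable M" for n
    by (rule sq_integrableI) (use le[of n] in \<open>auto intro: le_less_trans\<close>)
  show ?thesis
  proof (rule that[of f])
    show "f \<in> sq_integrable M" using sq[of 0] by simp
    fix n
    show "(\<lambda>x. f x - (\<Sum>i<n. u i x)) \<in> sq_integrable M" by (rule sq)
    have "(L2_norm M (L2_class M (\<lambda>x. f x - (\<Sum>i<n. u i x))))\<^sup>2 \<le> (\<Sum>i. L2_norm M (L2_class M (u (i + n))))\<^sup>2"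
      using le[of n] unfolding nn_integral_sq_class[OF sq] by (simp add: ennreal_le_iff)
    then show "L2_norm M (L2_class M (\<lambda>x. f x - (\<Sum>i<n. u i x))) \<le> (\<Sum>i. L2_norm M (L2_class M (u (i + n))))"
      by (rule power2_le_imp_le) (auto intro!: suminf_nonneg summable_ignore_initial_segment[OF s])
  qed
qed

text \<open>Summable increments stand in for the Cauchy property. Both applications, the Neumann
  iterates and a minimizing sequence, have geometrically bounded increments.\<close>

lemma L2_complete:
  assumes F: "\<And>n::nat. F n \<in> L2 M"
    and s: "summable (\<lambda>n. L2_norm M (L2_lincomb M 1 (F (Suc n)) (-1) (F n)))"
  obtains L where "L \<in> L2 M" "(\<lambda>n. L2_norm M (L2_lincomb M 1 (F n) (-1) L)) \<longlonglongrightarrow> 0"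
proof -
  let ?r = "\<lambda>n. L2_rep (F n)"
  note r = F[THEN L2_rep_sq]
  let ?u = "\<lambda>n x. 1 * ?r (Suc n) x + (-1) * ?r n x"
  have u: "?u n \<in> sq_integrable M" for n by (intro sq_integrable_lincomb r)
  have lc: "L2_lincomb M 1 (F (Suc n)) (-1) (F n) = L2_class M (?u n)" for n
    by (simp add: L2_lincomb_def)
  from L2_suminf[where u="?u", OF u s[unfolded lc]]
  obtain f where f: "f \<in> sq_integrable M"
    "\<And>n. L2_norm M (L2_class M (\<lambda>x. f x - (\<Sum>i<n. ?u i x))) \<le> (\<Sum>i. L2_norm M (L2_class M (?u (i + n))))"
    "\<And>n. (\<lambda>x. f x - (\<Sum>i<n. ?u i x)) \<in> sq_integrable M" by blast
  have tele: "(\<Sum>i<n. ?u i x) = ?r n x - ?r 0 x" for n x by (induction n) auto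
  \<comment> \<open>The telescoped series sums to the limit minus the first element, which is added
    back.\<close>
  let ?l = "\<lambda>x. 1 * f x + 1 * ?r 0 x"
  have l: "?l \<in> sq_integrable M" by (intro sq_integrable_lincomb f r)
  have eq: "L2_norm M (L2_lincomb M 1 (F n) (-1) (L2_class M ?l)) = L2_norm M (L2_class M (\<lambda>x. f x - (\<Sum>i<n. ?u i x)))" for n
  proof -
    have "L2_lincomb M 1 (F n) (-1) (L2_class M ?l) = L2_class M (\<lambda>x. 1 * ?r n x + (-1) * ?l x)"
      using L2_lincomb_class[OF r[of n] l, of 1 "-1"] F by simp
    also have "L2_norm M \<dots> = L2_norm M (L2_class M (\<lambda>x. f x - (\<Sum>i<n. ?u i x)))"
      unfolding L2_norm_class[OF sq_integrable_lincomb[OF r[of n] l]] L2_norm_class[OF f(3)]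
      by (intro arg_cong[of _ _ sqrt] Bochner_Integration.integral_cong refl arg_cong[of _ _ "\<lambda>x. x\<^sup>2"])
         (simp only: tele, subst norm_minus_commute[symmetric], simp add: algebra_simps)
    finally show ?thesis .
  qed
  show ?thesis
  proof (rule that)
    show "L2_class M ?l \<in> L2 M" by (rule L2_class_in[OF l])
    have "(\<lambda>n. \<Sum>i. L2_norm M (L2_class M (?u (i + n)))) \<longlonglongrightarrow> 0"
      by (rule suminf_exist_split2) (use s lc in simp)
    then show "(\<lambda>n. L2_norm M (L2_lincomb M 1 (F n) (-1) (L2_class M ?l))) \<longlonglongrightarrow> 0"
      unfolding eq by (rule Lim_null_comparison[rotated]) (use f(2) in \<open>auto intro!: always_eventually\<close>)
  qed
qed

section \<open>Bounded operators\<close>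

lemma L2_operator_in: "L2_operator M A \<Longrightarrow> F \<in> L2 M \<Longrightarrow> A F \<in> L2 M"
  by (auto simp: L2_operator_def)

lemma L2_operator_lincomb:
  "L2_operator M A \<Longrightarrow> F \<in> L2 M \<Longrightarrow> G \<in> L2 M \<Longrightarrow> A (L2_lincomb M c F d G) = L2_lincomb M c (A F) d (A G)"
  by (auto simp: L2_operator_def)

lemma L2_operator_eqI:
  assumes "L2_operator M A" "L2_operator M B" "\<And>F. F \<in> L2 M \<Longrightarrow> A F = B F" shows "A = B"
  by (rule extensionalityI[of _ "L2 M"]) (use assms in \<open>auto simp: L2_operator_def PiE_def\<close>)

definition bounded_operator :: "'a measure \<Rightarrow> 'a L2_op \<Rightarrow> bool" where
  "bounded_operator M A \<longleftrightarrow> L2_operator M A \<and> bounded_op_set M {A}"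

lemma bounded_operatorD: "bounded_operator M A \<Longrightarrow> L2_operator M A"
  by (simp add: bounded_operator_def)

lemma bounded_operatorI:
  "L2_operator M A \<Longrightarrow> (\<And>F. F \<in> L2 M \<Longrightarrow> L2_norm M (A F) \<le> C * L2_norm M F) \<Longrightarrow> bounded_operator M A"
  by (auto simp: bounded_operator_def bounded_op_set_def)

lemma bounded_operator_in: "bounded_operator M A \<Longrightarrow> F \<in> L2 M \<Longrightarrow> A F \<in> L2 M"
  by (rule L2_operator_in[OF bounded_operatorD])

lemma L2_norm_scale: "F \<in> L2 M \<Longrightarrow> L2_norm M (L2_lincomb M c F 0 F) = cmod c * L2_norm M F"
  by (rule power2_eq_imp_eq) (auto simp: L2_norm_lincomb_sq)

lemma Sup_nonneg_upper: "bdd_above S \<Longrightarrow> x \<in> S \<Longrightarrow> x \<le> Sup_nonneg S"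
  unfolding Sup_nonneg_def by (rule cSup_upper) auto

lemma Sup_nonneg_ge_0: "bdd_above S \<Longrightarrow> 0 \<le> Sup_nonneg S"
  unfolding Sup_nonneg_def by (rule cSup_upper) auto

lemma Sup_nonneg_least: "0 \<le> C \<Longrightarrow> (\<And>x. x \<in> S \<Longrightarrow> x \<le> C) \<Longrightarrow> Sup_nonneg S \<le> C"
  unfolding Sup_nonneg_def by (rule cSup_least) auto

lemma bounded_operator_bdd_above:
  assumes "bounded_operator M A"
  shows "bdd_above {L2_norm M (A F) | F. F \<in> L2 M \<and> L2_norm M F \<le> 1}"
proof -
  obtain C where C: "\<And>F. F \<in> L2 M \<Longrightarrow> L2_norm M (A F) \<le> C * L2_norm M F"
    using assms by (auto simp: bounded_operator_def bounded_op_set_def)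
  show ?thesis
  proof (rule bdd_aboveI[of _ "max C 0"])
    fix x assume "x \<in> {L2_norm M (A F) | F. F \<in> L2 M \<and> L2_norm M F \<le> 1}"
    then obtain F where F: "F \<in> L2 M" "L2_norm M F \<le> 1" "x = L2_norm M (A F)" by auto
    have "x \<le> C * L2_norm M F" using C F by simp
    also have "\<dots> \<le> max C 0 * L2_norm M F" by (intro mult_right_mono) auto
    also have "\<dots> \<le> max C 0 * 1" by (intro mult_left_mono) (use F in auto)
    finally show "x \<le> max C 0" by simp
  qed
qed

lemma op_norm_nonneg [simp]: "bounded_operator M A \<Longrightarrow> 0 \<le> op_norm M A"
  unfolding op_norm_def by (intro Sup_nonneg_ge_0 bounded_operator_bdd_above)

lemma op_norm_bound:
  assumes A: "bounded_operator M A" and F: "F \<in> L2 M"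
  shows "L2_norm M (A F) \<le> op_norm M A * L2_norm M F"
proof (cases "L2_norm M F = 0")
  case True
  obtain C where "\<And>F. F \<in> L2 M \<Longrightarrow> L2_norm M (A F) \<le> C * L2_norm M F"
    using A by (auto simp: bounded_operator_def bounded_op_set_def)
  from this[OF F] True show ?thesis by simp
next
  case False
  let ?c = "complex_of_real (1 / L2_norm M F)"
  let ?G = "L2_lincomb M ?c F 0 F"
  have "L2_norm M ?G = 1" using False by (simp add: L2_norm_scale F norm_divide)
  then have "L2_norm M (A ?G) \<le> op_norm M A"
    unfolding op_norm_def by (intro Sup_nonneg_upper bounded_operator_bdd_above A) (use F in auto)
  moreover have "L2_norm M (A ?G) = L2_norm M (A F) / L2_norm M F"
    using A F by (simp add: L2_operator_lincomb[OF bounded_operatorD] L2_norm_scale bounded_operator_in norm_divide)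
  ultimately have "L2_norm M (A F) / L2_norm M F \<le> op_norm M A" by simp
  then show ?thesis using False by (subst (asm) pos_divide_le_eq) (auto simp: less_le)
qed

lemma op_norm_le:
  assumes "0 \<le> C" "\<And>F. F \<in> L2 M \<Longrightarrow> L2_norm M (A F) \<le> C * L2_norm M F"
  shows "op_norm M A \<le> C"
  unfolding op_norm_def
proof (rule Sup_nonneg_least[OF assms(1)], clarify)
  fix F assume F: "F \<in> L2 M" "L2_norm M F \<le> 1"
  have "L2_norm M (A F) \<le> C * L2_norm M F" by (rule assms(2)[OF F(1)])
  also have "\<dots> \<le> C" using mult_left_mono[OF F(2) assms(1)] by simp
  finally show "L2_norm M (A F) \<le> C" .
qed

lemma op_norm_sq_le:
  assumes "0 \<le> K" "\<And>F. F \<in> L2 M \<Longrightarrow> (L2_norm M (A F))\<^sup>2 \<le> K * (L2_norm M F)\<^sup>2" "bounded_operator M A"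
  shows "(op_norm M A)\<^sup>2 \<le> K"
proof -
  have "op_norm M A \<le> sqrt K"
  proof (rule op_norm_le)
    fix F assume "F \<in> L2 M"
    from assms(2)[OF this] have "L2_norm M (A F) \<le> sqrt (K * (L2_norm M F)\<^sup>2)" by (rule real_le_rsqrt)
    then show "L2_norm M (A F) \<le> sqrt K * L2_norm M F" by (simp add: real_sqrt_mult)
  qed (use assms in auto)
  then have "(op_norm M A)\<^sup>2 \<le> (sqrt K)\<^sup>2" by (rule power_mono) (use assms in auto)
  then show ?thesis using assms by simp
qed

lemma L2_operator_compose:
  assumes "L2_operator M A" "L2_operator M B" shows "L2_operator M (compose (L2 M) A B)"
  using assms by (auto simp: L2_operator_def compose_def PiE_iff)

lemma bounded_operator_compose:
  assumes A: "bounded_operator M A" and B: "bounded_operator M B"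
  shows "bounded_operator M (compose (L2 M) A B)"
    and "op_norm M (compose (L2 M) A B) \<le> op_norm M A * op_norm M B"
proof -
  have *: "L2_norm M (compose (L2 M) A B F) \<le> (op_norm M A * op_norm M B) * L2_norm M F" if F: "F \<in> L2 M" for F
  proof -
    have "L2_norm M (A (B F)) \<le> op_norm M A * L2_norm M (B F)" by (rule op_norm_bound[OF A bounded_operator_in[OF B F]])
    also have "\<dots> \<le> op_norm M A * (op_norm M B * L2_norm M F)"
      by (rule mult_left_mono[OF op_norm_bound[OF B F] op_norm_nonneg[OF A]])
    finally show ?thesis using F by (simp add: compose_eq mult.assoc)
  qed
  show "bounded_operator M (compose (L2 M) A B)"
    by (rule bounded_operatorI[OF _ *]) (auto intro: L2_operator_compose bounded_operatorD A B)
  show "op_norm M (compose (L2 M) A B) \<le> op_norm M A * op_norm M B"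
    by (rule op_norm_le[OF _ *]) (use A B in auto)
qed

definition op_list_prod :: "'a measure \<Rightarrow> 'a L2_op list \<Rightarrow> 'a L2_op" where
  "op_list_prod M As = foldr (compose (L2 M)) As (restrict id (L2 M))"

abbreviation op_power :: "'a measure \<Rightarrow> 'a L2_op \<Rightarrow> nat \<Rightarrow> 'a L2_op" where
  "op_power M A n \<equiv> op_list_prod M (replicate n A)"

lemma op_list_prod_Nil: "op_list_prod M [] = restrict id (L2 M)"
  by (simp add: op_list_prod_def)

lemma op_list_prod_Cons: "op_list_prod M (A # As) = compose (L2 M) A (op_list_prod M As)"
  by (simp add: op_list_prod_def)

lemma op_list_prod_Nil_apply [simp]: "F \<in> L2 M \<Longrightarrow> op_list_prod M [] F = F"
  by (simp add: op_list_prod_def)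

lemma L2_operator_id: "L2_operator M (op_list_prod M [])"
  by (auto simp: L2_operator_def op_list_prod_Nil)

lemma bounded_operator_id: "bounded_operator M (op_list_prod M [])"
  by (rule bounded_operatorI[of _ _ 1]) (simp_all add: L2_operator_id)

lemma op_norm_id: "op_norm M (op_list_prod M []) \<le> 1"
  by (rule op_norm_le) simp_all

lemma L2_operator_list_prod:
  "(\<And>A. A \<in> set As \<Longrightarrow> L2_operator M A) \<Longrightarrow> L2_operator M (op_list_prod M As)"
  by (induction As) (auto simp: op_list_prod_Cons L2_operator_id L2_operator_compose)

lemma bounded_operator_list_prod:
  "(\<And>A. A \<in> set As \<Longrightarrow> bounded_operator M A) \<Longrightarrow> bounded_operator M (op_list_prod M As)"
  by (induction As) (auto simp: op_list_prod_Cons bounded_operator_id bounded_operator_compose)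

lemma op_norm_list_prod:
  "(\<And>A. A \<in> set As \<Longrightarrow> bounded_operator M A \<and> op_norm M A \<le> C) \<Longrightarrow> op_norm M (op_list_prod M As) \<le> C ^ length As"
proof (induction As)
  case Nil
  then show ?case by (simp add: op_norm_id)
next
  case (Cons A As)
  have b: "bounded_operator M A" "bounded_operator M (op_list_prod M As)"
    using Cons by (auto intro: bounded_operator_list_prod)
  have "op_norm M (op_list_prod M (A # As)) \<le> op_norm M A * op_norm M (op_list_prod M As)"
    unfolding op_list_prod_Cons by (intro bounded_operator_compose b)
  also have "\<dots> \<le> C * C ^ length As"
    using Cons by (intro mult_mono Cons.IH) (auto simp: b intro: order_trans[OF op_norm_nonneg[OF b(1)]])
  finally show ?case by simp
qed

lemma compose_id_left: "L2_operator M A \<Longrightarrow> compose (L2 M) (op_list_prod M []) A = A"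
  by (rule L2_operator_eqI[OF L2_operator_compose[OF L2_operator_id]]) (auto simp: compose_eq L2_operator_in)

lemma compose_id_right: "L2_operator M A \<Longrightarrow> compose (L2 M) A (op_list_prod M []) = A"
  by (rule L2_operator_eqI[OF L2_operator_compose[OF _ L2_operator_id]]) (auto simp: compose_eq L2_operator_in)

lemma op_list_prod_append:
  assumes "\<And>A. A \<in> set As \<union> set Bs \<Longrightarrow> L2_operator M A"
  shows "op_list_prod M (As @ Bs) = compose (L2 M) (op_list_prod M As) (op_list_prod M Bs)"
  using assms
proof (induction As)
  case Nil
  then show ?case by (simp add: compose_id_left L2_operator_list_prod)
next
  case (Cons A As)
  have "L2_operator M (op_list_prod M Bs)" by (rule L2_operator_list_prod) (use Cons.prems in auto)
  then have "op_list_prod M Bs \<in> L2 M \<rightarrow> L2 M" by (auto simp: L2_operator_in)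
  from compose_assoc[OF this, of A "op_list_prod M As"] Cons show ?case
    by (simp add: op_list_prod_Cons)
qed

lemma op_list_prod_single: "L2_operator M A \<Longrightarrow> op_list_prod M [A] = A"
  by (simp add: op_list_prod_Cons compose_id_right)

lemma op_list_prod_concat:
  assumes "\<And>As A. As \<in> set Ass \<Longrightarrow> A \<in> set As \<Longrightarrow> L2_operator M A"
  shows "op_list_prod M (concat Ass) = op_list_prod M (map (op_list_prod M) Ass)"
  using assms
proof (induction Ass)
  case (Cons As Ass)
  have "op_list_prod M (concat (As # Ass)) = compose (L2 M) (op_list_prod M As) (op_list_prod M (concat Ass))"
    unfolding concat.simps by (rule op_list_prod_append) (use Cons.prems in auto)
  moreover have "op_list_prod M (concat Ass) = op_list_prod M (map (op_list_prod M) Ass)"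
    by (rule Cons.IH) (use Cons.prems in auto)
  ultimately show ?case by (simp add: op_list_prod_Cons)
qed simp

lemma op_power_Suc_apply: "F \<in> L2 M \<Longrightarrow> op_power M A (Suc n) F = A (op_power M A n F)"
  by (simp add: op_list_prod_Cons compose_def)

lemma op_power_0_apply: "F \<in> L2 M \<Longrightarrow> op_power M A 0 F = F"
  by simp

lemma op_power_add:
  assumes "L2_operator M A"
  shows "op_power M A (m + n) = compose (L2 M) (op_power M A m) (op_power M A n)"
  unfolding replicate_add by (rule op_list_prod_append) (use assms in auto)

lemma op_power_mult:
  assumes "L2_operator M A" shows "op_power M (op_power M A m) n = op_power M A (m * n)"
proof -
  have "op_power M A (m * n) = op_list_prod M (concat (replicate n (replicate m A)))"
    by (rule arg_cong[of _ _ "op_list_prod M"]) (induction n, simp_all add: replicate_add)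
  also have "\<dots> = op_list_prod M (map (op_list_prod M) (replicate n (replicate m A)))"
    by (rule op_list_prod_concat) (use assms in auto)
  finally show ?thesis by (simp add: map_replicate)
qed

lemma bounded_operator_power: "bounded_operator M A \<Longrightarrow> bounded_operator M (op_power M A n)"
  by (rule bounded_operator_list_prod) auto

lemma op_power_in: "L2_operator M A \<Longrightarrow> F \<in> L2 M \<Longrightarrow> op_power M A n F \<in> L2 M"
  by (rule L2_operator_in[OF L2_operator_list_prod]) auto

lemma op_power_commute:
  assumes "L2_operator M A" "F \<in> L2 M" shows "op_power M A n (A F) = A (op_power M A n F)"
  by (induction n) (use assms in \<open>simp_all add: op_power_Suc_apply op_power_0_apply L2_operator_in del: replicate_Suc\<close>)

section \<open>Neumann series\<close>

text \<open>Limit equations for the resolvent are verified through \<open>L2_eqI\<close>, so norm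
  convergence has to be handed on to inner products.\<close>

lemma L2_inner_tendsto:
  assumes F: "\<And>n. F n \<in> L2 M" and L: "L \<in> L2 M" and H: "H \<in> L2 M"
    and lim: "(\<lambda>n. L2_norm M (L2_lincomb M 1 (F n) (-1) L)) \<longlonglongrightarrow> 0"
  shows "(\<lambda>n. L2_inner M (F n) H) \<longlonglongrightarrow> L2_inner M L H"
proof (rule LIM_zero_cancel, rule Lim_null_comparison)
  show "\<forall>\<^sub>F n in sequentially. norm (L2_inner M (F n) H - L2_inner M L H)
     \<le> L2_norm M (L2_lincomb M 1 (F n) (-1) L) * L2_norm M H"
    using L2_Cauchy_Schwarz[OF L2_lincomb_in[OF F L] H, of 1 _ "-1"]
    by (intro always_eventually) (simp add: L2_inner_lincomb_left F L H)
  show "(\<lambda>n. L2_norm M (L2_lincomb M 1 (F n) (-1) L) * L2_norm M H) \<longlonglongrightarrow> 0"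
    by (intro tendsto_mult_left_zero lim)
qed

lemma op_tendsto:
  assumes A: "bounded_operator M A" and F: "\<And>n. F n \<in> L2 M" and L: "L \<in> L2 M"
    and lim: "(\<lambda>n. L2_norm M (L2_lincomb M 1 (F n) (-1) L)) \<longlonglongrightarrow> 0"
  shows "(\<lambda>n. L2_norm M (L2_lincomb M 1 (A (F n)) (-1) (A L))) \<longlonglongrightarrow> 0"
proof (rule Lim_null_comparison)
  show "\<forall>\<^sub>F n in sequentially. norm (L2_norm M (L2_lincomb M 1 (A (F n)) (-1) (A L)))
     \<le> op_norm M A * L2_norm M (L2_lincomb M 1 (F n) (-1) L)"
    using op_norm_bound[OF A L2_lincomb_in[OF F L], of 1 _ "-1"]
    by (intro always_eventually) (simp add: L2_operator_lincomb[OF bounded_operatorD[OF A]] F L)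
  show "(\<lambda>n. op_norm M A * L2_norm M (L2_lincomb M 1 (F n) (-1) L)) \<longlonglongrightarrow> 0"
    by (intro tendsto_mult_right_zero lim)
qed

text \<open>Partial sums of the Neumann series: step n is the sum over k < n of (1 / z) ^ (k + 1)
  times A ^ k F. Writing them as fixed-point iteration for z X = F + A X avoids finite sums of
  equivalence classes.\<close>

fun neumann_iter :: "'a measure \<Rightarrow> 'a L2_op \<Rightarrow> complex \<Rightarrow> nat \<Rightarrow> 'a L2_op" where
  "neumann_iter M A z 0 F = L2_zero M"
| "neumann_iter M A z (Suc n) F = L2_lincomb M (1 / z) F (1 / z) (A (neumann_iter M A z n F))"

lemma neumann_iter_in:
  assumes "L2_operator M A" "F \<in> L2 M" shows "neumann_iter M A z n F \<in> L2 M"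
  by (induction n) (use assms in \<open>auto simp: L2_operator_in\<close>)

lemma L2_operator_zero:
  assumes "L2_operator M A" shows "A (L2_zero M) = L2_zero M"
proof -
  have "L2_zero M = L2_lincomb M 0 (L2_zero M) 0 (L2_zero M)"
    by (rule L2_eqI) (auto simp: L2_inner_lincomb_left)
  then have "A (L2_zero M) = L2_lincomb M 0 (A (L2_zero M)) 0 (A (L2_zero M))"
    using L2_operator_lincomb[OF assms L2_zero_in L2_zero_in, of 0 0] by simp
  also have "\<dots> = L2_zero M"
    by (rule L2_eqI) (auto simp: L2_inner_lincomb_left L2_operator_in assms)
  finally show ?thesis .
qed

text \<open>Applying A to an increment and dividing by z gives the next increment. The right side is
  the n-th term of the Neumann series.\<close>

lemma neumann_iter_diff:
  assumes A: "L2_operator M A" and F: "F \<in> L2 M"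
  shows "L2_lincomb M 1 (neumann_iter M A z (Suc n) F) (-1) (neumann_iter M A z n F)
    = L2_lincomb M ((1 / z) ^ Suc n) (op_power M A n F) 0 (op_power M A n F)"
proof (induction n)
  case 0
  show ?case by (rule L2_eqI) (use A F in \<open>auto simp: op_power_0_apply L2_operator_zero L2_inner_lincomb_left\<close>)
next
  case (Suc n)
  let ?S = "neumann_iter M A z"
  note [simp] = F L2_operator_in[OF A] neumann_iter_in[OF A F] op_power_in[OF A]
  have "L2_lincomb M 1 (A (?S (Suc n) F)) (-1) (A (?S n F)) =
    A (L2_lincomb M 1 (?S (Suc n) F) (-1) (?S n F))"
    by (rule L2_operator_lincomb[OF A, symmetric]) (simp_all del: neumann_iter.simps)
  also have "\<dots> = A (L2_lincomb M ((1 / z) ^ Suc n) (op_power M A n F) 0 (op_power M A n F))"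
    by (simp only: Suc)
  also have "\<dots> = L2_lincomb M ((1 / z) ^ Suc n) (op_power M A (Suc n) F) 0 (op_power M A (Suc n) F)"
    by (simp add: L2_operator_lincomb[OF A] op_power_Suc_apply del: replicate_Suc power_Suc)
  finally have eq: "L2_lincomb M 1 (A (?S (Suc n) F)) (-1) (A (?S n F)) =
    L2_lincomb M ((1 / z) ^ Suc n) (op_power M A (Suc n) F) 0 (op_power M A (Suc n) F)" .
  show ?case
  proof (rule L2_eqI)
    fix H assume H: "H \<in> L2 M"
    have "L2_inner M (A (?S (Suc n) F)) H - L2_inner M (A (?S n F)) H = (1 / z) ^ Suc n * L2_inner M (op_power M A (Suc n) F) H"
      using arg_cong[OF eq, of "\<lambda>G. L2_inner M G H"] H
      by (simp add: L2_inner_lincomb_left del: replicate_Suc power_Suc neumann_iter.simps)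
    then show "L2_inner M (L2_lincomb M 1 (?S (Suc (Suc n)) F) (-1) (?S (Suc n) F)) H =
      L2_inner M (L2_lincomb M ((1 / z) ^ Suc (Suc n)) (op_power M A (Suc n) F) 0 (op_power M A (Suc n) F)) H"
      using H
      by (simp add: L2_inner_lincomb_left algebra_simps
          neumann_iter.simps(2)[of M A z "Suc n"] neumann_iter.simps(2)[of M A z "n"]
          del: replicate_Suc neumann_iter.simps)
  qed (auto simp del: neumann_iter.simps replicate_Suc)
qed

lemma neumann_iter_lincomb:
  assumes A: "L2_operator M A" and F: "F \<in> L2 M" and G: "G \<in> L2 M"
  shows "neumann_iter M A z n (L2_lincomb M c F d G) =
    L2_lincomb M c (neumann_iter M A z n F) d (neumann_iter M A z n G)"
proof (induction n)
  case (Suc n)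
  then show ?case
    by (intro L2_eqI)
      (auto simp: L2_operator_lincomb[OF A] L2_inner_lincomb_left L2_operator_in[OF A] neumann_iter_in[OF A] F G algebra_simps)
next
  case 0
  show ?case by (rule L2_eqI) (auto simp: L2_inner_lincomb_left)
qed

lemma neumann_iter_commute:
  assumes A: "L2_operator M A" and F: "F \<in> L2 M"
  shows "neumann_iter M A z n (A F) = A (neumann_iter M A z n F)"
  by (induction n) (simp_all add: L2_operator_zero[OF A] L2_operator_lincomb[OF A] L2_operator_in[OF A] neumann_iter_in[OF A] F)

text \<open>The Neumann series converges geometrically with ratio t / |z|, and its sum inverts z -
  A. The inverse is built vector by vector as a limit; linearity, boundedness and the inverse
  equations are then passed to the limit.\<close>

lemma not_in_op_spectrum:
  assumes A: "bounded_operator M A" and t: "0 \<le> t" "\<And>n. op_norm M (op_power M A n) \<le> C * t ^ n" and z: "t < cmod z"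
  shows "z \<notin> op_spectrum M A"
proof -
  note L = bounded_operatorD[OF A]
  let ?S = "neumann_iter M A z"
  have z0: "z \<noteq> 0" using z t by auto
  \<comment> \<open>\<open>q n\<close> times the norm of F bounds the n-th term of the series at
    F.\<close>
  define q where "q = (\<lambda>n. C / cmod z * (t / cmod z) ^ n)"
  have "norm (t / cmod z) < 1" using z t(1) by (simp add: abs_of_nonneg divide_less_eq)
  then have sq: "summable q" unfolding q_def by (intro summable_mult summable_geometric)
  have C0: "0 \<le> C"
    using order_trans[OF op_norm_nonneg[OF bounded_operator_power[OF A, of 0]] t(2)[of 0]] by simp
  have q0: "0 \<le> q n" for n unfolding q_def using C0 t by auto
  have diff: "L2_norm M (L2_lincomb M 1 (?S (Suc n) F) (-1) (?S n F)) \<le> q n * L2_norm M F" if F: "F \<in> L2 M" for F n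
  proof -
    have "L2_norm M (op_power M A n F) \<le> C * t ^ n * L2_norm M F"
      by (rule order_trans[OF op_norm_bound[OF bounded_operator_power[OF A] F]]) (intro mult_right_mono t, simp)
    then have "L2_norm M (op_power M A n F) / cmod z ^ Suc n \<le> C * t ^ n * L2_norm M F / cmod z ^ Suc n"
      by (rule divide_right_mono) simp
    then show ?thesis unfolding neumann_iter_diff[OF L F]
      by (subst L2_norm_scale) (auto simp: op_power_in[OF L F] norm_power norm_divide norm_mult q_def power_divide field_simps)
  qed
  have "\<exists>B. \<forall>F\<in>L2 M. B F \<in> L2 M \<and> (\<lambda>n. L2_norm M (L2_lincomb M 1 (?S n F) (-1) (B F))) \<longlonglongrightarrow> 0"
  proof (intro bchoice ballI)
    fix F assume F: "F \<in> L2 M"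
    have "summable (\<lambda>n. L2_norm M (L2_lincomb M 1 (?S (Suc n) F) (-1) (?S n F)))"
      by (rule summable_comparison_test'[OF summable_mult2[OF sq, of "L2_norm M F"]]) (use diff[OF F] in \<open>auto simp del: neumann_iter.simps\<close>)
    from L2_complete[OF neumann_iter_in[OF L F] this] show "\<exists>y. y \<in> L2 M \<and> (\<lambda>n. L2_norm M (L2_lincomb M 1 (?S n F) (-1) y)) \<longlonglongrightarrow> 0"
      by metis
  qed
  then obtain B0 where "\<And>F. F \<in> L2 M \<Longrightarrow> B0 F \<in> L2 M"
    "\<And>F. F \<in> L2 M \<Longrightarrow> (\<lambda>n. L2_norm M (L2_lincomb M 1 (?S n F) (-1) (B0 F))) \<longlonglongrightarrow> 0" by auto
  moreover define B where "B = restrict B0 (L2 M)"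
  ultimately have Bin: "\<And>F. F \<in> L2 M \<Longrightarrow> B F \<in> L2 M"
    and Blim: "\<And>F. F \<in> L2 M \<Longrightarrow> (\<lambda>n. L2_norm M (L2_lincomb M 1 (?S n F) (-1) (B F))) \<longlonglongrightarrow> 0"
    by auto
  note [simp] = Bin neumann_iter_in[OF L] L2_operator_in[OF L]
  have w: "(\<lambda>n. L2_inner M (?S n F) H) \<longlonglongrightarrow> L2_inner M (B F) H" if "F \<in> L2 M" "H \<in> L2 M" for F H
    by (rule L2_inner_tendsto) (use that Blim in auto)
  have wA: "(\<lambda>n. L2_inner M (A (?S n F)) H) \<longlonglongrightarrow> L2_inner M (A (B F)) H" if "F \<in> L2 M" "H \<in> L2 M" for F H
    by (rule L2_inner_tendsto[OF _ _ _ op_tendsto[OF A]]) (use that Blim in auto)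
  have lin: "B (L2_lincomb M c F d G) = L2_lincomb M c (B F) d (B G)" if FG: "F \<in> L2 M" "G \<in> L2 M" for F G c d
  proof (rule L2_eqI)
    fix H assume H: "H \<in> L2 M"
    have "(\<lambda>n. c * L2_inner M (?S n F) H + d * L2_inner M (?S n G) H) \<longlonglongrightarrow> L2_inner M (B (L2_lincomb M c F d G)) H"
      using w[OF L2_lincomb_in[OF FG] H, of c d] FG H by (simp add: neumann_iter_lincomb[OF L] L2_inner_lincomb_left)
    moreover have "(\<lambda>n. c * L2_inner M (?S n F) H + d * L2_inner M (?S n G) H) \<longlonglongrightarrow> c * L2_inner M (B F) H + d * L2_inner M (B G) H"
      by (intro tendsto_intros w FG H)
    ultimately show "L2_inner M (B (L2_lincomb M c F d G)) H = L2_inner M (L2_lincomb M c (B F) d (B G)) H"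
      using FG H LIMSEQ_unique by (simp add: L2_inner_lincomb_left)
  qed (use FG in auto)
  have opB: "L2_operator M B" unfolding L2_operator_def
  proof (intro conjI ballI allI)
    show "B \<in> L2 M \<rightarrow>\<^sub>E L2 M" by (rule PiE_I) (simp_all only: Bin, simp add: B_def)
  qed (rule lin)
  have bB: "L2_norm M (B F) \<le> suminf q * L2_norm M F" if F: "F \<in> L2 M" for F
  proof -
    have S: "L2_norm M (?S n F) \<le> (\<Sum>k<n. q k) * L2_norm M F" for n
    proof (induction n)
      case (Suc n)
      have "?S (Suc n) F = L2_lincomb M 1 (?S n F) 1 (L2_lincomb M 1 (?S (Suc n) F) (-1) (?S n F))"
        by (rule L2_eqI) (auto simp: L2_inner_lincomb_left F simp del: neumann_iter.simps)
      then have "L2_norm M (?S (Suc n) F) \<le> L2_norm M (?S n F) + L2_norm M (L2_lincomb M 1 (?S (Suc n) F) (-1) (?S n F))"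
        using L2_norm_lincomb[of "?S n F" M "L2_lincomb M 1 (?S (Suc n) F) (-1) (?S n F)" 1 1] F
        by (simp del: neumann_iter.simps)
      with Suc diff[OF F, of n] show ?case by (simp add: algebra_simps del: neumann_iter.simps)
    qed simp
    have "L2_norm M (B F) \<le> suminf q * L2_norm M F + L2_norm M (L2_lincomb M 1 (?S n F) (-1) (B F))" for n
    proof -
      have "B F = L2_lincomb M 1 (?S n F) (-1) (L2_lincomb M 1 (?S n F) (-1) (B F))"
        by (rule L2_eqI) (auto simp: L2_inner_lincomb_left F)
      then have "L2_norm M (B F) \<le> L2_norm M (?S n F) + L2_norm M (L2_lincomb M 1 (?S n F) (-1) (B F))"
        using L2_norm_lincomb[of "?S n F" M "L2_lincomb M 1 (?S n F) (-1) (B F)" 1 "-1"] F by simp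
      also have "L2_norm M (?S n F) \<le> suminf q * L2_norm M F"
        by (rule order_trans[OF S]) (intro mult_right_mono sum_le_suminf sq; simp add: q0)
      finally show ?thesis by simp
    qed
    moreover have "(\<lambda>n. suminf q * L2_norm M F + L2_norm M (L2_lincomb M 1 (?S n F) (-1) (B F))) \<longlonglongrightarrow> suminf q * L2_norm M F + 0"
      by (intro tendsto_intros Blim F)
    ultimately show ?thesis by (intro LIMSEQ_le_const[of _ "suminf q * L2_norm M F"]) auto
  qed
  \<comment> \<open>The limit of the recursion z S_(n+1) = F + A S_n, tested against H.\<close>
  have eq1: "z * L2_inner M (B F) H = L2_inner M F H + L2_inner M (A (B F)) H" if F: "F \<in> L2 M" and H: "H \<in> L2 M" for F H
  proof -
    have "(\<lambda>n. z * L2_inner M (?S (Suc n) F) H) \<longlonglongrightarrow> z * L2_inner M (B F) H"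
      by (intro tendsto_intros LIMSEQ_Suc w F H)
    moreover have "z * L2_inner M (?S (Suc n) F) H = L2_inner M F H + L2_inner M (A (?S n F)) H" for n
      using z0 F H by (simp add: L2_inner_lincomb_left field_simps)
    moreover have "(\<lambda>n. L2_inner M F H + L2_inner M (A (?S n F)) H) \<longlonglongrightarrow> L2_inner M F H + L2_inner M (A (B F)) H"
      by (intro tendsto_intros wA F H)
    ultimately show ?thesis using LIMSEQ_unique by fastforce
  qed
  \<comment> \<open>The iterates commute with A, hence so does B; this turns the right inverse
    equation \<open>inv\<close> into the left one.\<close>
  have eq2: "B (A F) = A (B F)" if F: "F \<in> L2 M" for F
  proof (rule L2_eqI)
    fix H assume H: "H \<in> L2 M"
    show "L2_inner M (B (A F)) H = L2_inner M (A (B F)) H"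
      using w[of "A F" H] wA[OF F H] F H LIMSEQ_unique by (auto simp: neumann_iter_commute[OF L])
  qed (use F in auto)
  have inv: "L2_lincomb M z (B F) (-1) (A (B F)) = F" if F: "F \<in> L2 M" for F
    by (rule L2_eqI) (use F eq1 in \<open>auto simp: L2_inner_lincomb_left\<close>)
  have "L2_operator M B \<and> bounded_op_set M {B} \<and>
     (\<forall>F\<in>L2 M. B (L2_lincomb M z F (-1) (A F)) = F \<and> L2_lincomb M z (B F) (-1) (A (B F)) = F)"
    using opB bounded_operatorI[OF opB bB] by (auto simp: lin eq2 inv bounded_operator_def)
  then show ?thesis unfolding op_spectrum_def by blast
qed

text \<open>The elementary half of Gelfand's formula.\<close>

lemma op_spectral_radius_le:
  assumes "bounded_operator M A" and "0 \<le> t" "\<And>n. op_norm M (op_power M A n) \<le> C * t ^ n"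
  shows "op_spectral_radius M A \<le> t"
  unfolding op_spectral_radius_def
  by (rule Sup_nonneg_least) (use not_in_op_spectrum[OF assms] assms(2) in \<open>force simp: not_less[symmetric]\<close>)+

lemma op_norm_power_le:
  assumes "bounded_operator M A" shows "op_norm M (op_power M A n) \<le> op_norm M A ^ n"
  using op_norm_list_prod[of "replicate n A" M "op_norm M A"] assms by (auto simp del: op_norm_nonneg)

lemma op_spectral_radius_le_norm:
  assumes "bounded_operator M A" shows "op_spectral_radius M A \<le> op_norm M A"
  by (rule op_spectral_radius_le[where C=1]) (use assms op_norm_power_le in auto)

lemma op_spectrum_le_norm: "bounded_operator M A \<Longrightarrow> z \<in> op_spectrum M A \<Longrightarrow> cmod z \<le> op_norm M A"
  using not_in_op_spectrum[of M A "op_norm M A" 1 z] op_norm_power_le[of M A] by fastforce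

lemma op_spectrum_bdd: "bounded_operator M A \<Longrightarrow> bdd_above (cmod ` op_spectrum M A)"
  using op_spectrum_le_norm by (intro bdd_aboveI[of _ "op_norm M A"]) auto

lemma op_spectral_radius_nonneg [simp]: "bounded_operator M A \<Longrightarrow> 0 \<le> op_spectral_radius M A"
  unfolding op_spectral_radius_def by (intro Sup_nonneg_ge_0 op_spectrum_bdd)

lemma op_spectrum_le_radius: "bounded_operator M A \<Longrightarrow> z \<in> op_spectrum M A \<Longrightarrow> cmod z \<le> op_spectral_radius M A"
  unfolding op_spectral_radius_def by (intro Sup_nonneg_upper op_spectrum_bdd) auto

section \<open>Resolvents\<close>

text \<open>Here \<open>R\<close> is the inverse of \<open>1 - u A\<close> rather than of \<open>z - A\<close>, so that the power series at \<open>u = 0\<close> has the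
  powers of \<open>A\<close> as coefficients.\<close>

definition resolvent :: "'a measure \<Rightarrow> 'a L2_op \<Rightarrow> complex \<Rightarrow> 'a L2_op \<Rightarrow> bool" where
  "resolvent M A u R \<longleftrightarrow> bounded_operator M R \<and>
     (\<forall>F\<in>L2 M. R (L2_lincomb M 1 F (-u) (A F)) = F \<and> L2_lincomb M 1 (R F) (-u) (A (R F)) = F)"

lemma resolvent_zero: "L2_operator M A \<Longrightarrow> resolvent M A 0 (op_list_prod M [])"
  unfolding resolvent_def
proof (intro conjI ballI bounded_operator_id)
  fix F assume "L2_operator M A" and F: "F \<in> L2 M"
  note [simp] = L2_operator_in[OF this]
  show "op_list_prod M [] (L2_lincomb M 1 F (- 0) (A F)) = F"
    "L2_lincomb M 1 (op_list_prod M [] F) (- 0) (A (op_list_prod M [] F)) = F"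
    using F by (simp_all add: L2_eqI[of _ M] L2_inner_lincomb_left)
qed

text \<open>For nonzero u, 1 - u A is u times (1 / u - A), so the inverse of 1 / u - A divided by u
  serves; the hypothesis keeps 1 / u outside the spectrum.\<close>

lemma resolvent_exists:
  assumes A: "bounded_operator M A" and u: "cmod u * op_spectral_radius M A < 1"
  shows "\<exists>R. resolvent M A u R"
proof (cases "u = 0")
  case True
  then show ?thesis using resolvent_zero[OF bounded_operatorD[OF A]] by auto
next
  case False
  note L = bounded_operatorD[OF A]
  have "op_spectral_radius M A < cmod (1 / u)" using u False by (simp add: norm_divide field_simps)
  then have "1 / u \<notin> op_spectrum M A" using op_spectrum_le_radius[OF A] by fastforce
  then obtain B where B': "L2_operator M B \<and> bounded_op_set M {B} \<and>
     (\<forall>F\<in>L2 M. B (L2_lincomb M (1 / u) F (-1) (A F)) = F \<and> L2_lincomb M (1 / u) (B F) (-1) (A (B F)) = F)"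
    unfolding op_spectrum_def mem_Collect_eq not_not by (elim exE)
  then have B: "L2_operator M B" "bounded_op_set M {B}"
    "\<And>F. F \<in> L2 M \<Longrightarrow> B (L2_lincomb M (1 / u) F (-1) (A F)) = F"
    "\<And>F. F \<in> L2 M \<Longrightarrow> L2_lincomb M (1 / u) (B F) (-1) (A (B F)) = F" by simp_all
  have bB: "bounded_operator M B" using B by (simp add: bounded_operator_def)
  note [simp] = L2_operator_in[OF B(1)] L2_operator_in[OF L]
  define R where "R = restrict (\<lambda>F. L2_lincomb M (1 / u) (B F) 0 (B F)) (L2 M)"
  have R: "R F = L2_lincomb M (1 / u) (B F) 0 (B F)" if "F \<in> L2 M" for F using that by (simp add: R_def)
  have "L2_operator M R" unfolding L2_operator_def
  proof (intro conjI ballI allI)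
    show "R \<in> L2 M \<rightarrow>\<^sub>E L2 M" by (auto simp: R_def)
    fix F G c d assume FG: "F \<in> L2 M" "G \<in> L2 M"
    show "R (L2_lincomb M c F d G) = L2_lincomb M c (R F) d (R G)"
      by (rule L2_eqI[of _ M]) (use FG in \<open>simp_all add: R L2_operator_lincomb[OF B(1)] L2_inner_lincomb_left algebra_simps add_divide_distrib\<close>)
  qed
  then have bR: "bounded_operator M R"
  proof (rule bounded_operatorI)
    fix F assume F: "F \<in> L2 M"
    have "L2_norm M (R F) = cmod (1 / u) * L2_norm M (B F)" using F by (simp add: R L2_norm_scale)
    also have "\<dots> \<le> cmod (1 / u) * (op_norm M B * L2_norm M F)"
      by (intro mult_left_mono op_norm_bound[OF bB F]) auto
    finally show "L2_norm M (R F) \<le> (cmod (1 / u) * op_norm M B) * L2_norm M F" by (simp add: mult.assoc)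
  qed
  have "R (L2_lincomb M 1 F (-u) (A F)) = F" if F: "F \<in> L2 M" for F
  proof -
    have "L2_lincomb M 1 F (-u) (A F) = L2_lincomb M u (L2_lincomb M (1 / u) F (-1) (A F)) 0 F"
      by (rule L2_eqI[of _ M]) (use F False in \<open>simp_all add: L2_inner_lincomb_left field_simps\<close>)
    then have "B (L2_lincomb M 1 F (-u) (A F)) = L2_lincomb M u F 0 (B F)"
      using F by (simp add: L2_operator_lincomb[OF B(1), of "L2_lincomb M (1 / u) F (-1) (A F)" F] B(3))
    then show ?thesis
      by (intro L2_eqI[of _ M]) (use F False in \<open>simp_all add: R L2_inner_lincomb_left\<close>)
  qed
  moreover have "L2_lincomb M 1 (R F) (-u) (A (R F)) = F" if F: "F \<in> L2 M" for F
  proof (rule L2_eqI[of _ M])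
    fix H assume H: "H \<in> L2 M"
    show "L2_inner M (L2_lincomb M 1 (R F) (-u) (A (R F))) H = L2_inner M F H"
      using arg_cong[OF B(4)[OF F], of "\<lambda>G. L2_inner M G H"] F H False
      by (simp add: R L2_operator_lincomb[OF L] L2_inner_lincomb_left field_simps)
  qed (use F in \<open>simp_all add: R\<close>)
  ultimately have "resolvent M A u R" using bR by (simp add: resolvent_def)
  then show ?thesis by blast
qed

section \<open>Holomorphy of the resolvent, with the powers of the operator as Taylor
  coefficients\<close>

context
  fixes M :: "'a measure" and A :: "'a L2_op" and R :: "complex \<Rightarrow> 'a L2_op" and U :: "complex set"
  assumes A: "bounded_operator M A" and R: "\<And>u. u \<in> U \<Longrightarrow> resolvent M A u (R u)" and U: "open U" "0 \<in> U"
begin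

lemma resolvent_bounded: "u \<in> U \<Longrightarrow> bounded_operator M (R u)"
  using R by (simp add: resolvent_def)

lemma resolvent_in: "u \<in> U \<Longrightarrow> F \<in> L2 M \<Longrightarrow> R u F \<in> L2 M"
  by (rule bounded_operator_in[OF resolvent_bounded])

lemma resolvent_A_in: "F \<in> L2 M \<Longrightarrow> A F \<in> L2 M"
  by (rule bounded_operator_in[OF A])

lemma resolvent_right: "u \<in> U \<Longrightarrow> F \<in> L2 M \<Longrightarrow> H \<in> L2 M \<Longrightarrow>
  L2_inner M (R u F) H = L2_inner M F H + u * L2_inner M (A (R u F)) H"
  using L2_inner_lincomb_left[OF resolvent_in resolvent_A_in[OF resolvent_in], of u F u F H 1 "-u"] R[of u]
  by (simp add: resolvent_def)

text \<open>The left inverse equation moves A to the argument F; this drives the induction for the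
  Taylor coefficients in \<open>resolvent_higher_deriv\<close>.\<close>

lemma resolvent_left:
  assumes "u \<in> U" "F \<in> L2 M" "H \<in> L2 M"
  shows "L2_inner M (R u F) H = L2_inner M F H + u * L2_inner M (R u (A F)) H"
proof -
  have "R u (L2_lincomb M 1 F (-u) (A F)) = L2_lincomb M 1 (R u F) (-u) (R u (A F))"
    by (rule L2_operator_lincomb[OF bounded_operatorD[OF resolvent_bounded]]) (simp_all add: assms resolvent_A_in)
  moreover have "R u (L2_lincomb M 1 F (-u) (A F)) = F" using R[of u] assms by (simp add: resolvent_def)
  ultimately show ?thesis
    using L2_inner_lincomb_left[OF resolvent_in resolvent_in[OF _ resolvent_A_in], of u F u F H 1 "-u"] assms
    by simp
qed

text \<open>The first resolvent identity: apply R w to (1 - w A) R u F, which equals F + (u - w) A R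
  u F.\<close>

lemma resolvent_identity:
  assumes u: "u \<in> U" and w: "w \<in> U" and F: "F \<in> L2 M"
  shows "R u F = L2_lincomb M 1 (R w F) (u - w) (R w (A (R u F)))"
proof -
  note [simp] = u w F resolvent_in resolvent_A_in
  have "R u F = R w (L2_lincomb M 1 (R u F) (-w) (A (R u F)))"
    using R[of w] by (simp add: resolvent_def)
  also have "L2_lincomb M 1 (R u F) (-w) (A (R u F)) = L2_lincomb M 1 F (u - w) (A (R u F))"
    by (rule L2_eqI[of _ M]) (simp_all add: L2_inner_lincomb_left resolvent_right[OF u F] algebra_simps)
  also have "R w \<dots> = L2_lincomb M 1 (R w F) (u - w) (R w (A (R u F)))"
    by (rule L2_operator_lincomb[OF bounded_operatorD[OF resolvent_bounded]]) simp_all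
  finally show ?thesis .
qed

text \<open>In the resolvent identity centred at u the correction term contains R w itself; near u
  its factor is at most 1 / 2, so it can be absorbed on the left. No continuity of R is presupposed,
  as the family was merely chosen pointwise.\<close>

lemma resolvent_locally_bounded:
  assumes u: "u \<in> U"
  obtains d K where "0 < d" "0 \<le> K" "\<And>w F. w \<in> U \<Longrightarrow> dist w u < d \<Longrightarrow> F \<in> L2 M \<Longrightarrow> L2_norm M (R w F) \<le> K * L2_norm M F"
proof -
  let ?K = "op_norm M (R u)" and ?a = "op_norm M A"
  have K: "0 \<le> ?K" "0 \<le> ?a" using resolvent_bounded[OF u] A by auto
  \<comment> \<open>Chosen so that d times \<open>?K * ?a\<close> is at most 1 / 2, also when that
    product vanishes.\<close>
  define d where "d = 1 / (2 * (?K * ?a + 1))"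
  have d: "0 < d" unfolding d_def using K by (simp add: add_nonneg_pos)
  have "L2_norm M (R w F) \<le> (2 * ?K) * L2_norm M F" if w: "w \<in> U" "dist w u < d" and F: "F \<in> L2 M" for w F
  proof -
    note [simp] = u w(1) F resolvent_in resolvent_A_in
    have "L2_norm M (R u (A (R w F))) \<le> ?K * L2_norm M (A (R w F))"
      by (rule op_norm_bound[OF resolvent_bounded]) simp_all
    also have "\<dots> \<le> ?K * (?a * L2_norm M (R w F))"
      by (rule mult_left_mono[OF op_norm_bound[OF A] K(1)]) simp
    finally have 1: "L2_norm M (R u (A (R w F))) \<le> ?K * (?a * L2_norm M (R w F))" .
    have "L2_norm M (R w F) \<le> 1 * L2_norm M (R u F) + cmod (w - u) * L2_norm M (R u (A (R w F)))"
      using L2_norm_lincomb[of "R u F" M "R u (A (R w F))" 1 "w - u"] resolvent_identity[OF w(1) u F] by simp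
    also have "\<dots> \<le> ?K * L2_norm M F + d * (?K * (?a * L2_norm M (R w F)))"
    proof (rule add_mono)
      show "1 * L2_norm M (R u F) \<le> ?K * L2_norm M F"
        using op_norm_bound[OF resolvent_bounded[OF u] F] by simp
      show "cmod (w - u) * L2_norm M (R u (A (R w F))) \<le> d * (?K * (?a * L2_norm M (R w F)))"
        using w(2) by (intro mult_mono 1) (use d in \<open>auto simp: dist_norm\<close>)
    qed
    also have "d * (?K * (?a * L2_norm M (R w F))) = (d * (?K * ?a)) * L2_norm M (R w F)" by simp
    also have "\<dots> \<le> 1 / 2 * L2_norm M (R w F)"
    proof (rule mult_right_mono)
      show "d * (?K * ?a) \<le> 1 / 2" unfolding d_def using K by (simp add: field_simps add_pos_nonneg)
    qed simp
    finally show ?thesis by simp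
  qed
  then show ?thesis using that[of d "2 * ?K"] d K by auto
qed

lemma resolvent_uniformly_bounded:
  assumes S: "compact S" "S \<subseteq> U"
  obtains K where "0 \<le> K" "\<And>w F. w \<in> S \<Longrightarrow> F \<in> L2 M \<Longrightarrow> L2_norm M (R w F) \<le> K * L2_norm M F"
proof -
  have "\<forall>u\<in>S. \<exists>d K. 0 < d \<and> 0 \<le> K \<and> (\<forall>w F. w \<in> U \<longrightarrow> dist w u < d \<longrightarrow> F \<in> L2 M \<longrightarrow> L2_norm M (R w F) \<le> K * L2_norm M F)"
    using resolvent_locally_bounded S(2) by (metis subsetD)
  then obtain d K where dK: "\<And>u. u \<in> S \<Longrightarrow> 0 < d u" "\<And>u. u \<in> S \<Longrightarrow> 0 \<le> K u"
    "\<And>u w F. u \<in> S \<Longrightarrow> w \<in> U \<Longrightarrow> dist w u < d u \<Longrightarrow> F \<in> L2 M \<Longrightarrow> L2_norm M (R w F) \<le> K u * L2_norm M F"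
    by metis
  have "S \<subseteq> (\<Union>u\<in>S. ball u (d u))" using dK(1) by (auto intro!: bexI)
  then obtain S' where S': "S' \<subseteq> S" "finite S'" "S \<subseteq> (\<Union>u\<in>S'. ball u (d u))"
    by (rule compactE_image[OF S(1), rotated]) auto
  show ?thesis
  \<comment> \<open>The sum of the finitely many nonnegative local bounds serves as a common upper
    bound.\<close>
  proof (rule that[of "\<Sum>u\<in>S'. K u"])
    show "0 \<le> (\<Sum>u\<in>S'. K u)" using dK(2) S' by (auto intro!: sum_nonneg)
    fix w F assume w: "w \<in> S" and F: "F \<in> L2 M"
    then obtain u where u: "u \<in> S'" "dist w u < d u" using S'(3) by (auto simp: dist_commute)
    have "L2_norm M (R w F) \<le> K u * L2_norm M F" by (rule dK(3)) (use u S' S w F in auto)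
    also have "\<dots> \<le> (\<Sum>u\<in>S'. K u) * L2_norm M F"
      by (rule mult_right_mono[OF member_le_sum]) (use u S' dK(2) in auto)
    finally show "L2_norm M (R w F) \<le> (\<Sum>u\<in>S'. K u) * L2_norm M F" .
  qed
qed

text \<open>The resolvent identity turns the difference quotient into an inner product with R w; a
  second use of it replaces R w by R u with an error of order w - u, controlled by the local bound.
  Only scalar functions are differentiated, which spares operator-valued calculus.\<close>

lemma resolvent_has_derivative:
  assumes u: "u \<in> U" and F: "F \<in> L2 M" and G: "G \<in> L2 M"
  shows "((\<lambda>u. L2_inner M (R u F) G) has_field_derivative L2_inner M (R u (A (R u F))) G) (at u)"
proof -
  note [simp] = u F G resolvent_in resolvent_A_in
  let ?P = "R u (A (R u F))" and ?Q = "A (R u (A (R u F)))"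
  obtain d K where d: "0 < d" "0 \<le> K" "\<And>w F. w \<in> U \<Longrightarrow> dist w u < d \<Longrightarrow> F \<in> L2 M \<Longrightarrow> L2_norm M (R w F) \<le> K * L2_norm M F"
    using resolvent_locally_bounded[OF u] by metis
  obtain e where e: "0 < e" "ball u e \<subseteq> U" using U(1) u unfolding open_contains_ball by blast
  have key: "norm ((L2_inner M (R w F) G - L2_inner M (R u F) G) / (w - u) - L2_inner M ?P G)
      \<le> cmod (w - u) * (K * L2_norm M ?Q * L2_norm M G)" if w: "w \<noteq> u" "dist w u < min d e" for w
  proof -
    have wU: "w \<in> U" using w e by (auto simp: dist_commute)
    note [simp] = wU
    let ?X = "R w (A (R u F))"
    have "L2_inner M (R u F) G = L2_inner M (R w F) G + (u - w) * L2_inner M ?X G"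
      by (subst resolvent_identity[OF u wU F]) (simp add: L2_inner_lincomb_left)
    then have a: "(L2_inner M (R w F) G - L2_inner M (R u F) G) / (w - u) = L2_inner M ?X G"
      using w(1) by (simp add: field_simps)
    have "L2_inner M ?P G = L2_inner M ?X G + (u - w) * L2_inner M (R w ?Q) G"
      by (subst resolvent_identity[OF u wU, of "A (R u F)"]) (simp_all add: L2_inner_lincomb_left)
    then have "L2_inner M ?X G - L2_inner M ?P G = (w - u) * L2_inner M (R w ?Q) G" by (simp add: algebra_simps)
    then have "norm (L2_inner M ?X G - L2_inner M ?P G) = cmod (w - u) * cmod (L2_inner M (R w ?Q) G)" by (simp add: norm_mult)
    also have "\<dots> \<le> cmod (w - u) * (L2_norm M (R w ?Q) * L2_norm M G)"
      by (rule mult_left_mono[OF L2_Cauchy_Schwarz]) simp_all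
    also have "\<dots> \<le> cmod (w - u) * (K * L2_norm M ?Q * L2_norm M G)"
      using w by (intro mult_left_mono mult_right_mono d(3)) auto
    finally show ?thesis unfolding a .
  qed
  show ?thesis unfolding has_field_derivative_iff
  proof (rule LIM_zero_cancel, rule Lim_null_comparison)
    show "\<forall>\<^sub>F w in at u. norm ((L2_inner M (R w F) G - L2_inner M (R u F) G) / (w - u) - L2_inner M ?P G)
      \<le> cmod (w - u) * (K * L2_norm M ?Q * L2_norm M G)"
      unfolding eventually_at using key d(1) e(1) by (intro exI[of _ "min d e"]) auto
    have "((\<lambda>w. cmod (w - u) * (K * L2_norm M ?Q * L2_norm M G)) \<longlongrightarrow> cmod (u - u) * (K * L2_norm M ?Q * L2_norm M G)) (at u)"
      by (intro tendsto_intros)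
    then show "((\<lambda>w. cmod (w - u) * (K * L2_norm M ?Q * L2_norm M G)) \<longlongrightarrow> 0) (at u)" by simp
  qed
qed

lemma resolvent_holomorphic:
  "F \<in> L2 M \<Longrightarrow> G \<in> L2 M \<Longrightarrow> (\<lambda>u. L2_inner M (R u F) G) holomorphic_on U"
  unfolding holomorphic_on_open[OF U(1)] using resolvent_has_derivative by blast

text \<open>By \<open>resolvent_left\<close> the function is a constant plus u times the same
  function for A F, so Leibniz' rule at 0 trades one derivative for one application of A.\<close>

lemma resolvent_higher_deriv:
  assumes "F \<in> L2 M" and G: "G \<in> L2 M"
  shows "(deriv ^^ n) (\<lambda>u. L2_inner M (R u F) G) 0 = fact n * L2_inner M (op_power M A n F) G"
  using assms(1)
proof (induction n arbitrary: F)
  case 0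
  then show ?case using resolvent_right[OF U(2) _ G, of F] by simp
next
  case (Suc n)
  let ?p = "\<lambda>u. L2_inner M (R u (A F)) G"
  have h: "?p holomorphic_on U" by (rule resolvent_holomorphic) (use Suc G resolvent_A_in in auto)
  have h2: "(\<lambda>u. u * ?p u) holomorphic_on U" by (intro holomorphic_intros h)
  have hF: "(\<lambda>u. L2_inner M (R u F) G) holomorphic_on U" by (rule resolvent_holomorphic) (use Suc G in auto)
  have "(deriv ^^ Suc n) (\<lambda>u. L2_inner M (R u F) G) 0 = (deriv ^^ Suc n) (\<lambda>u. L2_inner M F G + u * ?p u) 0"
    by (rule higher_deriv_transform_within_open[OF hF _ U])
      (use h2 Suc G resolvent_left in \<open>auto intro!: holomorphic_intros\<close>)
  also have "\<dots> = (deriv ^^ Suc n) (\<lambda>u. L2_inner M F G) 0 + (deriv ^^ Suc n) (\<lambda>u. u * ?p u) 0"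
    by (rule higher_deriv_add[OF _ h2 U]) simp
  also have "(deriv ^^ Suc n) (\<lambda>u. L2_inner M F G) 0 = 0" by (subst higher_deriv_const) simp
  also have "(deriv ^^ Suc n) (\<lambda>u. u * ?p u) 0 =
     (\<Sum>i = 0..Suc n. of_nat (Suc n choose i) * (deriv ^^ i) (\<lambda>u. u) 0 * (deriv ^^ (Suc n - i)) ?p 0)"
    by (rule higher_deriv_mult[OF _ h U]) simp
  \<comment> \<open>The function u vanishes at 0, and so do its derivatives of order at least two;
    only i = 1 survives.\<close>
  also have "\<dots> = (\<Sum>i = 0..Suc n. if i = 1 then of_nat (Suc n) * (deriv ^^ n) ?p 0 else 0)"
    by (intro sum.cong refl) (simp only: higher_deriv_ident, auto)
  also have "\<dots> = of_nat (Suc n) * (deriv ^^ n) ?p 0" by (subst sum.delta) auto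
  also have "(deriv ^^ n) ?p 0 = fact n * L2_inner M (op_power M A n (A F)) G"
    by (rule Suc.IH) (use Suc resolvent_A_in in auto)
  also have "op_power M A n (A F) = op_power M A (Suc n) F"
    using Suc.prems by (simp only: op_power_Suc_apply op_power_commute[OF bounded_operatorD[OF A]])
  finally show ?case by (simp add: algebra_simps)
qed

text \<open>Cauchy's estimate for the Taylor coefficients, with the uniform bound of R on the closed
  disc.\<close>

lemma resolvent_power_bound:
  assumes r: "0 < r" "cball 0 r \<subseteq> U"
  obtains C where "\<And>n. op_norm M (op_power M A n) \<le> C / r ^ n"
proof -
  obtain K where K: "0 \<le> K" "\<And>w F. w \<in> cball 0 r \<Longrightarrow> F \<in> L2 M \<Longrightarrow> L2_norm M (R w F) \<le> K * L2_norm M F"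
    using resolvent_uniformly_bounded[OF compact_cball r(2)] by metis
  have "op_norm M (op_power M A n) \<le> K / r ^ n" for n
  proof (rule op_norm_le)
    show "0 \<le> K / r ^ n" using K r by simp
    fix F assume F: "F \<in> L2 M"
    \<comment> \<open>Testing against the vector \<open>?G\<close> itself makes the scalar estimate
      read: the squared norm of \<open>?G\<close> is at most K / r ^ n times the norms of F and of
      \<open>?G\<close>.\<close>
    let ?G = "op_power M A n F"
    have G: "?G \<in> L2 M" by (rule op_power_in[OF bounded_operatorD[OF A] F])
    have hol: "(\<lambda>u. L2_inner M (R u F) ?G) holomorphic_on cball 0 r"
      by (rule holomorphic_on_subset[OF resolvent_holomorphic[OF F G] r(2)])
    have "norm ((deriv ^^ n) (\<lambda>u. L2_inner M (R u F) ?G) 0) \<le> fact n * (K * L2_norm M F * L2_norm M ?G) / r ^ n"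
    proof (rule Cauchy_inequality)
      show "(\<lambda>u. L2_inner M (R u F) ?G) holomorphic_on ball 0 r" by (rule holomorphic_on_subset[OF hol ball_subset_cball])
      show "continuous_on (cball 0 r) (\<lambda>u. L2_inner M (R u F) ?G)" by (rule holomorphic_on_imp_continuous_on[OF hol])
      fix x :: complex assume x: "norm (0 - x) = r"
      then have xr: "x \<in> cball 0 r" by simp
      have "norm (L2_inner M (R x F) ?G) \<le> L2_norm M (R x F) * L2_norm M ?G"
        by (rule L2_Cauchy_Schwarz[OF resolvent_in[OF _ F] G]) (use xr r in auto)
      also have "\<dots> \<le> K * L2_norm M F * L2_norm M ?G" by (rule mult_right_mono[OF K(2)[OF xr F]]) simp
      finally show "norm (L2_inner M (R x F) ?G) \<le> K * L2_norm M F * L2_norm M ?G" .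
    qed (rule r)
    then have "fact n * cmod (L2_inner M ?G ?G) \<le> fact n * (K * L2_norm M F * L2_norm M ?G) / r ^ n"
      by (simp only: resolvent_higher_deriv[OF F G]) (simp add: norm_mult)
    then have "fact n * (L2_norm M ?G)\<^sup>2 \<le> fact n * ((K * L2_norm M F * L2_norm M ?G) / r ^ n)"
      by (simp add: L2_inner_self norm_power)
    then have *: "L2_norm M ?G * L2_norm M ?G \<le> (K / r ^ n * L2_norm M F) * L2_norm M ?G"
      by (subst (asm) mult_le_cancel_left_pos) (auto simp: power2_eq_square field_simps)
    show "L2_norm M ?G \<le> K / r ^ n * L2_norm M F"
    proof (cases "L2_norm M ?G = 0")
      case True
      then show ?thesis using K r by simp
    next
      case False
      then show ?thesis using * by (subst (asm) mult_le_cancel_right_pos) (auto simp: less_le)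
    qed
  qed
  then show ?thesis using that by blast
qed

end

text \<open>The nontrivial half of Gelfand's formula: the Taylor coefficients of the resolvent are the
  powers of the operator, and the resolvent is holomorphic up to the inverse spectral radius.\<close>

lemma op_norm_power_bound:
  assumes A: "bounded_operator M A" and t: "op_spectral_radius M A < t"
  obtains C where "\<And>n. op_norm M (op_power M A n) \<le> C * t ^ n"
proof -
  let ?\<rho> = "op_spectral_radius M A"
  have \<rho>: "0 \<le> ?\<rho>" using A by simp
  then have t0: "0 < t" using t by linarith
  \<comment> \<open>Written without division so that radius 0 is included; U is then the whole
    plane.\<close>
  define U where "U = {u. cmod u * ?\<rho> < 1}"
  have "open U" unfolding U_def by (intro open_Collect_less continuous_intros)
  moreover have "0 \<in> U" by (simp add: U_def)
  moreover obtain R where "\<And>u. u \<in> U \<Longrightarrow> resolvent M A u (R u)"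
    using resolvent_exists[OF A] unfolding U_def by (metis mem_Collect_eq)
  moreover have "cball 0 (1 / t) \<subseteq> U"
  proof
    fix u :: complex assume "u \<in> cball 0 (1 / t)"
    then have "cmod u * ?\<rho> \<le> 1 / t * ?\<rho>" by (intro mult_right_mono \<rho>) simp
    also have "\<dots> < 1" using t t0 by simp
    finally show "u \<in> U" by (simp add: U_def)
  qed
  ultimately obtain C where "\<And>n. op_norm M (op_power M A n) \<le> C / (1 / t) ^ n"
    using resolvent_power_bound[OF A, of U R "1 / t"] t0 by (metis zero_less_divide_1_iff)
  then show ?thesis using that[of C] t0 by (simp add: power_one_over)
qed

section \<open>Adjoints\<close>

text \<open>The representing vector is the minimizer of a quadratic functional: completeness
  provides it, and the vanishing first variation gives the representation.\<close>

lemma Riesz_representation: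
  assumes lin: "\<And>F G c d. F \<in> L2 M \<Longrightarrow> G \<in> L2 M \<Longrightarrow> \<phi> (L2_lincomb M c F d G) = c * \<phi> F + d * \<phi> G"
    and bd: "\<And>F. F \<in> L2 M \<Longrightarrow> cmod (\<phi> F) \<le> K * L2_norm M F"
  obtains H where "H \<in> L2 M" "\<And>F. F \<in> L2 M \<Longrightarrow> \<phi> F = L2_inner M F H"
proof -
  \<comment> \<open>If \<phi> is the inner product with H, then J F is the squared distance between
    F and H minus the squared norm of H.\<close>
  define J where "J = (\<lambda>F. (L2_norm M F)\<^sup>2 - 2 * Re (\<phi> F))"
  have Jlow: "- K\<^sup>2 \<le> J F" if F: "F \<in> L2 M" for F
  proof -
    have "Re (\<phi> F) \<le> K * L2_norm M F" using order_trans[OF complex_Re_le_cmod bd[OF F]] .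
    then have "J F \<ge> (L2_norm M F)\<^sup>2 - 2 * (K * L2_norm M F)" by (simp add: J_def)
    also have "(L2_norm M F)\<^sup>2 - 2 * (K * L2_norm M F) = (L2_norm M F - K)\<^sup>2 - K\<^sup>2" by (simp add: power2_eq_square algebra_simps)
    finally show ?thesis using zero_le_power2[of "L2_norm M F - K"] by linarith
  qed
  define d where "d = Inf (J ` L2 M)"
  have bdd: "bdd_below (J ` L2 M)" using Jlow by (auto intro!: bdd_belowI)
  have dle: "d \<le> J F" if "F \<in> L2 M" for F unfolding d_def using that bdd by (auto intro!: cInf_lower)
  have "\<exists>F\<in>L2 M. J F < d + e" if "0 < e" for e
    using cInf_lessD[of "J ` L2 M" "d + e"] that unfolding d_def by (auto intro: L2_zero_in)
  \<comment> \<open>The accuracy (1/4) ^ n makes the distances between consecutive elements, which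
    are square roots, summable.\<close>
  then have "\<forall>n. \<exists>F. F \<in> L2 M \<and> J F < d + (1/4) ^ n" by (metis zero_less_divide_1_iff zero_less_numeral zero_less_power)
  then obtain S where S: "\<And>n. S n \<in> L2 M" "\<And>n. J (S n) < d + (1/4) ^ n" by metis
  \<comment> \<open>Parallelogram law: J at the midpoint of F and G cannot lie below the infimum
    d.\<close>
  have para: "(L2_norm M (L2_lincomb M 1 F (-1) G))\<^sup>2 \<le> 2 * (J F - d) + 2 * (J G - d)" if FG: "F \<in> L2 M" "G \<in> L2 M" for F G
  proof -
    have "d \<le> J (L2_lincomb M (1/2) F (1/2) G)" using FG by (intro dle) auto
    then show ?thesis using FG by (simp add: J_def L2_norm_lincomb_sq lin power_mult_distrib norm_divide power_divide)
  qed
  have "summable (\<lambda>n. L2_norm M (L2_lincomb M 1 (S (Suc n)) (-1) (S n)))"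
  proof (rule summable_comparison_test')
    show "summable (\<lambda>n. 2 * (1/2::real) ^ n)" by (intro summable_mult summable_geometric) simp
    fix n :: nat
    have "(L2_norm M (L2_lincomb M 1 (S (Suc n)) (-1) (S n)))\<^sup>2 \<le> 2 * (J (S (Suc n)) - d) + 2 * (J (S n) - d)"
      by (rule para[OF S(1) S(1)])
    also have "\<dots> \<le> 4 * (1/4) ^ n"
    proof -
      define e where "e = (1/4::real) ^ n"
      have "0 < e" "J (S n) < d + e" "J (S (Suc n)) < d + 1 / 4 * e"
        using S(2)[of n] S(2)[of "Suc n"] by (auto simp: e_def)
      then have "2 * (J (S (Suc n)) - d) + 2 * (J (S n) - d) \<le> 4 * e" by (simp add: field_simps)
      then show ?thesis by (simp only: e_def)
    qed
    also have "\<dots> = (2 * (1/2) ^ n)\<^sup>2" by (simp add: power_mult_distrib power_divide power_mult[symmetric] mult.commute[of n 2]) (simp add: power_mult)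
    finally have "L2_norm M (L2_lincomb M 1 (S (Suc n)) (-1) (S n)) \<le> 2 * (1/2) ^ n"
      by (rule power2_le_imp_le) simp
    then show "norm (L2_norm M (L2_lincomb M 1 (S (Suc n)) (-1) (S n))) \<le> 2 * (1/2) ^ n" by simp
  qed
  from L2_complete[OF S(1) this] obtain H where H: "H \<in> L2 M" "(\<lambda>n. L2_norm M (L2_lincomb M 1 (S n) (-1) H)) \<longlonglongrightarrow> 0" by metis
  have JH: "J H \<le> d"
  proof (rule LIMSEQ_le_const)
    let ?e = "\<lambda>n. L2_norm M (L2_lincomb M 1 (S n) (-1) H)"
    have "(\<lambda>n. d + (1/4) ^ n - 2 * Re (L2_inner M (S n) H - L2_inner M H H) + 2 * K * ?e n) \<longlonglongrightarrow> d + 0 - 2 * Re (L2_inner M H H - L2_inner M H H) + 2 * K * 0"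
      by (intro tendsto_intros L2_inner_tendsto H S(1)) (simp_all add: LIMSEQ_realpow_zero)
    then show "(\<lambda>n. d + (1/4) ^ n - 2 * Re (L2_inner M (S n) H - L2_inner M H H) + 2 * K * ?e n) \<longlonglongrightarrow> d" by simp
    have "J H \<le> d + (1/4) ^ n - 2 * Re (L2_inner M (S n) H - L2_inner M H H) + 2 * K * ?e n" for n
    proof -
      have "0 \<le> (?e n)\<^sup>2" by simp
      then have "2 * Re (L2_inner M (S n) H) \<le> (L2_norm M (S n))\<^sup>2 + (L2_norm M H)\<^sup>2"
        by (simp add: L2_norm_lincomb_sq S H)
      moreover have "Re (L2_inner M H H) = (L2_norm M H)\<^sup>2" by (simp add: L2_inner_self)
      moreover have "Re (\<phi> (S n)) - Re (\<phi> H) \<le> K * ?e n"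
        using order_trans[OF complex_Re_le_cmod bd[OF L2_lincomb_in[OF S(1) H(1), of 1 n "-1"]]] by (simp add: lin S H)
      ultimately show ?thesis using S(2)[of n] by (simp add: J_def algebra_simps)
    qed
    then show "\<exists>N. \<forall>n\<ge>N. J H \<le> d + (1/4) ^ n - 2 * Re (L2_inner M (S n) H - L2_inner M H H) + 2 * K * ?e n" by auto
  qed
  have "\<phi> F = L2_inner M F H" if F: "F \<in> L2 M" for F
  proof -
    define z where "z = L2_inner M F H - \<phi> F"
    have "cmod z ^ 2 * s * 2 \<le> s\<^sup>2 * (cmod z * L2_norm M F)\<^sup>2" if "s > 0" for s :: real
    proof -
      \<comment> \<open>The perturbation is given the phase of cnj z, so that the first-order term
        becomes 2 s |z|^2; letting s tend to 0 then forces z = 0.\<close>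
      have "J H \<le> J (L2_lincomb M 1 H (- of_real s * cnj z) F)" using JH dle[OF L2_lincomb_in[OF H(1) F]] by (rule order_trans)
      also have "\<dots> = J H + (s * cmod z * L2_norm M F)\<^sup>2 - 2 * s * Re (cnj z * (L2_inner M F H - \<phi> F))"
        unfolding J_def
        by (simp add: L2_norm_lincomb_sq H F lin norm_mult L2_inner_commute[of M H F] algebra_simps)
      also have "Re (cnj z * (L2_inner M F H - \<phi> F)) = (cmod z)\<^sup>2"
        unfolding z_def[symmetric] cmod_power2 by (simp add: power2_eq_square)
      finally show ?thesis by (simp add: power_mult_distrib algebra_simps)
    qed
    then have *: "cmod z ^ 2 * 2 \<le> s * (cmod z * L2_norm M F)\<^sup>2" if "s > 0" for s :: real
      using that by (auto simp: power2_eq_square algebra_simps)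
    have "cmod z ^ 2 * 2 \<le> 0"
    proof (rule field_le_epsilon)
      fix e :: real assume e: "0 < e"
      let ?B = "(cmod z * L2_norm M F)\<^sup>2"
      have "cmod z ^ 2 * 2 \<le> e / (?B + 1) * ?B" by (rule *) (use e in \<open>simp add: add_nonneg_pos\<close>)
      also have "\<dots> = e * (?B / (?B + 1))" by simp
      also have "\<dots> \<le> e * 1" by (intro mult_left_mono) (use e in \<open>simp_all add: divide_le_eq add_nonneg_pos\<close>)
      finally show "cmod z ^ 2 * 2 \<le> 0 + e" by simp
    qed
    then show ?thesis by (simp add: z_def)
  qed
  then show ?thesis using that H(1) by blast
qed

definition is_adjoint :: "'a measure \<Rightarrow> 'a L2_op \<Rightarrow> 'a L2_op \<Rightarrow> bool" where
  "is_adjoint M A B \<longleftrightarrow> L2_operator M B \<and> (\<forall>F\<in>L2 M. \<forall>G\<in>L2 M. L2_inner M (A F) G = L2_inner M F (B G))"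

lemma ops_adjoint_eq: "ops_adjoint M \<Psi> = {B. \<exists>A\<in>\<Psi>. is_adjoint M A B}"
  by (auto simp: ops_adjoint_def is_adjoint_def)

lemma is_adjointD: "is_adjoint M A B \<Longrightarrow> F \<in> L2 M \<Longrightarrow> G \<in> L2 M \<Longrightarrow> L2_inner M (A F) G = L2_inner M F (B G)"
  by (simp add: is_adjoint_def)

text \<open>Riesz representation of the functional that sends F to the inner product of A F and G.
  Since \<open>ops_adjoint\<close> merely collects operators satisfying the adjoint relation,
  existence is what provides it with elements.\<close>

lemma is_adjoint_exists:
  assumes A: "bounded_operator M A"
  obtains B where "is_adjoint M A B"
proof -
  note L = bounded_operatorD[OF A]
  have "\<exists>H. H \<in> L2 M \<and> (\<forall>F\<in>L2 M. L2_inner M (A F) G = L2_inner M F H)" if G: "G \<in> L2 M" for G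
  proof -
    have "cmod (L2_inner M (A F) G) \<le> op_norm M A * L2_norm M G * L2_norm M F" if F: "F \<in> L2 M" for F
    proof -
      have "cmod (L2_inner M (A F) G) \<le> L2_norm M (A F) * L2_norm M G"
        by (rule L2_Cauchy_Schwarz[OF L2_operator_in[OF L F] G])
      also have "\<dots> \<le> op_norm M A * L2_norm M F * L2_norm M G"
        by (rule mult_right_mono[OF op_norm_bound[OF A F]]) simp
      finally show ?thesis by (simp add: ac_simps)
    qed
    from Riesz_representation[of M "\<lambda>F. L2_inner M (A F) G", OF _ this] show ?thesis
      by (simp add: L2_operator_lincomb[OF L] L2_inner_lincomb_left L2_operator_in[OF L] G) metis
  qed
  then obtain B0 where B0: "\<And>G. G \<in> L2 M \<Longrightarrow> B0 G \<in> L2 M"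
    "\<And>F G. F \<in> L2 M \<Longrightarrow> G \<in> L2 M \<Longrightarrow> L2_inner M (A F) G = L2_inner M F (B0 G)" by metis
  define B where "B = restrict B0 (L2 M)"
  have B: "\<And>G. G \<in> L2 M \<Longrightarrow> B G \<in> L2 M"
    "\<And>F G. F \<in> L2 M \<Longrightarrow> G \<in> L2 M \<Longrightarrow> L2_inner M (A F) G = L2_inner M F (B G)"
    using B0 by (auto simp: B_def)
  have "L2_operator M B" unfolding L2_operator_def
  proof (intro conjI ballI allI)
    show "B \<in> L2 M \<rightarrow>\<^sub>E L2 M" using B0 by (auto simp: B_def)
    fix F G c d assume FG: "F \<in> L2 M" "G \<in> L2 M"
    show "B (L2_lincomb M c F d G) = L2_lincomb M c (B F) d (B G)"
    proof (rule L2_eqI[of _ M])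
      fix H assume H: "H \<in> L2 M"
      have "L2_inner M H (B (L2_lincomb M c F d G)) = L2_inner M H (L2_lincomb M c (B F) d (B G))"
        using FG H by (simp add: B(2)[symmetric] B(1) L2_inner_lincomb_right L2_operator_in[OF L])
      then show "L2_inner M (B (L2_lincomb M c F d G)) H = L2_inner M (L2_lincomb M c (B F) d (B G)) H"
        by (metis L2_inner_commute)
    qed (use FG B in auto)
  qed
  then show ?thesis using that B(2) by (auto simp: is_adjoint_def)
qed

lemma is_adjoint_unique:
  assumes "is_adjoint M A B" "is_adjoint M A C" shows "B = C"
proof (rule L2_operator_eqI[of M])
  fix G assume G: "G \<in> L2 M"
  show "B G = C G"
  proof (rule L2_eqI[of _ M])
    fix H assume H: "H \<in> L2 M"
    have "L2_inner M H (B G) = L2_inner M H (C G)" using assms G H by (metis is_adjointD)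
    then show "L2_inner M (B G) H = L2_inner M (C G) H" by (metis L2_inner_commute)
  qed (use assms G L2_operator_in[of M B] L2_operator_in[of M C] in \<open>auto simp: is_adjoint_def\<close>)
qed (use assms in \<open>auto simp: is_adjoint_def\<close>)

lemma is_adjoint_sym: "L2_operator M A \<Longrightarrow> is_adjoint M A B \<Longrightarrow> is_adjoint M B A"
  unfolding is_adjoint_def by (metis L2_inner_commute)

lemma is_adjoint_compose:
  assumes "is_adjoint M A A'" "is_adjoint M B B'" "L2_operator M A" "L2_operator M B"
  shows "is_adjoint M (compose (L2 M) A B) (compose (L2 M) B' A')"
  using assms L2_operator_in[of M A'] L2_operator_in[of M B]
  by (simp add: is_adjoint_def L2_operator_compose compose_eq)

lemma is_adjoint_bounded:
  assumes A: "bounded_operator M A" and B: "is_adjoint M A B"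
  shows "bounded_operator M B" "op_norm M B \<le> op_norm M A"
proof -
  have LB: "L2_operator M B" using B by (simp add: is_adjoint_def)
  have *: "L2_norm M (B G) \<le> op_norm M A * L2_norm M G" if G: "G \<in> L2 M" for G
  proof -
    note BG = L2_operator_in[OF LB G]
    have "(L2_norm M (B G))\<^sup>2 = cmod (L2_inner M (B G) (B G))" by (simp add: L2_inner_self norm_power)
    also have "\<dots> = cmod (L2_inner M (A (B G)) G)" using is_adjointD[OF B BG G] by simp
    also have "\<dots> \<le> L2_norm M (A (B G)) * L2_norm M G"
      by (rule L2_Cauchy_Schwarz[OF bounded_operator_in[OF A BG] G])
    also have "\<dots> \<le> op_norm M A * L2_norm M (B G) * L2_norm M G"
      by (rule mult_right_mono[OF op_norm_bound[OF A BG]]) simp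
    finally have "L2_norm M (B G) * L2_norm M (B G) \<le> (op_norm M A * L2_norm M G) * L2_norm M (B G)"
      by (simp add: power2_eq_square ac_simps)
    then show ?thesis
      by (cases "L2_norm M (B G) = 0") (auto simp: less_le A dest: mult_right_le_imp_le)
  qed
  show "bounded_operator M B" by (rule bounded_operatorI[OF LB *])
  show "op_norm M B \<le> op_norm M A" by (rule op_norm_le[OF _ *]) (use A in auto)
qed

lemma op_norm_sq_le_adjoint:
  assumes A: "bounded_operator M A" and B: "is_adjoint M A B"
  shows "(op_norm M A)\<^sup>2 \<le> op_norm M (compose (L2 M) B A)"
proof -
  note bB = is_adjoint_bounded(1)[OF A B]
  note bP = bounded_operator_compose(1)[OF bB A]
  show ?thesis
  proof (rule op_norm_sq_le[OF op_norm_nonneg[OF bP] _ A])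
    fix F assume F: "F \<in> L2 M"
    note AF = bounded_operator_in[OF A F]
    have "(L2_norm M (A F))\<^sup>2 = cmod (L2_inner M (A F) (A F))" by (simp add: L2_inner_self norm_power)
    also have "\<dots> = cmod (L2_inner M F (compose (L2 M) B A F))" using is_adjointD[OF B F AF] F by (simp add: compose_eq)
    also have "\<dots> \<le> L2_norm M F * L2_norm M (compose (L2 M) B A F)"
      by (rule L2_Cauchy_Schwarz[OF F bounded_operator_in[OF bP F]])
    also have "\<dots> \<le> L2_norm M F * (op_norm M (compose (L2 M) B A) * L2_norm M F)"
      by (rule mult_left_mono[OF op_norm_bound[OF bP F]]) simp
    finally show "(L2_norm M (A F))\<^sup>2 \<le> op_norm M (compose (L2 M) B A) * (L2_norm M F)\<^sup>2"
      by (simp add: power2_eq_square ac_simps)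
  qed
qed

lemma is_adjoint_power:
  assumes "L2_operator M P" "is_adjoint M P P" shows "is_adjoint M (op_power M P n) (op_power M P n)"
proof (induction n)
  case 0
  show ?case by (simp add: is_adjoint_def L2_operator_id)
next
  case (Suc n)
  have "is_adjoint M (compose (L2 M) P (op_power M P n)) (compose (L2 M) (op_power M P n) P)"
    by (rule is_adjoint_compose[OF assms(2) Suc assms(1) L2_operator_list_prod]) (use assms in auto)
  also have "compose (L2 M) (op_power M P n) P = compose (L2 M) P (op_power M P n)"
    using op_power_add[OF assms(1), of n 1] op_power_add[OF assms(1), of 1 n] by (simp add: op_list_prod_single[OF assms(1)])
  finally show ?case by (simp add: op_list_prod_Cons)
qed

text \<open>The product P of the adjoint B with A is self-adjoint, and so are its powers. By
  \<open>op_norm_sq_le_adjoint\<close> the squared norm of a power of P is therefore at most the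
  norm of the squared power; iterate.\<close>

lemma op_norm_power_adjoint:
  assumes A: "bounded_operator M A" and B: "is_adjoint M A B"
  shows "(op_norm M A)\<^sup>2 ^ (2 ^ k) \<le> op_norm M (op_power M (compose (L2 M) B A) (2 ^ k))"
proof (induction k)
  let ?P = "compose (L2 M) B A"
  have LA: "L2_operator M A" and LB: "L2_operator M B" using A B by (auto simp: bounded_operatorD is_adjoint_def)
  have LP: "L2_operator M ?P" by (rule L2_operator_compose[OF LB LA])
  have P: "is_adjoint M ?P ?P" by (rule is_adjoint_compose[OF is_adjoint_sym[OF LA B] B LB LA])
  have bP: "bounded_operator M ?P" by (rule bounded_operator_compose(1)[OF is_adjoint_bounded(1)[OF A B] A])
  {
    case 0
    show ?case using op_norm_sq_le_adjoint[OF A B] by (simp add: op_list_prod_single[OF LP])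
  next
    case (Suc k)
    have "(op_norm M A)\<^sup>2 ^ (2 ^ Suc k) = ((op_norm M A)\<^sup>2 ^ (2 ^ k))\<^sup>2" by (simp add: power_mult[symmetric] mult.commute)
    also have "\<dots> \<le> (op_norm M (op_power M ?P (2 ^ k)))\<^sup>2" by (rule power_mono[OF Suc]) simp
    also have "\<dots> \<le> op_norm M (compose (L2 M) (op_power M ?P (2 ^ k)) (op_power M ?P (2 ^ k)))"
      by (rule op_norm_sq_le_adjoint[OF bounded_operator_power[OF bP] is_adjoint_power[OF LP P]])
    also have "\<dots> = op_norm M (op_power M ?P (2 ^ Suc k))" by (simp only: op_power_add[OF LP, symmetric] power_Suc mult_2)
    finally show ?case .
  }
qed

section \<open>Spectral radius and growth of powers\<close>

text \<open>The hypothesis omits n = 0, where kernel estimates are silent; the identity has norm at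
  most 1, which \<open>max C 1\<close> covers.\<close>

lemma op_spectral_radius_leI:
  assumes A: "bounded_operator M A" and t: "0 < t" and le: "\<And>n. n > 0 \<Longrightarrow> op_norm M (op_power M A n) \<le> C * t ^ n"
  shows "op_spectral_radius M A \<le> t"
proof (rule op_spectral_radius_le[OF A])
  fix n show "op_norm M (op_power M A n) \<le> max C 1 * t ^ n"
  proof (cases "n = 0")
    case True
    then show ?thesis using op_norm_id[of M] by simp
  next
    case False
    then have "op_norm M (op_power M A n) \<le> C * t ^ n" using le by simp
    also have "\<dots> \<le> max C 1 * t ^ n" using t by (intro mult_right_mono) auto
    finally show ?thesis .
  qed
qed (use t in simp)

text \<open>If a / t exceeded 1, its powers would outgrow C. Exponents need only be unbounded; they
  will be 2 ^ k and k + 1.\<close>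

lemma power_growth_le:
  fixes a t C :: real
  assumes le: "\<And>k::nat. a ^ f k \<le> C * t ^ f k" and f: "\<And>k. k \<le> f k" and t: "0 < t"
  shows "a \<le> t"
proof (rule ccontr)
  assume "\<not> a \<le> t"
  then have q: "1 < a / t" using t by simp
  then obtain k where k: "C < (a / t) ^ k" using real_arch_pow by blast
  have "(a / t) ^ k \<le> (a / t) ^ f k" by (rule power_increasing[OF f]) (use q in simp)
  also have "\<dots> \<le> C" using le[of k] t by (simp add: power_divide divide_le_eq)
  finally show False using k by simp
qed

text \<open>Both halves of Gelfand's formula: any t above the radius of B bounds the growth of the
  powers of B, hence that of the powers of A.\<close>

lemma op_spectral_radius_mono:
  assumes A: "bounded_operator M A" and B: "bounded_operator M B"
    and le: "\<And>n. n > 0 \<Longrightarrow> op_norm M (op_power M A n) \<le> op_norm M (op_power M B n)"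
  shows "op_spectral_radius M A \<le> op_spectral_radius M B"
proof (rule dense_ge)
  fix t assume t: "op_spectral_radius M B < t"
  then have t0: "0 < t" using op_spectral_radius_nonneg[OF B] by linarith
  obtain C where "\<And>n. op_norm M (op_power M B n) \<le> C * t ^ n" using op_norm_power_bound[OF B t] by metis
  then show "op_spectral_radius M A \<le> t"
    by (intro op_spectral_radius_leI[OF A t0]) (use le in \<open>blast intro: order_trans\<close>)
qed

text \<open>Division of n by m: a growth bound along multiples of m extends to all n, the remainder
  costing only a constant.\<close>

lemma op_spectral_radius_power:
  assumes A: "bounded_operator M A" and m: "m > 0"
  shows "op_spectral_radius M A ^ m \<le> op_spectral_radius M (op_power M A m)"
proof (rule dense_ge)
  note B = bounded_operator_power[OF A, of m]
  fix t assume t: "op_spectral_radius M (op_power M A m) < t"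
  then have t0: "0 < t" using op_spectral_radius_nonneg[OF B] by linarith
  obtain C where C: "\<And>n. op_norm M (op_power M (op_power M A m) n) \<le> C * t ^ n"
    using op_norm_power_bound[OF B t] by metis
  define s where "s = root m t"
  have s: "0 < s" "s ^ m = t" using t0 m by (simp_all add: s_def)
  define N where "N = max 1 (op_norm M A)"
  have N: "1 \<le> N" "op_norm M A \<le> N" by (auto simp: N_def)
  \<comment> \<open>Collects the remainder power, of norm at most N ^ m, and the quotient of t ^ (n
    div m) by s ^ n, at most \<open>max 1 (1 / s) ^ m\<close>.\<close>
  define C' where "C' = max C 0 * (N * max 1 (1 / s)) ^ m"
  have "op_spectral_radius M A \<le> s"
  proof (rule op_spectral_radius_leI[OF A s(1)])
    fix n :: nat
    have "op_power M A n = compose (L2 M) (op_power M A (m * (n div m))) (op_power M A (n mod m))"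
      by (subst op_power_add[OF bounded_operatorD[OF A], symmetric]) simp
    then have "op_norm M (op_power M A n) \<le> op_norm M (op_power M A (m * (n div m))) * op_norm M (op_power M A (n mod m))"
      using bounded_operator_compose(2)[OF bounded_operator_power[OF A] bounded_operator_power[OF A]] by simp
    also have "\<dots> \<le> (max C 0 * t ^ (n div m)) * N ^ m"
    proof (rule mult_mono)
      have "op_norm M (op_power M A (m * (n div m))) \<le> C * t ^ (n div m)"
        using C[of "n div m"] by (simp only: op_power_mult[OF bounded_operatorD[OF A]])
      also have "\<dots> \<le> max C 0 * t ^ (n div m)" by (intro mult_right_mono) (use t0 in auto)
      finally show "op_norm M (op_power M A (m * (n div m))) \<le> max C 0 * t ^ (n div m)" .
      have "op_norm M (op_power M A (n mod m)) \<le> op_norm M A ^ (n mod m)" by (rule op_norm_power_le[OF A])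
      also have "\<dots> \<le> N ^ (n mod m)" by (rule power_mono) (use N A in auto)
      also have "\<dots> \<le> N ^ m" by (rule power_increasing) (use N m in \<open>auto intro: less_imp_le\<close>)
      finally show "op_norm M (op_power M A (n mod m)) \<le> N ^ m" .
    qed (use t0 bounded_operator_power[OF A] in auto)
    also have "t ^ (n div m) \<le> max 1 (1 / s) ^ m * s ^ n"
    proof -
      have "s ^ n = t ^ (n div m) * s ^ (n mod m)"
        by (metis div_mult_mod_eq mult.commute power_add power_mult s(2))
      then have "t ^ (n div m) = (1 / s) ^ (n mod m) * s ^ n" using s by (simp add: power_divide)
      also have "(1 / s) ^ (n mod m) \<le> max 1 (1 / s) ^ (n mod m)" by (rule power_mono) (use s in auto)
      also have "\<dots> \<le> max 1 (1 / s) ^ m" by (rule power_increasing) (use m in \<open>auto intro: less_imp_le\<close>)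
      finally show ?thesis using s by simp
    qed
    finally show "op_norm M (op_power M A n) \<le> C' * s ^ n"
      using N by (simp add: C'_def power_mult_distrib mult_left_mono mult_right_mono ac_simps)
  qed
  then have "op_spectral_radius M A ^ m \<le> s ^ m" by (rule power_mono) (use A in simp)
  then show "op_spectral_radius M A ^ m \<le> t" using s by simp
qed

lemma op_power_compose_Suc:
  assumes A: "L2_operator M A" and B: "L2_operator M B"
  shows "op_power M (compose (L2 M) A B) (Suc n) =
    compose (L2 M) A (compose (L2 M) (op_power M (compose (L2 M) B A) n) B)"
proof -
  let ?AB = "compose (L2 M) A B" and ?BA = "compose (L2 M) B A"
  note LAB = L2_operator_compose[OF A B] and LBA = L2_operator_compose[OF B A]
  show ?thesis
  proof (rule L2_operator_eqI[of M])
    fix F assume F: "F \<in> L2 M"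
    note [simp] = L2_operator_in[OF A] L2_operator_in[OF B] F op_power_in[OF LBA] op_power_in[OF LAB]
    have "op_power M ?AB n (A G) = A (op_power M ?BA n G)" if "G \<in> L2 M" for G n
      by (induction n) (use that in \<open>simp_all add: op_power_Suc_apply op_power_0_apply compose_eq del: replicate_Suc\<close>)
    from this[of "B F" n] show "op_power M ?AB (Suc n) F = compose (L2 M) A (compose (L2 M) (op_power M ?BA n) B) F"
      using op_power_commute[OF LAB F, of n]
      by (simp add: op_power_Suc_apply compose_eq del: replicate_Suc)
  qed (auto intro!: L2_operator_compose L2_operator_list_prod A B LBA LAB)
qed

text \<open>By \<open>op_power_compose_Suc\<close> the powers of A B are those of B A, one exponent
  lower, between two fixed factors; the shift in the exponent costs the factor 1 / t.\<close>

lemma op_spectral_radius_compose_le: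
  assumes A: "bounded_operator M A" and B: "bounded_operator M B"
  shows "op_spectral_radius M (compose (L2 M) A B) \<le> op_spectral_radius M (compose (L2 M) B A)"
proof (rule dense_ge)
  note AB = bounded_operator_compose(1)[OF A B] and BA = bounded_operator_compose(1)[OF B A]
  fix t assume t: "op_spectral_radius M (compose (L2 M) B A) < t"
  then have t0: "0 < t" using op_spectral_radius_nonneg[OF BA] by linarith
  obtain C where C: "\<And>n. op_norm M (op_power M (compose (L2 M) B A) n) \<le> C * t ^ n"
    using op_norm_power_bound[OF BA t] by metis
  show "op_spectral_radius M (compose (L2 M) A B) \<le> t"
  proof (rule op_spectral_radius_leI[OF AB t0])
    fix n :: nat assume "n > 0"
    then obtain k where k: "n = Suc k" by (cases n) auto
    let ?P = "op_power M (compose (L2 M) B A) k"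
    note P = bounded_operator_power[OF BA, of k]
    have "op_norm M (op_power M (compose (L2 M) A B) n) = op_norm M (compose (L2 M) A (compose (L2 M) ?P B))"
      unfolding k by (simp only: op_power_compose_Suc[OF bounded_operatorD[OF A] bounded_operatorD[OF B]])
    also have "\<dots> \<le> op_norm M A * op_norm M (compose (L2 M) ?P B)"
      by (rule bounded_operator_compose(2)[OF A bounded_operator_compose(1)[OF P B]])
    also have "\<dots> \<le> op_norm M A * (op_norm M ?P * op_norm M B)"
      by (rule mult_left_mono[OF bounded_operator_compose(2)[OF P B] op_norm_nonneg[OF A]])
    also have "\<dots> \<le> op_norm M A * ((C * t ^ k) * op_norm M B)"
      by (intro mult_left_mono mult_right_mono C op_norm_nonneg A B)
    also have "\<dots> = op_norm M A * op_norm M B * C / t * t ^ n" using t0 by (simp add: k)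
    finally show "op_norm M (op_power M (compose (L2 M) A B) n) \<le> op_norm M A * op_norm M B * C / t * t ^ n" .
  qed
qed

text \<open>The lower bound of \<open>op_norm_power_adjoint\<close> is pushed through the comparison
  at the exponents 2 ^ k and meets the growth bound C * t ^ (2 ^ k) for D.\<close>

lemma op_norm_sq_le_spectral_radius:
  assumes A: "bounded_operator M A" and B: "is_adjoint M A B" and D: "bounded_operator M D"
    and le: "\<And>n. n > 0 \<Longrightarrow> op_norm M (op_power M (compose (L2 M) B A) n) \<le> op_norm M (op_power M D n)"
  shows "(op_norm M A)\<^sup>2 \<le> op_spectral_radius M D"
proof (rule dense_ge)
  fix t assume t: "op_spectral_radius M D < t"
  then have t0: "0 < t" using op_spectral_radius_nonneg[OF D] by linarith
  obtain C where C: "\<And>n. op_norm M (op_power M D n) \<le> C * t ^ n" using op_norm_power_bound[OF D t] by metis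
  show "(op_norm M A)\<^sup>2 \<le> t"
  proof (rule power_growth_le[where f = "\<lambda>k. 2 ^ k" and C = C, OF _ _ t0])
    fix k
    show "(op_norm M A)\<^sup>2 ^ 2 ^ k \<le> C * t ^ 2 ^ k"
      using op_norm_power_adjoint[OF A B, of k] le[of "2 ^ k"] C[of "2 ^ k"] by simp
  qed (simp add: less_imp_le)
qed

section \<open>Growth rates of sequences\<close>

text \<open>Shaped like \<open>gen_spectral_radius\<close>; the root at k = 0, where 1 / 0 = 0, does
  not affect the limsup.\<close>

definition growth_rate :: "(nat \<Rightarrow> real) \<Rightarrow> real" where
  "growth_rate x = real_of_ereal (limsup (\<lambda>k. ereal (x k powr (1 / real k))))"

text \<open>A geometric bound makes the limsup finite, so that its conversion to a real number is
  faithful; the k-th root of the constant tends to 1.\<close>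

lemma growth_rate_limsup:
  fixes x :: "nat \<Rightarrow> real"
  assumes x0: "\<And>k. 0 \<le> x k" and C: "\<And>k. k > 0 \<Longrightarrow> x k \<le> C * t ^ k" and t: "0 < t"
  shows "limsup (\<lambda>k. ereal (x k powr (1 / real k))) = ereal (growth_rate x)" "0 \<le> growth_rate x" "growth_rate x \<le> t"
proof -
  let ?f = "\<lambda>k. ereal (x k powr (1 / real k))"
  \<comment> \<open>Positive, because the limit uses \<open>?C powr 0 = 1\<close>, which fails at
    0.\<close>
  let ?C = "max C 1"
  have "(\<lambda>k. ?C powr (1 / real k) * t) \<longlonglongrightarrow> ?C powr 0 * t"
    by (intro tendsto_intros lim_1_over_n) auto
  also have "?C powr 0 * t = t" by (subst powr_zero_eq_one) auto
  finally have lim: "(\<lambda>k. ereal (?C powr (1 / real k) * t)) \<longlonglongrightarrow> ereal t" by simp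
  have "limsup ?f \<le> limsup (\<lambda>k. ereal (?C powr (1 / real k) * t))"
  proof (rule Limsup_mono, rule eventually_sequentiallyI[of 1])
    fix k :: nat assume k: "1 \<le> k"
    have "x k powr (1 / real k) \<le> (?C * t ^ k) powr (1 / real k)"
    proof (rule powr_mono2)
      have "x k \<le> C * t ^ k" using C k by simp
      also have "\<dots> \<le> ?C * t ^ k" using t by (intro mult_right_mono) auto
      finally show "x k \<le> ?C * t ^ k" .
    qed (use x0 in auto)
    also have "\<dots> = ?C powr (1 / real k) * t" using t k
      by (subst powr_mult) (auto simp: powr_powr powr_realpow[symmetric])
    finally show "?f k \<le> ereal (?C powr (1 / real k) * t)" by simp
  qed
  also have "\<dots> = ereal t" by (rule lim_imp_Limsup[OF sequentially_bot lim])
  finally have le: "limsup ?f \<le> ereal t" .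
  have "0 \<le> liminf ?f" by (rule Liminf_bounded) auto
  also have "\<dots> \<le> limsup ?f" by (rule Liminf_le_Limsup) simp
  finally have ge: "0 \<le> limsup ?f" .
  then show *: "limsup ?f = ereal (growth_rate x)" using le unfolding growth_rate_def
    by (cases "limsup ?f") auto
  show "0 \<le> growth_rate x" "growth_rate x \<le> t" using le ge unfolding * by auto
qed

lemma growth_rate_bound:
  assumes x0: "\<And>k. 0 \<le> x k" and B: "\<And>k. x k \<le> B ^ k" "0 < B" and t: "growth_rate x < t"
  obtains C where "0 \<le> C" "\<And>k. x k \<le> C * t ^ k"
proof -
  have aux: "limsup (\<lambda>k. ereal (x k powr (1 / real k))) = ereal (growth_rate x)" "0 \<le> growth_rate x"
    using growth_rate_limsup[of x 1 B] x0 B by auto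
  have t0: "0 < t" using aux t by linarith
  have "limsup (\<lambda>k. ereal (x k powr (1 / real k))) < ereal t" using aux t by simp
  then have "\<forall>\<^sub>F k in sequentially. ereal (x k powr (1 / real k)) < ereal t" by (rule Limsup_lessD)
  then obtain K where K: "\<And>k. k \<ge> K \<Longrightarrow> x k powr (1 / real k) < t" by (auto simp: eventually_sequentially)
  \<comment> \<open>The sum takes care of the indices up to K, the summand 1 of all later
    ones.\<close>
  define C where "C = 1 + (\<Sum>k\<le>K. B ^ k / t ^ k)"
  have s: "0 \<le> B ^ k / t ^ k" for k using B t0 by simp
  have "x k \<le> C * t ^ k" for k
  proof (cases "k > K")
    case True
    have "x k = (x k powr (1 / real k)) powr real k" using True x0[of k] by (simp add: powr_powr powr_one_gt_zero_iff)
    also have "\<dots> \<le> t powr real k" using K[of k] True by (intro powr_mono2) auto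
    also have "\<dots> = t ^ k" using t0 by (simp add: powr_realpow)
    also have "\<dots> \<le> C * t ^ k" using t0 sum_nonneg[of "{..K}" "\<lambda>k. B ^ k / t ^ k"] s by (simp add: C_def)
    finally show ?thesis .
  next
    case False
    have "x k \<le> B ^ k / t ^ k * t ^ k" using B t0 by simp
    also have "\<dots> \<le> C * t ^ k"
      using member_le_sum[of k "{..K}" "\<lambda>k. B ^ k / t ^ k"] False s t0 unfolding C_def by (intro mult_right_mono) auto
    finally show ?thesis .
  qed
  moreover have "0 \<le> C" unfolding C_def using s by (intro add_nonneg_nonneg sum_nonneg) auto
  ultimately show ?thesis using that by blast
qed

text \<open>Fekete's lemma in multiplicative form: dividing k by n shows that the growth rate is at
  most the n-th root of x n for every n > 0, so the liminf reaches the limsup. This gives meaning to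
  the \<open>lim\<close> in \<open>joint_spectral_radius\<close>.\<close>

lemma growth_rate_Fekete:
  assumes x0: "\<And>k. 0 \<le> x k" and B: "\<And>k. x k \<le> B ^ k" "1 \<le> B" and sub: "\<And>j k. x (j + k) \<le> x j * x k"
  shows "lim (\<lambda>k. x k powr (1 / real k)) = growth_rate x"
proof -
  let ?f = "\<lambda>k. x k powr (1 / real k)"
  have aux: "limsup (\<lambda>k. ereal (?f k)) = ereal (growth_rate x)"
    using growth_rate_limsup(1)[of x 1 B] x0 B by auto
  have le: "growth_rate x \<le> ?f n" if n: "n > 0" for n
  proof (rule dense_ge)
    fix t assume t: "?f n < t"
    then have t0: "0 < t" using powr_ge_zero[of "x n" "1 / real n"] by linarith
    have "x n = ?f n powr real n" using n x0[of n] by (simp add: powr_powr powr_one_gt_zero_iff)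
    also have "\<dots> \<le> t powr real n" using t by (intro powr_mono2) auto
    finally have xn: "x n \<le> t ^ n" using t0 by (simp add: powr_realpow)
    have mult: "x (n * q) \<le> t ^ (n * q)" for q
    proof (induction q)
      case 0
      then show ?case using B(1)[of 0] by simp
    next
      case (Suc q)
      have "x (n * Suc q) \<le> x n * x (n * q)" using sub[of n "n * q"] by simp
      also have "\<dots> \<le> t ^ n * t ^ (n * q)" by (intro mult_mono xn Suc x0) (use t0 in simp)
      finally show ?case by (simp add: power_add)
    qed
    \<comment> \<open>The remainder contributes at most B ^ n, and passing from t ^ (n * (k div n))
      to t ^ k at most \<open>max 1 (1 / t) ^ n\<close>.\<close>
    define C where "C = (B * max 1 (1 / t)) ^ n"
    have "x k \<le> C * t ^ k" for k
    proof -
      have "x k \<le> x (n * (k div n)) * x (k mod n)" using sub[of "n * (k div n)" "k mod n"] by simp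
      also have "\<dots> \<le> t ^ (n * (k div n)) * B ^ n"
      proof (rule mult_mono[OF mult])
        show "x (k mod n) \<le> B ^ n" using B(1)[of "k mod n"] power_increasing[of "k mod n" n B] B(2) n
          by (meson less_imp_le mod_less_divisor order_trans)
      qed (use t0 x0 in auto)
      also have "t ^ (n * (k div n)) \<le> max 1 (1 / t) ^ n * t ^ k"
      proof -
        have "t ^ k = t ^ (n * (k div n)) * t ^ (k mod n)" by (simp flip: power_add)
        then have "t ^ (n * (k div n)) = (1 / t) ^ (k mod n) * t ^ k" using t0 by (simp add: power_divide)
        also have "(1 / t) ^ (k mod n) \<le> max 1 (1 / t) ^ (k mod n)" by (rule power_mono) (use t0 in auto)
        also have "\<dots> \<le> max 1 (1 / t) ^ n" by (rule power_increasing) (use n in \<open>auto intro: less_imp_le\<close>)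
        finally show ?thesis using t0 by simp
      qed
      finally show ?thesis using B by (simp add: C_def power_mult_distrib mult_left_mono mult_right_mono ac_simps)
    qed
    then show "growth_rate x \<le> t" using growth_rate_limsup(3)[of x C t] x0 t0 by blast
  qed
  have "ereal (growth_rate x) \<le> liminf (\<lambda>k. ereal (?f k))"
    by (rule Liminf_bounded, rule eventually_sequentiallyI[of 1]) (use le in auto)
  moreover have "liminf (\<lambda>k. ereal (?f k)) \<le> limsup (\<lambda>k. ereal (?f k))" by (rule Liminf_le_Limsup) simp
  ultimately have "liminf (\<lambda>k. ereal (?f k)) = ereal (growth_rate x)" using aux by simp
  then have "(\<lambda>k. ereal (?f k)) \<longlonglongrightarrow> ereal (growth_rate x)" using aux by (intro Liminf_eq_Limsup) auto
  then have "?f \<longlonglongrightarrow> growth_rate x" by simp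
  then show ?thesis by (rule limI)
qed

section \<open>Bounded sets of operators\<close>

text \<open>The nonnegative C allows bounds to be multiplied even if the set is empty.\<close>

definition bounded_ops :: "'a measure \<Rightarrow> 'a L2_op set \<Rightarrow> bool" where
  "bounded_ops M \<Psi> \<longleftrightarrow> (\<exists>C\<ge>0. \<forall>A\<in>\<Psi>. bounded_operator M A \<and> op_norm M A \<le> C)"

lemma bounded_opsD: "bounded_ops M \<Psi> \<Longrightarrow> A \<in> \<Psi> \<Longrightarrow> bounded_operator M A"
  by (auto simp: bounded_ops_def)

lemma bounded_opsI: "(\<And>A. A \<in> \<Psi> \<Longrightarrow> bounded_operator M A \<and> op_norm M A \<le> C) \<Longrightarrow> bounded_ops M \<Psi>"
  unfolding bounded_ops_def by (rule exI[of _ "max C 0"]) (auto intro: max.coboundedI1)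

lemma bounded_opsI_set:
  assumes "bounded_op_set M \<Psi>" "\<And>A. A \<in> \<Psi> \<Longrightarrow> L2_operator M A" shows "bounded_ops M \<Psi>"
proof -
  obtain C where C: "\<And>A F. A \<in> \<Psi> \<Longrightarrow> F \<in> L2 M \<Longrightarrow> L2_norm M (A F) \<le> C * L2_norm M F"
    using assms(1) by (auto simp: bounded_op_set_def)
  show ?thesis
  proof (rule bounded_opsI[of _ _ "max C 0"], intro conjI)
    fix A assume A: "A \<in> \<Psi>"
    show "bounded_operator M A" by (rule bounded_operatorI[OF assms(2)[OF A] C[OF A]])
    show "op_norm M A \<le> max C 0"
    proof (rule op_norm_le)
      fix F assume F: "F \<in> L2 M"
      have "L2_norm M (A F) \<le> C * L2_norm M F" by (rule C[OF A F])
      also have "\<dots> \<le> max C 0 * L2_norm M F" by (rule mult_right_mono) auto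
      finally show "L2_norm M (A F) \<le> max C 0 * L2_norm M F" .
    qed simp
  qed
qed

lemma ops_prod_eq: "ops_prod M \<Psi>s = {op_list_prod M As | As. list_all2 (\<in>) As \<Psi>s}"
  by (simp add: ops_prod_def op_list_prod_def)

definition ops_comp :: "'a measure \<Rightarrow> 'a L2_op set \<Rightarrow> 'a L2_op set \<Rightarrow> 'a L2_op set" where
  "ops_comp M P Q = {compose (L2 M) A B | A B. A \<in> P \<and> B \<in> Q}"

lemma ops_prod_Nil: "ops_prod M [] = {op_list_prod M []}"
  by (auto simp: ops_prod_eq)

lemma ops_prod_Cons: "ops_prod M (\<Psi> # \<Psi>s) = ops_comp M \<Psi> (ops_prod M \<Psi>s)"
proof (intro set_eqI iffI)
  fix X assume "X \<in> ops_prod M (\<Psi> # \<Psi>s)"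
  then obtain A As where A: "A \<in> \<Psi>" "list_all2 (\<in>) As \<Psi>s" "X = compose (L2 M) A (op_list_prod M As)"
    by (auto simp: ops_prod_eq list_all2_Cons2 op_list_prod_Cons)
  then have "op_list_prod M As \<in> ops_prod M \<Psi>s" by (auto simp: ops_prod_eq)
  with A show "X \<in> ops_comp M \<Psi> (ops_prod M \<Psi>s)" unfolding ops_comp_def by blast
next
  fix X assume "X \<in> ops_comp M \<Psi> (ops_prod M \<Psi>s)"
  then obtain A As where "A \<in> \<Psi>" "list_all2 (\<in>) As \<Psi>s" "X = op_list_prod M (A # As)"
    by (auto simp: ops_prod_eq ops_comp_def op_list_prod_Cons)
  then show "X \<in> ops_prod M (\<Psi> # \<Psi>s)" unfolding ops_prod_eq by (blast intro: list_all2_Cons[THEN iffD2])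
qed

lemma ops_prod_append:
  assumes "\<And>\<Psi> A. \<Psi> \<in> set xs \<union> set ys \<Longrightarrow> A \<in> \<Psi> \<Longrightarrow> L2_operator M A"
  shows "ops_prod M (xs @ ys) = ops_comp M (ops_prod M xs) (ops_prod M ys)"
proof -
  have L: "L2_operator M A" if "list_all2 (\<in>) As zs" "set zs \<subseteq> set xs \<union> set ys" "A \<in> set As" for As zs A
    using that assms by (metis in_set_conv_nth list_all2_conv_all_nth subsetD)
  have app: "op_list_prod M (As @ Bs) = compose (L2 M) (op_list_prod M As) (op_list_prod M Bs)"
    if "list_all2 (\<in>) As xs" "list_all2 (\<in>) Bs ys" for As Bs
    by (rule op_list_prod_append) (use L that in auto)
  show ?thesis
  proof (intro set_eqI iffI)
    fix X assume "X \<in> ops_prod M (xs @ ys)"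
    then obtain As Bs where "list_all2 (\<in>) As xs" "list_all2 (\<in>) Bs ys" "X = op_list_prod M (As @ Bs)"
      by (auto simp: ops_prod_eq list_all2_append2)
    with app show "X \<in> ops_comp M (ops_prod M xs) (ops_prod M ys)" by (auto simp: ops_comp_def ops_prod_eq)
  next
    fix X assume "X \<in> ops_comp M (ops_prod M xs) (ops_prod M ys)"
    then obtain As Bs where *: "list_all2 (\<in>) As xs" "list_all2 (\<in>) Bs ys"
      "X = compose (L2 M) (op_list_prod M As) (op_list_prod M Bs)"
      by (auto simp: ops_comp_def ops_prod_eq)
    then have "X = op_list_prod M (As @ Bs)" "list_all2 (\<in>) (As @ Bs) (xs @ ys)"
      by (auto simp: app intro: list_all2_appendI)
    then show "X \<in> ops_prod M (xs @ ys)" unfolding ops_prod_eq by blast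
  qed
qed

lemma ops_prod_concat:
  assumes "\<And>L \<Psi> A. L \<in> set Ls \<Longrightarrow> \<Psi> \<in> set L \<Longrightarrow> A \<in> \<Psi> \<Longrightarrow> L2_operator M A"
  shows "ops_prod M (map (ops_prod M) Ls) = ops_prod M (concat Ls)"
  using assms
proof (induction Ls)
  case (Cons L Ls)
  have "ops_prod M (concat (L # Ls)) = ops_comp M (ops_prod M L) (ops_prod M (concat Ls))"
    unfolding concat.simps by (rule ops_prod_append) (use Cons.prems in auto)
  moreover have "ops_prod M (map (ops_prod M) Ls) = ops_prod M (concat Ls)"
    by (rule Cons.IH) (use Cons.prems in auto)
  ultimately show ?case by (simp add: ops_prod_Cons)
qed simp

lemma ops_power_prod:
  assumes "\<And>\<Psi> A. \<Psi> \<in> set L \<Longrightarrow> A \<in> \<Psi> \<Longrightarrow> L2_operator M A"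
  shows "ops_power M (ops_prod M L) k = ops_prod M (concat (replicate k L))"
  using ops_prod_concat[of "replicate k L" M] assms
  by (auto simp: ops_power_def map_replicate in_set_replicate)

lemma ops_power_eq: "ops_power M \<Psi> k = {op_list_prod M As | As. length As = k \<and> set As \<subseteq> \<Psi>}"
proof -
  have "list_all2 (\<in>) As (replicate k \<Psi>) \<longleftrightarrow> length As = k \<and> set As \<subseteq> \<Psi>" for As :: "'a L2_op list"
    by (auto simp: list_all2_conv_all_nth in_set_conv_nth subset_iff)
  then show ?thesis by (simp add: ops_power_def ops_prod_eq)
qed

lemma ops_comp_bounded:
  assumes "bounded_ops M P" "bounded_ops M Q" shows "bounded_ops M (ops_comp M P Q)"
proof -
  obtain C D where C: "0 \<le> C" "\<And>A. A \<in> P \<Longrightarrow> bounded_operator M A \<and> op_norm M A \<le> C"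
    and D: "0 \<le> D" "\<And>A. A \<in> Q \<Longrightarrow> bounded_operator M A \<and> op_norm M A \<le> D"
    using assms unfolding bounded_ops_def by metis
  show ?thesis
  proof (rule bounded_opsI)
    fix X assume "X \<in> ops_comp M P Q"
    then obtain A B where AB: "A \<in> P" "B \<in> Q" "X = compose (L2 M) A B" by (auto simp: ops_comp_def)
    note bc = bounded_operator_compose[OF conjunct1[OF C(2)[OF AB(1)]] conjunct1[OF D(2)[OF AB(2)]]]
    have "op_norm M A * op_norm M B \<le> C * D" using C D AB by (intro mult_mono) auto
    then show "bounded_operator M X \<and> op_norm M X \<le> C * D" using bc AB(3) by auto
  qed
qed

lemma ops_prod_bounded: "(\<And>\<Psi>. \<Psi> \<in> set L \<Longrightarrow> bounded_ops M \<Psi>) \<Longrightarrow> bounded_ops M (ops_prod M L)"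
proof (induction L)
  case Nil
  then show ?case using op_norm_id[of M] bounded_operator_id[of M] by (auto simp: ops_prod_Nil intro: bounded_opsI)
qed (auto simp: ops_prod_Cons ops_comp_bounded)

lemma ops_adjoint_bounded: "bounded_ops M \<Psi> \<Longrightarrow> bounded_ops M (ops_adjoint M \<Psi>)"
proof -
  assume "bounded_ops M \<Psi>"
  then obtain C where C: "\<And>A. A \<in> \<Psi> \<Longrightarrow> bounded_operator M A \<and> op_norm M A \<le> C"
    unfolding bounded_ops_def by metis
  show ?thesis
  proof (rule bounded_opsI)
    fix B assume "B \<in> ops_adjoint M \<Psi>"
    then obtain A where A: "A \<in> \<Psi>" "is_adjoint M A B" by (auto simp: ops_adjoint_eq)
    show "bounded_operator M B \<and> op_norm M B \<le> C"
      using is_adjoint_bounded[OF conjunct1[OF C[OF A(1)]] A(2)] C[OF A(1)] by simp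
  qed
qed

section \<open>Joint and generalized spectral radius\<close>

text \<open>The function \<open>w\<close> is the operator norm or the spectral radius, which yields the joint and the
  generalized spectral radius respectively.\<close>

definition sup_power :: "'a measure \<Rightarrow> ('a L2_op \<Rightarrow> real) \<Rightarrow> 'a L2_op set \<Rightarrow> nat \<Rightarrow> real" where
  "sup_power M w \<Psi> k = Sup_nonneg (w ` ops_power M \<Psi> k)"

definition weighted_radius :: "'a measure \<Rightarrow> ('a L2_op \<Rightarrow> real) \<Rightarrow> 'a L2_op set \<Rightarrow> real" where
  "weighted_radius M w \<Psi> = growth_rate (sup_power M w \<Psi>)"

lemma gen_spectral_radius_eq: "gen_spectral_radius M \<Psi> = weighted_radius M (op_spectral_radius M) \<Psi>"
  by (simp add: gen_spectral_radius_def weighted_radius_def growth_rate_def sup_power_def)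

text \<open>Kept as two concrete cases because key arguments differ: submultiplicativity belongs to
  the norm, whereas invariance under exchanging two factors and the lower bound for powers belong to
  the spectral radius.\<close>

definition size_function :: "'a measure \<Rightarrow> ('a L2_op \<Rightarrow> real) \<Rightarrow> bool" where
  "size_function M w \<longleftrightarrow> w = op_norm M \<or> w = op_spectral_radius M"

lemma size_function_bounds:
  assumes "size_function M w" "bounded_operator M A"
  shows "0 \<le> w A" "w A \<le> op_norm M A" "op_spectral_radius M A \<le> w A"
  using assms op_spectral_radius_le_norm[of M A] by (auto simp: size_function_def)

lemma bounded_ops_powerE:
  assumes "bounded_ops M \<Psi>"
  obtains B where "1 \<le> B" "\<And>k A. A \<in> ops_power M \<Psi> k \<Longrightarrow> bounded_operator M A \<and> op_norm M A \<le> B ^ k"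
proof -
  obtain C where C: "0 \<le> C" "\<And>A. A \<in> \<Psi> \<Longrightarrow> bounded_operator M A \<and> op_norm M A \<le> C"
    using assms unfolding bounded_ops_def by metis
  show ?thesis
  proof (rule that[of "max C 1"])
    fix k A assume "A \<in> ops_power M \<Psi> k"
    then obtain As where As: "A = op_list_prod M As" "length As = k" "set As \<subseteq> \<Psi>" by (auto simp: ops_power_eq)
    then show "bounded_operator M A \<and> op_norm M A \<le> max C 1 ^ k"
      using bounded_operator_list_prod[of As M] op_norm_list_prod[of As M "max C 1"] C(2)
      by (fastforce intro: max.coboundedI1)
  qed simp
qed

lemma sup_power_bounds:
  assumes w: "size_function M w" and \<Psi>: "bounded_ops M \<Psi>"
  obtains B where "1 \<le> B" "\<And>k. 0 \<le> sup_power M w \<Psi> k" "\<And>k. sup_power M w \<Psi> k \<le> B ^ k"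
    "\<And>k A. A \<in> ops_power M \<Psi> k \<Longrightarrow> w A \<le> sup_power M w \<Psi> k"
proof -
  obtain B where B: "1 \<le> B" "\<And>k A. A \<in> ops_power M \<Psi> k \<Longrightarrow> bounded_operator M A \<and> op_norm M A \<le> B ^ k"
    using bounded_ops_powerE[OF \<Psi>] by metis
  have wB: "w A \<le> B ^ k" if "A \<in> ops_power M \<Psi> k" for A k
    using B(2)[OF that] size_function_bounds(2)[OF w, of A] by linarith
  then have bdd: "bdd_above (w ` ops_power M \<Psi> k)" for k by (auto intro!: bdd_aboveI)
  show ?thesis
  proof (rule that[OF B(1)])
    fix k show "0 \<le> sup_power M w \<Psi> k" unfolding sup_power_def by (rule Sup_nonneg_ge_0[OF bdd])
    show "sup_power M w \<Psi> k \<le> B ^ k" unfolding sup_power_def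
      by (rule Sup_nonneg_least) (use wB B(1) in auto)
    fix A assume "A \<in> ops_power M \<Psi> k"
    then show "w A \<le> sup_power M w \<Psi> k" unfolding sup_power_def by (intro Sup_nonneg_upper[OF bdd]) auto
  qed
qed

lemma weighted_radius_nonneg:
  assumes w: "size_function M w" and \<Psi>: "bounded_ops M \<Psi>" shows "0 \<le> weighted_radius M w \<Psi>"
proof -
  obtain B where B: "1 \<le> B" "\<And>k. 0 \<le> sup_power M w \<Psi> k" "\<And>k. sup_power M w \<Psi> k \<le> B ^ k"
    using sup_power_bounds[OF assms] by metis
  then show ?thesis unfolding weighted_radius_def using growth_rate_limsup(2)[of "sup_power M w \<Psi>" 1 B] by auto
qed

text \<open>Together with the converse \<open>weighted_radius_le\<close> this replaces limsups by
  estimates that are uniform over all words of a given length; later comparisons of radii go through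
  this pair.\<close>

lemma weighted_radius_bound:
  assumes w: "size_function M w" and \<Psi>: "bounded_ops M \<Psi>" and t: "weighted_radius M w \<Psi> < t"
  obtains C where "0 \<le> C" "\<And>k A. A \<in> ops_power M \<Psi> k \<Longrightarrow> w A \<le> C * t ^ k"
proof -
  obtain B where B: "1 \<le> B" "\<And>k. 0 \<le> sup_power M w \<Psi> k" "\<And>k. sup_power M w \<Psi> k \<le> B ^ k"
    "\<And>k A. A \<in> ops_power M \<Psi> k \<Longrightarrow> w A \<le> sup_power M w \<Psi> k"
    using sup_power_bounds[OF w \<Psi>] by metis
  obtain C where "0 \<le> C" "\<And>k. sup_power M w \<Psi> k \<le> C * t ^ k"
    using growth_rate_bound[of "sup_power M w \<Psi>" B t] B t unfolding weighted_radius_def by (metis less_le_trans zero_less_one)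
  then show ?thesis using that B(4) by (meson order_trans)
qed

lemma weighted_radius_le:
  assumes w: "size_function M w" and \<Psi>: "bounded_ops M \<Psi>" and t: "0 < t"
    and le: "\<And>k A. k > 0 \<Longrightarrow> A \<in> ops_power M \<Psi> k \<Longrightarrow> w A \<le> C * t ^ k"
  shows "weighted_radius M w \<Psi> \<le> t"
  unfolding weighted_radius_def
proof (rule growth_rate_limsup(3)[OF _ _ t])
  show "0 \<le> sup_power M w \<Psi> k" for k using sup_power_bounds[OF w \<Psi>] by metis
  fix k :: nat assume k: "k > 0"
  show "sup_power M w \<Psi> k \<le> max C 0 * t ^ k" unfolding sup_power_def
  proof (rule Sup_nonneg_least)
    fix x assume "x \<in> w ` ops_power M \<Psi> k"
    then have "x \<le> C * t ^ k" using le k by auto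
    also have "\<dots> \<le> max C 0 * t ^ k" by (rule mult_right_mono) (use t in auto)
    finally show "x \<le> max C 0 * t ^ k" .
  qed (use t in simp)
qed

text \<open>Splitting a word of length j + k makes the suprema of norms submultiplicative, so
  Fekete's lemma identifies the limit with the limsup.\<close>

lemma joint_spectral_radius_eq:
  assumes \<Psi>: "bounded_ops M \<Psi>" shows "joint_spectral_radius M \<Psi> = weighted_radius M (op_norm M) \<Psi>"
proof -
  let ?x = "sup_power M (op_norm M) \<Psi>"
  have w: "size_function M (op_norm M)" by (simp add: size_function_def)
  obtain B where B: "1 \<le> B" "\<And>k. 0 \<le> ?x k" "\<And>k. ?x k \<le> B ^ k"
    "\<And>k A. A \<in> ops_power M \<Psi> k \<Longrightarrow> op_norm M A \<le> ?x k"
    using sup_power_bounds[OF w \<Psi>] by metis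
  have sub: "?x (j + k) \<le> ?x j * ?x k" for j k
    unfolding sup_power_def[of _ _ _ "j + k"]
  proof (rule Sup_nonneg_least)
    show "0 \<le> ?x j * ?x k" using B by simp
    fix x assume "x \<in> op_norm M ` ops_power M \<Psi> (j + k)"
    then obtain As where As: "x = op_norm M (op_list_prod M As)" "length As = j + k" "set As \<subseteq> \<Psi>" by (auto simp: ops_power_eq)
    have in1: "op_list_prod M (take j As) \<in> ops_power M \<Psi> j"
      unfolding ops_power_eq using As by (auto intro!: exI[of _ "take j As"] dest: in_set_takeD)
    have in2: "op_list_prod M (drop j As) \<in> ops_power M \<Psi> k"
      unfolding ops_power_eq using As by (auto intro!: exI[of _ "drop j As"] dest: in_set_dropD)
    have b: "bounded_operator M A" if "A \<in> set As" for A using bounded_opsD[OF \<Psi>] that As(3) by auto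
    have b1: "bounded_operator M (op_list_prod M (take j As))" "bounded_operator M (op_list_prod M (drop j As))"
      by (intro bounded_operator_list_prod b; auto dest: in_set_takeD in_set_dropD)+
    have "op_list_prod M (take j As @ drop j As) = compose (L2 M) (op_list_prod M (take j As)) (op_list_prod M (drop j As))"
      by (rule op_list_prod_append) (use b in \<open>auto dest: in_set_takeD in_set_dropD intro: bounded_operatorD\<close>)
    then have "x \<le> op_norm M (op_list_prod M (take j As)) * op_norm M (op_list_prod M (drop j As))"
      using bounded_operator_compose(2)[OF b1] As(1) by simp
    also have "\<dots> \<le> ?x j * ?x k" by (intro mult_mono B(4) in1 in2 B(2) op_norm_nonneg b1)
    finally show "x \<le> ?x j * ?x k" .
  qed
  show ?thesis
    using growth_rate_Fekete[of ?x B, OF B(2,3,1) sub]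
    by (simp add: joint_spectral_radius_def weighted_radius_def ops_norm_def sup_power_def)
qed

lemma op_power_in_ops_power: "A \<in> \<Psi> \<Longrightarrow> op_power M A k \<in> ops_power M \<Psi> k"
  unfolding ops_power_eq by (auto intro!: exI[of _ "replicate k A"])

text \<open>Powers of A are words over \<Psi>, and the k-th power of the radius of A is at most the
  radius of the k-th power, hence at most its size.\<close>

lemma op_spectral_radius_le_weighted:
  assumes w: "size_function M w" and \<Psi>: "bounded_ops M \<Psi>" and A: "A \<in> \<Psi>"
  shows "op_spectral_radius M A \<le> weighted_radius M w \<Psi>"
proof (rule dense_ge)
  note bA = bounded_opsD[OF \<Psi> A]
  fix t assume t: "weighted_radius M w \<Psi> < t"
  then have t0: "0 < t" using weighted_radius_nonneg[OF w \<Psi>] by linarith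
  obtain C where C: "0 \<le> C" "\<And>k A. A \<in> ops_power M \<Psi> k \<Longrightarrow> w A \<le> C * t ^ k"
    using weighted_radius_bound[OF w \<Psi> t] by metis
  show "op_spectral_radius M A \<le> t"
  proof (rule power_growth_le[where f = Suc and C = C, OF _ _ t0])
    fix k
    have "op_spectral_radius M A ^ Suc k \<le> op_spectral_radius M (op_power M A (Suc k))"
      by (rule op_spectral_radius_power[OF bA]) simp
    also have "\<dots> \<le> w (op_power M A (Suc k))"
      by (rule size_function_bounds(3)[OF w bounded_operator_power[OF bA]])
    also have "\<dots> \<le> C * t ^ Suc k" by (rule C(2)[OF op_power_in_ops_power[OF A]])
    finally show "op_spectral_radius M A ^ Suc k \<le> C * t ^ Suc k" .
  qed simp
qed

text \<open>Control of the words whose length is a multiple of n suffices; the two sizes reach such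
  lengths in different ways, by cutting or by repeating a word.\<close>

lemma weighted_radius_le_multiple:
  assumes w: "size_function M w" and \<Psi>: "bounded_ops M \<Psi>" and t: "0 < t" and n: "n > 0"
    and le: "\<And>k A. k > 0 \<Longrightarrow> A \<in> ops_power M \<Psi> (n * k) \<Longrightarrow> w A \<le> C * t ^ k"
  shows "weighted_radius M w \<Psi> ^ n \<le> t"
proof -
  define s where "s = root n t"
  have s: "0 < s" "s ^ n = t" using t n by (simp_all add: s_def)
  have "weighted_radius M w \<Psi> \<le> s"
  proof -
    consider "w = op_norm M" | "w = op_spectral_radius M" using w by (auto simp: size_function_def)
    then show ?thesis
    proof cases
      case 1
      obtain B where B: "1 \<le> B" "\<And>k A. A \<in> ops_power M \<Psi> k \<Longrightarrow> bounded_operator M A \<and> op_norm M A \<le> B ^ k"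
        using bounded_ops_powerE[OF \<Psi>] by metis
      show ?thesis
      proof (rule weighted_radius_le[OF w \<Psi> s(1)])
        fix k A assume "A \<in> ops_power M \<Psi> k"
        then obtain As where As: "A = op_list_prod M As" "length As = k" "set As \<subseteq> \<Psi>" by (auto simp: ops_power_eq)
        \<comment> \<open>The norm is submultiplicative, so the word is cut at the largest multiple
          of n; the remaining letters cost at most B ^ n.\<close>
        let ?j = "n * (k div n)"
        have jk: "?j \<le> k" by simp
        have in1: "op_list_prod M (take ?j As) \<in> ops_power M \<Psi> ?j"
          unfolding ops_power_eq using As jk by (auto intro!: exI[of _ "take ?j As"] dest: in_set_takeD)
        have in2: "op_list_prod M (drop ?j As) \<in> ops_power M \<Psi> (k mod n)"
          unfolding ops_power_eq using As by (auto intro!: exI[of _ "drop ?j As"] dest: in_set_dropD simp: minus_mult_div_eq_mod)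
        have "op_list_prod M (take ?j As @ drop ?j As) = compose (L2 M) (op_list_prod M (take ?j As)) (op_list_prod M (drop ?j As))"
          by (rule op_list_prod_append) (use bounded_opsD[OF \<Psi>] As in \<open>auto dest!: in_set_takeD in_set_dropD intro: bounded_operatorD\<close>)
        then have "op_norm M A \<le> op_norm M (op_list_prod M (take ?j As)) * op_norm M (op_list_prod M (drop ?j As))"
          using bounded_operator_compose(2)[OF conjunct1[OF B(2)[OF in1]] conjunct1[OF B(2)[OF in2]]] As(1) by simp
        also have "\<dots> \<le> (max C 1 * t ^ (k div n)) * B ^ n"
        proof (rule mult_mono)
          show "op_norm M (op_list_prod M (take ?j As)) \<le> max C 1 * t ^ (k div n)"
          proof (cases "k div n = 0")
            case True
            then show ?thesis using op_norm_id[of M] by simp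
          next
            case False
            then have "op_norm M (op_list_prod M (take ?j As)) \<le> C * t ^ (k div n)"
              using le[OF _ in1] 1 by simp
            also have "\<dots> \<le> max C 1 * t ^ (k div n)" by (rule mult_right_mono) (use t in auto)
            finally show ?thesis .
          qed
          have "op_norm M (op_list_prod M (drop ?j As)) \<le> B ^ (k mod n)" using B(2)[OF in2] by simp
          also have "\<dots> \<le> B ^ n" by (rule power_increasing) (use B(1) n in \<open>auto intro: less_imp_le\<close>)
          finally show "op_norm M (op_list_prod M (drop ?j As)) \<le> B ^ n" .
        qed (use t B(2)[OF in2] in auto)
        also have "t ^ (k div n) \<le> max 1 (1 / s) ^ n * s ^ k"
        proof -
          have "s ^ k = t ^ (k div n) * s ^ (k mod n)" unfolding s(2)[symmetric] by (simp flip: power_add power_mult)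
          then have "t ^ (k div n) = (1 / s) ^ (k mod n) * s ^ k" using s by (simp add: power_divide)
          also have "(1 / s) ^ (k mod n) \<le> max 1 (1 / s) ^ (k mod n)" by (rule power_mono) (use s in auto)
          also have "\<dots> \<le> max 1 (1 / s) ^ n" by (rule power_increasing) (use n in \<open>auto intro: less_imp_le\<close>)
          finally show ?thesis using s by simp
        qed
        finally show "w A \<le> (max C 1 * max 1 (1 / s) ^ n * B ^ n) * s ^ k"
          using B(1) by (simp add: 1 mult_left_mono mult_right_mono ac_simps)
      qed
    next
      case 2
      show ?thesis
      proof (rule weighted_radius_le[OF w \<Psi> s(1)])
        fix k A assume k: "k > 0" and "A \<in> ops_power M \<Psi> k"
        then obtain As where As: "A = op_list_prod M As" "length As = k" "set As \<subseteq> \<Psi>" by (auto simp: ops_power_eq)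
        have bA: "bounded_operator M A" unfolding As(1) by (rule bounded_operator_list_prod) (use As bounded_opsD[OF \<Psi>] in auto)
        \<comment> \<open>The spectral radius is not submultiplicative, so the word is repeated n
          times instead of being cut; its length is then a multiple of n.\<close>
        have "op_list_prod M (concat (replicate n As)) = op_list_prod M (map (op_list_prod M) (replicate n As))"
          by (rule op_list_prod_concat) (use As bounded_opsD[OF \<Psi>] in \<open>auto simp: in_set_replicate intro: bounded_operatorD\<close>)
        then have "op_power M A n = op_list_prod M (concat (replicate n As))" by (simp add: map_replicate As(1))
        moreover have "length (concat (replicate n As)) = n * k" by (simp add: length_concat As sum_list_replicate)
        moreover have "set (concat (replicate n As)) \<subseteq> \<Psi>" using As by auto
        ultimately have "op_power M A n \<in> ops_power M \<Psi> (n * k)" unfolding ops_power_eq by blast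
        then have "op_spectral_radius M (op_power M A n) \<le> C * t ^ k" using le k 2 by auto
        then have "op_spectral_radius M A ^ n \<le> C * t ^ k" using op_spectral_radius_power[OF bA n] by simp
        also have "\<dots> \<le> max C 1 ^ n * (s ^ k) ^ n"
        proof -
          \<comment> \<open>Turns the constant into an n-th power, so that n-th roots can be taken
            on both sides.\<close>
          have "C \<le> max C 1 ^ n" using power_increasing[of 1 n "max C 1"] n by (simp add: Suc_leI)
          moreover have "(s ^ k) ^ n = t ^ k" unfolding s(2)[symmetric] by (simp flip: power_mult add: mult.commute)
          ultimately show ?thesis using t by (simp add: mult_right_mono)
        qed
        also have "\<dots> = (max C 1 * s ^ k) ^ n" by (simp add: power_mult_distrib)
        finally have "op_spectral_radius M A \<le> max C 1 * s ^ k"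
          by (subst (asm) power_mono_iff) (use s n bA in auto)
        then show "w A \<le> max C 1 * s ^ k" by (simp add: 2)
      qed
    qed
  qed
  then have "weighted_radius M w \<Psi> ^ n \<le> s ^ n" by (rule power_mono) (rule weighted_radius_nonneg[OF w \<Psi>])
  then show ?thesis using s by simp
qed

lemma concat_replicate_rotate:
  "concat (replicate (Suc j) (xs @ ys)) = xs @ concat (replicate j (ys @ xs)) @ ys"
  by (induction j) auto

lemma concat_replicate_Suc_right: "concat (replicate (Suc j) zs) = concat (replicate j zs) @ zs"
  by (induction j) auto

text \<open>A word (xs ys) ^ (j + 1) is xs (ys xs) ^ j ys. For the norm the two outer factors cost a
  constant; for the spectral radius xs is moved to the end by
  \<open>op_spectral_radius_compose_le\<close>, which gives a word over the rotated product of the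
  same length.\<close>

lemma weighted_radius_cyclic:
  assumes w: "size_function M w" and b: "\<And>\<Psi>. \<Psi> \<in> set xs \<union> set ys \<Longrightarrow> bounded_ops M \<Psi>"
  shows "weighted_radius M w (ops_prod M (xs @ ys)) \<le> weighted_radius M w (ops_prod M (ys @ xs))"
proof (rule dense_ge)
  let ?P = "ops_prod M (xs @ ys)" and ?Q = "ops_prod M (ys @ xs)"
  have bP: "bounded_ops M ?P" and bQ: "bounded_ops M ?Q" by (rule ops_prod_bounded; use b in auto)+
  have L: "L2_operator M A" if "\<Psi> \<in> set xs \<union> set ys" "A \<in> \<Psi>" for \<Psi> A
    using bounded_opsD[OF b] that by (auto intro: bounded_operatorD)
  fix t assume t: "weighted_radius M w ?Q < t"
  then have t0: "0 < t" using weighted_radius_nonneg[OF w bQ] by linarith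
  obtain C where C: "0 \<le> C" "\<And>k A. A \<in> ops_power M ?Q k \<Longrightarrow> w A \<le> C * t ^ k"
    using weighted_radius_bound[OF w bQ t] by metis
  have pP: "ops_power M ?P k = ops_prod M (concat (replicate k (xs @ ys)))" for k
    by (rule ops_power_prod) (use L in \<open>auto simp: in_set_replicate split: if_splits\<close>)
  have pQ: "ops_power M ?Q k = ops_prod M (concat (replicate k (ys @ xs)))" for k
    by (rule ops_power_prod) (use L in \<open>auto simp: in_set_replicate split: if_splits\<close>)
  have bx: "bounded_ops M (ops_prod M xs)" and by': "bounded_ops M (ops_prod M ys)"
    by (rule ops_prod_bounded; use b in auto)+
  have bc: "bounded_ops M (ops_prod M (concat (replicate j (ys @ xs))))" for j
    by (rule ops_prod_bounded) (use b in \<open>auto simp: in_set_replicate split: if_splits\<close>)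
  show "weighted_radius M w ?P \<le> t"
  proof -
    consider "w = op_norm M" | "w = op_spectral_radius M" using w by (auto simp: size_function_def)
    then show ?thesis
    proof cases
      case 1
      obtain X where X: "0 \<le> X" "\<And>A. A \<in> ops_prod M xs \<Longrightarrow> bounded_operator M A \<and> op_norm M A \<le> X"
        using bx unfolding bounded_ops_def by metis
      obtain Y where Y: "0 \<le> Y" "\<And>A. A \<in> ops_prod M ys \<Longrightarrow> bounded_operator M A \<and> op_norm M A \<le> Y"
        using by' unfolding bounded_ops_def by metis
      show ?thesis
      proof (rule weighted_radius_le[OF w bP t0])
        fix k A assume "k > 0" and A: "A \<in> ops_power M ?P k"
        then obtain j where j: "k = Suc j" by (cases k) auto
        have "ops_power M ?P k = ops_comp M (ops_prod M xs) (ops_prod M (concat (replicate j (ys @ xs)) @ ys))"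
          unfolding pP j concat_replicate_rotate by (rule ops_prod_append) (use L in \<open>auto simp: in_set_replicate split: if_splits\<close>)
        also have "ops_prod M (concat (replicate j (ys @ xs)) @ ys) = ops_comp M (ops_power M ?Q j) (ops_prod M ys)"
          unfolding pQ by (rule ops_prod_append) (use L in \<open>auto simp: in_set_replicate split: if_splits\<close>)
        finally obtain A1 A2 A3 where As: "A1 \<in> ops_prod M xs" "A2 \<in> ops_power M ?Q j" "A3 \<in> ops_prod M ys"
          "A = compose (L2 M) A1 (compose (L2 M) A2 A3)" using A by (auto simp: ops_comp_def)
        have b2: "bounded_operator M A2" using bounded_opsD[OF bc] As(2) by (auto simp: pQ)
        note b1 = conjunct1[OF X(2)[OF As(1)]] and b3 = conjunct1[OF Y(2)[OF As(3)]]
        have "op_norm M A \<le> op_norm M A1 * op_norm M (compose (L2 M) A2 A3)"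
          unfolding As(4) by (rule bounded_operator_compose(2)[OF b1 bounded_operator_compose(1)[OF b2 b3]])
        also have "\<dots> \<le> op_norm M A1 * (op_norm M A2 * op_norm M A3)"
          by (rule mult_left_mono[OF bounded_operator_compose(2)[OF b2 b3] op_norm_nonneg[OF b1]])
        also have "\<dots> \<le> X * ((C * t ^ j) * Y)"
          using X(2)[OF As(1)] Y(2)[OF As(3)] C(2)[OF As(2)] C(1) X(1) Y(1) t0 b1 b2 b3 unfolding 1
          by (intro mult_mono) auto
        also have "\<dots> = X * Y * C / t * t ^ k" using t0 by (simp add: j)
        finally show "w A \<le> X * Y * C / t * t ^ k" by (simp add: 1)
      qed
    next
      case 2
      show ?thesis
      proof (rule weighted_radius_le[OF w bP t0])
        fix k A assume "k > 0" and A: "A \<in> ops_power M ?P k"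
        then obtain j where j: "k = Suc j" by (cases k) auto
        have "ops_power M ?P k = ops_comp M (ops_prod M xs) (ops_prod M (concat (replicate j (ys @ xs)) @ ys))"
          unfolding pP j concat_replicate_rotate by (rule ops_prod_append) (use L in \<open>auto simp: in_set_replicate split: if_splits\<close>)
        then obtain A1 A2 where As: "A1 \<in> ops_prod M xs" "A2 \<in> ops_prod M (concat (replicate j (ys @ xs)) @ ys)"
          "A = compose (L2 M) A1 A2" using A by (auto simp: ops_comp_def)
        have "ops_power M ?Q k = ops_prod M ((concat (replicate j (ys @ xs)) @ ys) @ xs)"
          unfolding pQ j concat_replicate_Suc_right by simp
        also have "\<dots> = ops_comp M (ops_prod M (concat (replicate j (ys @ xs)) @ ys)) (ops_prod M xs)"
          by (rule ops_prod_append) (use L in \<open>auto simp: in_set_replicate split: if_splits\<close>)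
        finally have "compose (L2 M) A2 A1 \<in> ops_power M ?Q k" using As by (auto simp: ops_comp_def)
        from C(2)[OF this] have "op_spectral_radius M (compose (L2 M) A2 A1) \<le> C * t ^ k" by (simp add: 2)
        moreover have "bounded_operator M A2"
          by (rule bounded_opsD[OF ops_prod_bounded As(2)]) (use b in \<open>auto simp: in_set_replicate split: if_splits\<close>)
        ultimately show "w A \<le> C * t ^ k" unfolding 2 As(3)
          using op_spectral_radius_compose_le[OF bounded_opsD[OF bx As(1)], of A2] by simp
      qed
    qed
  qed
qed

section \<open>Real powers of extended nonnegative reals\<close>

text \<open>Infinity and 0 are fixed under every exponent, including 0; with these conventions
  \<open>epow_mult\<close> holds without side conditions.\<close>

definition epow :: "ennreal \<Rightarrow> real \<Rightarrow> ennreal" where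
  "epow x p = (if x = \<infinity> then \<infinity> else ennreal (enn2real x powr p))"

lemma epow_ennreal: "0 \<le> r \<Longrightarrow> epow (ennreal r) p = ennreal (r powr p)"
  by (simp add: epow_def)

lemma epow_top [simp]: "epow top p = top"
  by (simp add: epow_def)

lemma epow_0 [simp]: "epow 0 p = 0"
  by (simp add: epow_def)

lemma epow_one [simp]: "epow 1 p = 1"
  by (simp add: epow_def)

lemma epow_by_1 [simp]: "epow x 1 = x"
  by (cases x) (auto simp: epow_def)

lemma enn2real_epow: "enn2real (epow x p) = enn2real x powr p"
  by (cases x) (auto simp: epow_def)

lemma epow_eq_0_iff: "epow x p = 0 \<longleftrightarrow> x = 0"
  by (cases x) (auto simp: epow_ennreal)

lemma epow_mono: "x \<le> y \<Longrightarrow> 0 \<le> p \<Longrightarrow> epow x p \<le> epow y p"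
  by (cases x; cases y) (auto simp: epow_ennreal intro!: ennreal_leI powr_mono2 simp: top_unique)

lemma epow_mult: "epow (x * y) p = epow x p * epow y p"
  by (cases x; cases y)
    (auto simp: epow_ennreal powr_mult ennreal_mult[symmetric] ennreal_mult_top ennreal_top_mult epow_eq_0_iff)

lemma epow_prod: "epow (\<Prod>i\<in>I. f i) p = (\<Prod>i\<in>I. epow (f i) p)"
  by (induction I rule: infinite_finite_induct) (auto simp: epow_mult)

lemma epow_epow: "epow (epow x p) q = epow x (p * q)"
  by (cases x) (auto simp: epow_ennreal powr_powr)

lemma epow_add: "0 < p \<or> 0 < q \<Longrightarrow> epow x (p + q) = epow x p * epow x q"
  by (cases x) (auto simp: epow_ennreal powr_add ennreal_mult)

lemma epow_power: "epow x p ^ n = epow (x ^ n) p"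
  by (induction n) (auto simp: epow_mult)

lemma epow_power_eq:
  assumes "n > 0" shows "epow x p ^ n = epow x (real n * p)"
proof (cases x)
  case (real r)
  have "(r powr p) ^ n = r powr (real n * p)"
  proof (cases "r = 0")
    case False
    then have "(r powr p) ^ n = (r powr p) powr real n" by (simp add: powr_realpow)
    then show ?thesis by (simp add: powr_powr mult.commute)
  qed (use assms in simp)
  then show ?thesis using real by (simp add: epow_ennreal ennreal_power)
qed (use assms in simp)

lemma ennreal_prod_mono:
  fixes f g :: "'i \<Rightarrow> ennreal"
  shows "(\<And>i. i \<in> I \<Longrightarrow> f i \<le> g i) \<Longrightarrow> (\<Prod>i\<in>I. f i) \<le> (\<Prod>i\<in>I. g i)"
  by (induction I rule: infinite_finite_induct) (auto intro: mult_mono)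

lemma borel_measurable_epow [measurable (raw)]:
  assumes [measurable]: "f \<in> borel_measurable M" shows "(\<lambda>x. epow (f x) p) \<in> borel_measurable M"
  unfolding epow_def by measurable

section \<open>Hoelder's inequality\<close>

lemma ennreal_geom_mean_le:
  fixes g :: "'i \<Rightarrow> ennreal"
  assumes "finite I" "I \<noteq> {}"
  shows "of_nat (card I) * (\<Prod>i\<in>I. epow (g i) (1 / card I)) \<le> (\<Sum>i\<in>I. g i)"
proof (cases "\<exists>i\<in>I. g i = top")
  case True
  then obtain i where "i \<in> I" "g i = top" by auto
  then have "(\<Sum>i\<in>I. g i) = top" using member_le_sum[of i I g] assms by (simp add: top_unique)
  then show ?thesis by simp
next
  case False
  define r where "r i = enn2real (g i)" for i
  have r: "g i = ennreal (r i)" "0 \<le> r i" if "i \<in> I" for i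
    using False that by (auto simp: r_def ennreal_enn2real_if)
  have "(\<Prod>i\<in>I. epow (g i) (1 / card I)) = ennreal ((\<Prod>i\<in>I. r i) powr (1 / card I))"
  proof -
    have "(\<Prod>i\<in>I. g i) = ennreal (\<Prod>i\<in>I. r i)" using r by (simp add: prod_ennreal)
    then show ?thesis unfolding epow_prod[symmetric] using r by (simp add: epow_ennreal prod_nonneg)
  qed
  moreover have "(\<Sum>i\<in>I. g i) = ennreal (\<Sum>i\<in>I. r i)"
    using r by (simp add: sum_ennreal)
  moreover have "real (card I) * (\<Prod>i\<in>I. r i) powr (1 / card I) \<le> (\<Sum>i\<in>I. r i)"
  proof -
    have "(\<Prod>i\<in>I. r i) powr (1 / card I) \<le> (\<Sum>i\<in>I. r i / card I)"
      by (rule arith_geom_mean) (use assms r in auto)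
    then show ?thesis using assms by (simp add: sum_divide_distrib[symmetric] pos_le_divide_eq card_gt_0_iff mult.commute)
  qed
  ultimately show ?thesis
    by (simp add: ennreal_of_nat_eq_real_of_nat ennreal_mult[symmetric] ennreal_leI)
qed

text \<open>Normalise all integrals to 1 and integrate the inequality of arithmetic and geometric
  means. A vanishing integral kills the integrand almost everywhere; an infinite one, with no other
  vanishing, makes the right side infinite.\<close>

lemma nn_integral_Hoelder:
  fixes f :: "'i \<Rightarrow> 'a \<Rightarrow> ennreal"
  assumes I: "finite I" "I \<noteq> {}" and f [measurable]: "\<And>i. i \<in> I \<Longrightarrow> f i \<in> borel_measurable M"
  shows "(\<integral>\<^sup>+x. (\<Prod>i\<in>I. epow (f i x) (1 / card I)) \<partial>M) \<le> (\<Prod>i\<in>I. epow (\<integral>\<^sup>+x. f i x \<partial>M) (1 / card I))"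
proof -
  let ?c = "\<lambda>i. \<integral>\<^sup>+x. f i x \<partial>M"
  consider "\<exists>i\<in>I. ?c i = 0" | "\<forall>i\<in>I. ?c i \<noteq> 0" "\<exists>i\<in>I. ?c i = top" | "\<forall>i\<in>I. ?c i \<noteq> 0 \<and> ?c i \<noteq> top" by blast
  then show ?thesis
  proof cases
    case 1
    then obtain i where i: "i \<in> I" "?c i = 0" by auto
    have "AE x in M. f i x = 0" using i f[OF i(1)] by (simp add: nn_integral_0_iff_AE)
    then have "AE x in M. (\<Prod>i\<in>I. epow (f i x) (1 / card I)) = 0"
      by eventually_elim (use i I in \<open>auto intro!: prod_zero bexI[of _ i]\<close>)
    then have "(\<integral>\<^sup>+x. (\<Prod>i\<in>I. epow (f i x) (1 / card I)) \<partial>M) = 0"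
      by (subst nn_integral_0_iff_AE) auto
    then show ?thesis by simp
  next
    case 2
    then obtain i where i: "i \<in> I" "?c i = top" by auto
    have "(\<Prod>i\<in>I. epow (?c i) (1 / card I)) = epow (?c i) (1 / card I) * (\<Prod>j\<in>I - {i}. epow (?c j) (1 / card I))"
      by (rule prod.remove[OF I(1) i(1)])
    also have "\<dots> = top" using 2(1) I i by (simp add: ennreal_top_mult epow_eq_0_iff)
    finally show ?thesis by simp
  next
    case 3
    define r where "r i = enn2real (?c i)" for i
    have r: "?c i = ennreal (r i)" "0 < r i" if "i \<in> I" for i
      using 3 that by (auto simp: r_def ennreal_enn2real_if enn2real_positive_iff less_top zero_less_iff_neq_zero)
    \<comment> \<open>Each \<open>?g i\<close> has integral 1, so the sum over I integrates to
      \<open>card I\<close>, which cancels.\<close>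
    let ?g = "\<lambda>i x. ennreal (1 / r i) * f i x"
    have g: "(\<integral>\<^sup>+x. ?g i x \<partial>M) = 1" if "i \<in> I" for i
      using r[OF that] f[OF that] by (simp add: nn_integral_cmult ennreal_mult[symmetric])
    have fg: "f i x = ?c i * ?g i x" if "i \<in> I" for i x
      using r[OF that] by (simp add: mult.assoc[symmetric] ennreal_mult[symmetric])
    have "(\<Prod>i\<in>I. epow (f i x) (1 / card I)) = (\<Prod>i\<in>I. epow (?c i) (1 / card I)) * (\<Prod>i\<in>I. epow (?g i x) (1 / card I))" for x
      unfolding prod.distrib[symmetric] epow_mult[symmetric] by (rule prod.cong[OF refl]) (use fg in simp)
    then have eq: "(\<integral>\<^sup>+x. (\<Prod>i\<in>I. epow (f i x) (1 / card I)) \<partial>M) =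
       (\<Prod>i\<in>I. epow (?c i) (1 / card I)) * (\<integral>\<^sup>+x. (\<Prod>i\<in>I. epow (?g i x) (1 / card I)) \<partial>M)"
      by (simp add: nn_integral_cmult)
    have "of_nat (card I) * (\<integral>\<^sup>+x. (\<Prod>i\<in>I. epow (?g i x) (1 / card I)) \<partial>M)
        = (\<integral>\<^sup>+x. of_nat (card I) * (\<Prod>i\<in>I. epow (?g i x) (1 / card I)) \<partial>M)"
      by (rule nn_integral_cmult[symmetric]) measurable
    also have "\<dots> \<le> (\<integral>\<^sup>+x. (\<Sum>i\<in>I. ?g i x) \<partial>M)"
      by (intro nn_integral_mono ennreal_geom_mean_le I)
    also have "\<dots> = (\<Sum>i\<in>I. \<integral>\<^sup>+x. ?g i x \<partial>M)" by (rule nn_integral_sum) measurable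
    also have "\<dots> = of_nat (card I) * 1" using g by simp
    finally have "of_nat (card I) * (\<integral>\<^sup>+x. (\<Prod>i\<in>I. epow (?g i x) (1 / card I)) \<partial>M) \<le> of_nat (card I) * 1" .
    then have "(\<integral>\<^sup>+x. (\<Prod>i\<in>I. epow (?g i x) (1 / card I)) \<partial>M) \<le> 1"
      by (subst (asm) ennreal_mult_le_mult_iff) (use I in auto)
    then have "(\<Prod>i\<in>I. epow (?c i) (1 / card I)) * (\<integral>\<^sup>+x. (\<Prod>i\<in>I. epow (?g i x) (1 / card I)) \<partial>M) \<le> (\<Prod>i\<in>I. epow (?c i) (1 / card I)) * 1"
      by (rule mult_left_mono) simp
    then show ?thesis unfolding eq by simp
  qed
qed

text \<open>Every value is at most the total sum S; keep one factor f x and bound the remaining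
  power b - 1 by that of S.\<close>

lemma nn_integral_count_space_epow:
  assumes "1 \<le> b"
  shows "(\<integral>\<^sup>+x. epow (f x) b \<partial>count_space R) \<le> epow (\<integral>\<^sup>+x. f x \<partial>count_space R) b"
proof (cases "b = 1")
  case False
  then have b: "0 < b - 1" using assms by simp
  let ?S = "\<integral>\<^sup>+x. f x \<partial>count_space R"
  have "epow (f x) b \<le> epow ?S (b - 1) * f x" if "x \<in> R" for x
  proof -
    have "epow (f x) b = epow (f x) (b - 1) * epow (f x) 1" using b by (subst epow_add[symmetric]) auto
    also have "\<dots> \<le> epow ?S (b - 1) * epow (f x) 1"
      by (intro mult_right_mono epow_mono nn_integral_ge_point that) (use b in auto)
    finally show ?thesis by simp
  qed
  then have "(\<integral>\<^sup>+x. epow (f x) b \<partial>count_space R) \<le> (\<integral>\<^sup>+x. epow ?S (b - 1) * f x \<partial>count_space R)"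
    by (intro nn_integral_mono) auto
  also have "\<dots> = epow ?S (b - 1) * epow ?S 1" by (simp add: nn_integral_cmult)
  also have "\<dots> = epow ?S b" using b by (subst epow_add[symmetric]) auto
  finally show ?thesis .
qed simp

text \<open>The exponents for which Hadamard weighted means with equal weights are compatible with
  composition: beyond \<open>1 / m\<close> one needs that \<open>\<ell>\<^sup>p\<close> norms decrease in \<open>p\<close>, that is, an
  atomic measure.\<close>

definition admissible :: "'a measure \<Rightarrow> nat \<Rightarrow> real \<Rightarrow> bool" where
  "admissible M m \<alpha> \<longleftrightarrow> 0 < m \<and> (\<alpha> = 1 / real m \<or> 1 / real m \<le> \<alpha> \<and> (\<exists>R. M = count_space R))"

lemma admissible_pos: "admissible M m \<alpha> \<Longrightarrow> 0 < \<alpha>"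
  unfolding admissible_def by (auto intro: less_le_trans[rotated])

text \<open>With \<alpha> = b / m, apply Hoelder with weights 1 / m to the b-th powers; then b
  leaves the integral, trivially for b = 1 and by \<open>nn_integral_count_space_epow\<close> for
  counting measure.\<close>

lemma nn_integral_Hadamard:
  assumes adm: "admissible M m \<alpha>" and f [measurable]: "\<And>l. l \<in> {1..m} \<Longrightarrow> f l \<in> borel_measurable M"
  shows "(\<integral>\<^sup>+x. (\<Prod>l\<in>{1..m}. epow (f l x) \<alpha>) \<partial>M) \<le> (\<Prod>l\<in>{1..m}. epow (\<integral>\<^sup>+x. f l x \<partial>M) \<alpha>)"
proof -
  define b where "b = \<alpha> * real m"
  have m: "0 < m" and b1: "1 \<le> b" and b: "b = 1 \<or> (\<exists>R. M = count_space R)"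
    using adm by (auto simp: admissible_def b_def field_simps)
  have \<alpha>: "\<alpha> = b * (1 / card {1..m})" using m by (simp add: b_def)
  have "(\<integral>\<^sup>+x. (\<Prod>l\<in>{1..m}. epow (f l x) \<alpha>) \<partial>M) = (\<integral>\<^sup>+x. (\<Prod>l\<in>{1..m}. epow (epow (f l x) b) (1 / card {1..m})) \<partial>M)"
    unfolding epow_epow \<alpha> ..
  also have "\<dots> \<le> (\<Prod>l\<in>{1..m}. epow (\<integral>\<^sup>+x. epow (f l x) b \<partial>M) (1 / card {1..m}))"
    by (rule nn_integral_Hoelder) (use m in auto)
  also have "\<dots> \<le> (\<Prod>l\<in>{1..m}. epow (epow (\<integral>\<^sup>+x. f l x \<partial>M) b) (1 / card {1..m}))"
  proof (intro ennreal_prod_mono epow_mono)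
    fix l
    show "(\<integral>\<^sup>+x. epow (f l x) b \<partial>M) \<le> epow (\<integral>\<^sup>+x. f l x \<partial>M) b"
      using b nn_integral_count_space_epow[OF b1] by auto
  qed auto
  also have "\<dots> = (\<Prod>l\<in>{1..m}. epow (\<integral>\<^sup>+x. f l x \<partial>M) \<alpha>)" unfolding epow_epow \<alpha> ..
  finally show ?thesis .
qed

section \<open>Nonnegative square-integrable functions\<close>

text \<open>Infinite values on a null set are tolerated, so integrals against kernels stay within
  this notion without redefinition.\<close>

definition sq2 :: "'a measure \<Rightarrow> ('a \<Rightarrow> ennreal) \<Rightarrow> bool" where
  "sq2 M f \<longleftrightarrow> f \<in> borel_measurable M \<and> (\<integral>\<^sup>+x. (f x)\<^sup>2 \<partial>M) < \<infinity>"

text \<open>\<open>enn2real\<close> sends infinity to 0; for \<open>sq2\<close> functions this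
  changes values on a null set only.\<close>

definition pos_class :: "'a measure \<Rightarrow> ('a \<Rightarrow> ennreal) \<Rightarrow> ('a \<Rightarrow> complex) set" where
  "pos_class M f = L2_class M (\<lambda>x. complex_of_real (enn2real (f x)))"

lemma sq2_measurable [measurable_dest]: "sq2 M f \<Longrightarrow> f \<in> borel_measurable M"
  by (simp add: sq2_def)

lemma sq2_finite: "sq2 M f \<Longrightarrow> AE x in M. f x < \<infinity>"
proof -
  assume f: "sq2 M f"
  note [measurable] = sq2_measurable[OF f]
  have "AE x in M. (f x)\<^sup>2 \<noteq> \<infinity>" using f by (intro nn_integral_PInf_AE) (auto simp: sq2_def)
  then show ?thesis by eventually_elim (auto simp: power_eq_top_ennreal less_top)
qed

lemma sq2_sq_integrable:
  assumes f: "sq2 M f"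
  shows "(\<integral>\<^sup>+x. (ennreal (cmod (complex_of_real (enn2real (f x)))))\<^sup>2 \<partial>M) = (\<integral>\<^sup>+x. (f x)\<^sup>2 \<partial>M)"
    and "(\<lambda>x. complex_of_real (enn2real (f x))) \<in> sq_integrable M"
proof -
  note [measurable] = sq2_measurable[OF f]
  show *: "(\<integral>\<^sup>+x. (ennreal (cmod (complex_of_real (enn2real (f x)))))\<^sup>2 \<partial>M) = (\<integral>\<^sup>+x. (f x)\<^sup>2 \<partial>M)"
    by (rule nn_integral_cong_AE) (use sq2_finite[OF f] in \<open>auto simp: less_top\<close>)
  show "(\<lambda>x. complex_of_real (enn2real (f x))) \<in> sq_integrable M"
    by (rule sq_integrableI) (use f in \<open>auto simp: sq2_def * simp del: norm_of_real\<close>)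
qed

lemma pos_class_in [simp]: "sq2 M f \<Longrightarrow> pos_class M f \<in> L2 M"
  unfolding pos_class_def by (intro L2_class_in sq2_sq_integrable)

lemma L2_norm_pos_class: "sq2 M f \<Longrightarrow> (\<integral>\<^sup>+x. (f x)\<^sup>2 \<partial>M) = ennreal ((L2_norm M (pos_class M f))\<^sup>2)"
  unfolding pos_class_def by (simp only: nn_integral_sq_class[symmetric] sq2_sq_integrable)

lemma pos_class_cong: "sq2 M f \<Longrightarrow> sq2 M g \<Longrightarrow> AE x in M. f x = g x \<Longrightarrow> pos_class M f = pos_class M g"
  unfolding pos_class_def by (subst L2_class_eq_iff) (auto intro: sq2_sq_integrable)

lemma sq2_mono:
  assumes f: "sq2 M f" and g: "g \<in> borel_measurable M" and le: "AE x in M. g x \<le> f x"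
  shows "sq2 M g"
proof -
  have "(\<integral>\<^sup>+x. (g x)\<^sup>2 \<partial>M) \<le> (\<integral>\<^sup>+x. (f x)\<^sup>2 \<partial>M)"
    by (rule nn_integral_mono_AE) (use le in \<open>eventually_elim, simp add: power_mono\<close>)
  then show ?thesis using f g by (auto simp: sq2_def)
qed

lemma sq2_cmod: "f \<in> sq_integrable M \<Longrightarrow> sq2 M (\<lambda>x. ennreal (cmod (f x)))"
  using nn_integral_sq_class[of f M] by (auto simp: sq2_def)

lemma L2_norm_le_pos_class:
  assumes F: "F \<in> L2 M" and h: "sq2 M h" and le: "AE x in M. ennreal (cmod (L2_rep F x)) \<le> h x"
  shows "L2_norm M F \<le> L2_norm M (pos_class M h)"
proof (rule power2_le_imp_le)
  have "ennreal ((L2_norm M F)\<^sup>2) = (\<integral>\<^sup>+x. (ennreal (cmod (L2_rep F x)))\<^sup>2 \<partial>M)"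
    using nn_integral_sq_class[OF L2_rep_sq[OF F]] F by simp
  also have "\<dots> \<le> (\<integral>\<^sup>+x. (h x)\<^sup>2 \<partial>M)"
    by (rule nn_integral_mono_AE) (use le in \<open>eventually_elim, simp add: power_mono\<close>)
  also have "\<dots> = ennreal ((L2_norm M (pos_class M h))\<^sup>2)" by (rule L2_norm_pos_class[OF h])
  finally show "(L2_norm M F)\<^sup>2 \<le> (L2_norm M (pos_class M h))\<^sup>2" by (simp add: ennreal_le_iff)
qed simp

lemma L2_norm_cmod: "F \<in> L2 M \<Longrightarrow> L2_norm M (pos_class M (\<lambda>x. ennreal (cmod (L2_rep F x)))) = L2_norm M F"
  using L2_norm_pos_class[OF sq2_cmod[OF L2_rep_sq], of F M] nn_integral_sq_class[OF L2_rep_sq, of F M]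
  by (simp add: power2_eq_iff_nonneg)

text \<open>Positive and negative parts of real and imaginary parts span the space. This transfers
  statements from nonnegative functions, whose integrals always exist, to all vectors.\<close>

lemma L2_span_induct [consumes 1, case_names pos lincomb]:
  assumes F: "F \<in> L2 M" and pos: "\<And>f. sq2 M f \<Longrightarrow> P (pos_class M f)"
    and lc: "\<And>F G c d. F \<in> L2 M \<Longrightarrow> G \<in> L2 M \<Longrightarrow> P F \<Longrightarrow> P G \<Longrightarrow> P (L2_lincomb M c F d G)"
  shows "P F"
proof -
  obtain f where f: "f \<in> sq_integrable M" "F = L2_class M f" using F by (rule L2_cases)
  note [measurable] = sq_integrable_measurable[OF f(1)]
  define p1 p2 p3 p4 where "p1 x = ennreal (Re (f x))" and "p2 x = ennreal (- Re (f x))"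
    and "p3 x = ennreal (Im (f x))" and "p4 x = ennreal (- Im (f x))" for x
  note pd = p1_def p2_def p3_def p4_def
  have sq: "sq2 M p1" "sq2 M p2" "sq2 M p3" "sq2 M p4"
  proof -
    have c: "Re z \<le> cmod z" "- Re z \<le> cmod z" "Im z \<le> cmod z" "- Im z \<le> cmod z" for z
      using abs_Re_le_cmod[of z] abs_Im_le_cmod[of z] by auto
    have "sq2 M (\<lambda>x. ennreal (h (f x)))" if "h \<in> borel_measurable borel" "\<And>z. h z \<le> cmod z" for h
      by (rule sq2_mono[OF sq2_cmod[OF f(1)]]) (use that in \<open>auto intro!: ennreal_leI\<close>)
    from this[of Re] this[of "\<lambda>z. - Re z"] this[of Im] this[of "\<lambda>z. - Im z"] c
    show "sq2 M p1" "sq2 M p2" "sq2 M p3" "sq2 M p4" by (simp_all add: pd[abs_def])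
  qed
  let ?e = "\<lambda>p x. complex_of_real (enn2real (p x))"
  have "f = (\<lambda>x. 1 * (1 * ?e p1 x + (-1) * ?e p2 x) + \<i> * (1 * ?e p3 x + (-1) * ?e p4 x))"
  proof
    fix x
    have r: "enn2real (ennreal t) - enn2real (ennreal (- t)) = t" for t
      by (cases "0 \<le> t") (simp_all add: ennreal_neg)
    show "f x = 1 * (1 * ?e p1 x + (-1) * ?e p2 x) + \<i> * (1 * ?e p3 x + (-1) * ?e p4 x)"
      by (rule complex_eqI) (simp_all add: pd r)
  qed
  moreover have "L2_lincomb M 1 (L2_lincomb M 1 (pos_class M p1) (-1) (pos_class M p2)) \<i>
      (L2_lincomb M 1 (pos_class M p3) (-1) (pos_class M p4)) =
    L2_class M (\<lambda>x. 1 * (1 * ?e p1 x + (-1) * ?e p2 x) + \<i> * (1 * ?e p3 x + (-1) * ?e p4 x))"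
    unfolding pos_class_def
    by (simp only: L2_lincomb_class sq2_sq_integrable(2) sq sq_integrable_lincomb)
  ultimately have "F = L2_lincomb M 1 (L2_lincomb M 1 (pos_class M p1) (-1) (pos_class M p2)) \<i>
      (L2_lincomb M 1 (pos_class M p3) (-1) (pos_class M p4))"
    using f(2) by simp
  moreover have "P \<dots>" by (intro lc pos L2_lincomb_in pos_class_in sq)
  ultimately show ?thesis by simp
qed

text \<open>\<open>enn2real\<close> is multiplicative even at infinity, so the integrands differ
  only where the product is infinite, which is a null set.\<close>

lemma integral_enn2real_mult:
  assumes [measurable]: "u \<in> borel_measurable M" "v \<in> borel_measurable M" and fin: "(\<integral>\<^sup>+x. u x * v x \<partial>M) < \<infinity>"
  shows "integrable M (\<lambda>x. complex_of_real (enn2real (u x)) * complex_of_real (enn2real (v x)))"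
    and "(\<integral>x. complex_of_real (enn2real (u x)) * complex_of_real (enn2real (v x)) \<partial>M) = of_real (enn2real (\<integral>\<^sup>+x. u x * v x \<partial>M))"
proof -
  have "AE x in M. u x * v x \<noteq> \<infinity>" by (rule nn_integral_PInf_AE) (use fin in auto)
  then have eq: "(\<integral>\<^sup>+x. ennreal (enn2real (u x) * enn2real (v x)) \<partial>M) = (\<integral>\<^sup>+x. u x * v x \<partial>M)"
    by (intro nn_integral_cong_AE) (auto elim!: AE_mp simp: enn2real_mult[symmetric] less_top)
  have i: "integrable M (\<lambda>x. enn2real (u x) * enn2real (v x))"
    by (rule integrableI_nonneg) (use fin eq in auto)
  show "integrable M (\<lambda>x. complex_of_real (enn2real (u x)) * complex_of_real (enn2real (v x)))"
    using integrable_of_real[OF i, where 'a=complex] by simp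
  have "(\<integral>x. enn2real (u x) * enn2real (v x) \<partial>M) = enn2real (\<integral>\<^sup>+x. u x * v x \<partial>M)"
    by (subst integral_eq_nn_integral) (use eq in auto)
  then show "(\<integral>x. complex_of_real (enn2real (u x)) * complex_of_real (enn2real (v x)) \<partial>M) = of_real (enn2real (\<integral>\<^sup>+x. u x * v x \<partial>M))"
    by (simp add: integral_complex_of_real flip: of_real_mult)
qed

lemma L2_inner_pos_class:
  assumes f: "sq2 M f" and g: "sq2 M g"
  shows "L2_inner M (pos_class M f) (pos_class M g) = of_real (enn2real (\<integral>\<^sup>+x. f x * g x \<partial>M))"
proof -
  note [measurable] = sq2_measurable[OF f] sq2_measurable[OF g]
  have "(\<integral>\<^sup>+x. f x * g x \<partial>M)\<^sup>2 \<le> (\<integral>\<^sup>+x. (f x)\<^sup>2 \<partial>M) * (\<integral>\<^sup>+x. (g x)\<^sup>2 \<partial>M)"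
    by (rule Cauchy_Schwarz_nn_integral) auto
  also have "\<dots> < \<infinity>" using f g by (simp add: sq2_def ennreal_mult_less_top)
  finally have "(\<integral>\<^sup>+x. f x * g x \<partial>M) < \<infinity>" by (simp add: power_less_top_ennreal)
  from integral_enn2real_mult(2)[OF _ _ this] show ?thesis
    unfolding pos_class_def by (subst L2_inner_class) (auto simp: sq2_sq_integrable f g)
qed

section \<open>Majorization\<close>

text \<open>Pointwise domination of positive operators, phrased without kernels because the identity has none.\<close>

definition majorized :: "'a measure \<Rightarrow> 'a L2_op \<Rightarrow> 'a L2_op \<Rightarrow> bool" where
  "majorized M X Y \<longleftrightarrow> (\<forall>F\<in>L2 M. \<forall>g. sq2 M g \<and> (AE x in M. ennreal (cmod (L2_rep F x)) \<le> g x) \<longrightarrow>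
     (\<exists>h. sq2 M h \<and> Y (pos_class M g) = pos_class M h \<and> (AE x in M. ennreal (cmod (L2_rep (X F) x)) \<le> h x)))"

lemma majorizedE:
  assumes "majorized M X Y" "F \<in> L2 M" "sq2 M g" "AE x in M. ennreal (cmod (L2_rep F x)) \<le> g x"
  obtains h where "sq2 M h" "Y (pos_class M g) = pos_class M h" "AE x in M. ennreal (cmod (L2_rep (X F) x)) \<le> h x"
  using assms unfolding majorized_def by blast

lemma majorized_compose:
  assumes X: "majorized M X Y" and X': "majorized M X' Y'" and "L2_operator M X'"
  shows "majorized M (compose (L2 M) X X') (compose (L2 M) Y Y')"
  unfolding majorized_def
proof (intro ballI allI impI)
  fix F g assume F: "F \<in> L2 M" and g: "sq2 M g \<and> (AE x in M. ennreal (cmod (L2_rep F x)) \<le> g x)"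
  obtain h where h: "sq2 M h" "Y' (pos_class M g) = pos_class M h" "AE x in M. ennreal (cmod (L2_rep (X' F) x)) \<le> h x"
    using majorizedE[OF X' F] g by metis
  obtain k where "sq2 M k" "Y (pos_class M h) = pos_class M k" "AE x in M. ennreal (cmod (L2_rep (X (X' F)) x)) \<le> k x"
    using majorizedE[OF X L2_operator_in[OF assms(3) F] h(1,3)] by metis
  then show "\<exists>h. sq2 M h \<and> compose (L2 M) Y Y' (pos_class M g) = pos_class M h \<and>
      (AE x in M. ennreal (cmod (L2_rep (compose (L2 M) X X' F) x)) \<le> h x)"
    using F g h by (intro exI[of _ k]) (simp add: compose_eq)
qed

lemma majorized_id: "majorized M (op_list_prod M []) (op_list_prod M [])"
  unfolding majorized_def by auto

lemma majorized_list_prod: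
  "list_all2 (majorized M) Xs Ys \<Longrightarrow> (\<And>X. X \<in> set Xs \<Longrightarrow> L2_operator M X) \<Longrightarrow>
    majorized M (op_list_prod M Xs) (op_list_prod M Ys)"
  by (induction rule: list_all2_induct)
    (auto simp: majorized_id op_list_prod_Cons intro!: majorized_compose L2_operator_list_prod)

text \<open>The majorant g is itself fed into Y, as an element of the space, and the domination of Y
  by Z is applied to it.\<close>

lemma majorized_trans:
  assumes XY: "majorized M X Y" and YZ: "majorized M Y Z"
  shows "majorized M X Z"
  unfolding majorized_def
proof (intro ballI allI impI)
  fix F g assume F: "F \<in> L2 M" and g: "sq2 M g \<and> (AE x in M. ennreal (cmod (L2_rep F x)) \<le> g x)"
  obtain h where h: "sq2 M h" "Y (pos_class M g) = pos_class M h" "AE x in M. ennreal (cmod (L2_rep (X F) x)) \<le> h x"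
    using majorizedE[OF XY F] g by metis
  have rep: "AE x in M. L2_rep (pos_class M f) x = of_real (enn2real (f x))" if "sq2 M f" for f
    unfolding pos_class_def by (rule L2_rep_class[OF sq2_sq_integrable(2)[OF that]])
  \<comment> \<open>The class of g is dominated by g itself, as the second domination
    requires.\<close>
  have "AE x in M. ennreal (cmod (L2_rep (pos_class M g) x)) \<le> g x"
    using rep[of g] g sq2_finite[of M g] by (auto elim!: AE_mp simp: less_top)
  from majorizedE[OF YZ pos_class_in[OF conjunct1[OF g]] conjunct1[OF g] this]
  obtain k where k: "sq2 M k" "Z (pos_class M g) = pos_class M k"
    "AE x in M. ennreal (cmod (L2_rep (Y (pos_class M g)) x)) \<le> k x" .
  note k(3)[unfolded h(2)]
  with h(3) have "AE x in M. ennreal (cmod (L2_rep (X F) x)) \<le> k x"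
    using rep[OF h(1)] sq2_finite[OF h(1)]
    by eventually_elim (auto simp: less_top)
  then show "\<exists>h. sq2 M h \<and> Z (pos_class M g) = pos_class M h \<and> (AE x in M. ennreal (cmod (L2_rep (X F) x)) \<le> h x)"
    using k by blast
qed

text \<open>Take for g the modulus of F, whose class has the same norm as F.\<close>

lemma majorized_op_norm:
  assumes XY: "majorized M X Y" and X: "L2_operator M X" and Y: "bounded_operator M Y"
  shows "bounded_operator M X" "op_norm M X \<le> op_norm M Y"
proof -
  have *: "L2_norm M (X F) \<le> op_norm M Y * L2_norm M F" if F: "F \<in> L2 M" for F
  proof -
    let ?g = "\<lambda>x. ennreal (cmod (L2_rep F x))"
    have g: "sq2 M ?g" by (rule sq2_cmod[OF L2_rep_sq[OF F]])
    obtain h where h: "sq2 M h" "Y (pos_class M ?g) = pos_class M h" "AE x in M. ennreal (cmod (L2_rep (X F) x)) \<le> h x"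
      using majorizedE[OF XY F g] by auto
    have "L2_norm M (X F) \<le> L2_norm M (pos_class M h)"
      by (rule L2_norm_le_pos_class[OF L2_operator_in[OF X F] h(1,3)])
    also have "\<dots> \<le> op_norm M Y * L2_norm M (pos_class M ?g)"
      using op_norm_bound[OF Y pos_class_in[OF g]] h(2) by simp
    finally show ?thesis by (simp only: L2_norm_cmod[OF F])
  qed
  show "bounded_operator M X" by (rule bounded_operatorI[OF X *])
  show "op_norm M X \<le> op_norm M Y" by (rule op_norm_le[OF _ *]) (use Y in auto)
qed

lemma majorized_power:
  assumes "majorized M X Y" "L2_operator M X" shows "majorized M (op_power M X n) (op_power M Y n)"
  by (rule majorized_list_prod) (use assms in \<open>auto simp: list_all2_conv_all_nth\<close>)

text \<open>Domination passes to powers, so the norms of all powers are ordered and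
  \<open>op_spectral_radius_mono\<close> applies.\<close>

lemma majorized_size:
  assumes w: "size_function M w" and XY: "majorized M X Y" and X: "L2_operator M X" and Y: "bounded_operator M Y"
  shows "w X \<le> w Y"
proof -
  note bX = majorized_op_norm(1)[OF XY X Y]
  have "op_norm M (op_power M X n) \<le> op_norm M (op_power M Y n)" for n
    by (rule majorized_op_norm(2)[OF majorized_power[OF XY X] bounded_operatorD bounded_operator_power[OF Y]])
      (rule bounded_operator_power[OF bX])
  then show ?thesis
    using w op_spectral_radius_mono[OF bX Y] majorized_op_norm(2)[OF XY X Y] by (auto simp: size_function_def)
qed

section \<open>Nonnegative kernels\<close>

definition kernel_apply :: "'a measure \<Rightarrow> ('a \<times> 'a \<Rightarrow> ennreal) \<Rightarrow> ('a \<Rightarrow> ennreal) \<Rightarrow> 'a \<Rightarrow> ennreal" where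
  "kernel_apply M k f x = (\<integral>\<^sup>+y. k (x, y) * f y \<partial>M)"

definition kernel_comp :: "'a measure \<Rightarrow> ('a \<times> 'a \<Rightarrow> ennreal) \<Rightarrow> ('a \<times> 'a \<Rightarrow> ennreal) \<Rightarrow> 'a \<times> 'a \<Rightarrow> ennreal" where
  "kernel_comp M a b = (\<lambda>z. \<integral>\<^sup>+u. a (fst z, u) * b (u, snd z) \<partial>M)"

text \<open>Prescribed on nonnegative functions only, where the integral needs no convergence;
  linearity determines the rest, see \<open>represents_unique\<close> and
  \<open>represents_apply\<close>.\<close>

definition represents :: "'a measure \<Rightarrow> 'a L2_op \<Rightarrow> ('a \<times> 'a \<Rightarrow> ennreal) \<Rightarrow> bool" where
  "represents M A k \<longleftrightarrow> L2_operator M A \<and> k \<in> borel_measurable (M \<Otimes>\<^sub>M M) \<and>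
    (\<forall>f. sq2 M f \<longrightarrow> sq2 M (kernel_apply M k f) \<and> A (pos_class M f) = pos_class M (kernel_apply M k f))"

text \<open>An operator norm bound on the nonnegative cone, squared so that no roots of extended
  reals occur; it makes sense before any operator has been constructed.\<close>

definition kernel_bound :: "'a measure \<Rightarrow> ('a \<times> 'a \<Rightarrow> ennreal) \<Rightarrow> real \<Rightarrow> bool" where
  "kernel_bound M k C \<longleftrightarrow>
    (\<forall>f. sq2 M f \<longrightarrow> (\<integral>\<^sup>+x. (kernel_apply M k f x)\<^sup>2 \<partial>M) \<le> ennreal (C\<^sup>2) * (\<integral>\<^sup>+x. (f x)\<^sup>2 \<partial>M))"

definition kernel_transpose :: "('a \<times> 'a \<Rightarrow> ennreal) \<Rightarrow> 'a \<times> 'a \<Rightarrow> ennreal" where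
  "kernel_transpose k = (\<lambda>z. k (snd z, fst z))"

definition hadamard :: "nat \<Rightarrow> real \<Rightarrow> (nat \<Rightarrow> 'b \<Rightarrow> ennreal) \<Rightarrow> 'b \<Rightarrow> ennreal" where
  "hadamard m \<alpha> a z = (\<Prod>l\<in>{1..m}. epow (a l z) \<alpha>)"

lemma representsD:
  assumes "represents M A k"
  shows "L2_operator M A" "k \<in> borel_measurable (M \<Otimes>\<^sub>M M)"
    "sq2 M f \<Longrightarrow> sq2 M (kernel_apply M k f)" "sq2 M f \<Longrightarrow> A (pos_class M f) = pos_class M (kernel_apply M k f)"
  using assms by (auto simp: represents_def)

lemma hadamard_measurable [measurable]:
  "(\<And>l. l \<in> {1..m} \<Longrightarrow> a l \<in> borel_measurable N) \<Longrightarrow> hadamard m \<alpha> a \<in> borel_measurable N"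
  unfolding hadamard_def[abs_def] by measurable

lemma has_kernelD:
  "has_kernel M A a \<Longrightarrow> F \<in> L2 M \<Longrightarrow> f \<in> F \<Longrightarrow> g \<in> A F \<Longrightarrow>
    AE x in M. integrable M (\<lambda>y. a (x, y) * f y) \<and> g x = (\<integral>y. a (x, y) * f y \<partial>M)"
  by (simp add: has_kernel_def)

lemma represents_unique:
  assumes A: "represents M A k" and B: "represents M B k" shows "A = B"
proof (rule L2_operator_eqI[OF representsD(1)[OF A] representsD(1)[OF B]])
  fix F assume "F \<in> L2 M"
  then show "A F = B F"
  proof (induction rule: L2_span_induct)
    case (pos f)
    then show ?case using representsD(4)[OF A pos] representsD(4)[OF B pos] by simp
  next
    case (lincomb F G c d)
    then show ?case using L2_operator_lincomb[OF representsD(1)[OF A]] L2_operator_lincomb[OF representsD(1)[OF B]] by simp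
  qed
qed

lemma represents_bound:
  assumes A: "represents M A k" and b: "bounded_operator M A" and C: "op_norm M A \<le> C"
  shows "kernel_bound M k C"
  unfolding kernel_bound_def
proof (intro allI impI)
  fix f assume f: "sq2 M f"
  have "L2_norm M (A (pos_class M f)) \<le> op_norm M A * L2_norm M (pos_class M f)"
    by (rule op_norm_bound[OF b pos_class_in[OF f]])
  also have "\<dots> \<le> C * L2_norm M (pos_class M f)" by (rule mult_right_mono[OF C]) simp
  finally have "(L2_norm M (A (pos_class M f)))\<^sup>2 \<le> (C * L2_norm M (pos_class M f))\<^sup>2" by (rule power_mono) simp
  then show "(\<integral>\<^sup>+x. (kernel_apply M k f x)\<^sup>2 \<partial>M) \<le> ennreal (C\<^sup>2) * (\<integral>\<^sup>+x. (f x)\<^sup>2 \<partial>M)"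
    using L2_norm_pos_class[OF f] L2_norm_pos_class[OF representsD(3)[OF A f]]
    by (simp add: representsD(4)[OF A f] ennreal_mult[symmetric] power_mult_distrib ennreal_leI)
qed

lemma kernel_bound_sq2:
  assumes "kernel_bound M k C" "kernel_apply M k f \<in> borel_measurable M" "sq2 M f" shows "sq2 M (kernel_apply M k f)"
proof -
  have "(\<integral>\<^sup>+x. (kernel_apply M k f x)\<^sup>2 \<partial>M) \<le> ennreal (C\<^sup>2) * (\<integral>\<^sup>+x. (f x)\<^sup>2 \<partial>M)"
    using assms by (auto simp: kernel_bound_def)
  also have "\<dots> < \<infinity>" using assms(3) by (simp add: sq2_def ennreal_mult_less_top)
  finally show ?thesis using assms(2) by (simp add: sq2_def)
qed

lemma kernel_apply_mono:
  assumes "\<And>y. y \<in> space M \<Longrightarrow> k (x, y) \<le> k' (x, y)" "AE y in M. f y \<le> g y"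
  shows "kernel_apply M k f x \<le> kernel_apply M k' g x"
  unfolding kernel_apply_def
  by (rule nn_integral_mono_AE) (use assms AE_space[of M] in \<open>auto elim!: AE_mp intro!: mult_mono\<close>)

context sigma_finite_measure
begin

interpretation pair: pair_sigma_finite M M ..

lemma kernel_section_measurable:
  assumes [measurable]: "k \<in> borel_measurable (M \<Otimes>\<^sub>M M)" and x: "x \<in> space M"
  shows "(\<lambda>y. k (x, y)) \<in> borel_measurable M" "(\<lambda>y. k (y, x)) \<in> borel_measurable M"
proof -
  note [measurable] = measurable_const[OF x, of M]
  show "(\<lambda>y. k (x, y)) \<in> borel_measurable M" "(\<lambda>y. k (y, x)) \<in> borel_measurable M" using x by measurable
qed

lemma kernel_apply_measurable [measurable (raw)]:
  assumes [measurable]: "k \<in> borel_measurable (M \<Otimes>\<^sub>M M)" "f \<in> borel_measurable M"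
  shows "kernel_apply M k f \<in> borel_measurable M"
  unfolding kernel_apply_def[abs_def] by measurable

lemma kernel_transpose_measurable [measurable (raw)]:
  assumes [measurable]: "k \<in> borel_measurable (M \<Otimes>\<^sub>M M)"
  shows "kernel_transpose k \<in> borel_measurable (M \<Otimes>\<^sub>M M)"
  unfolding kernel_transpose_def by measurable

lemma kernel_comp_measurable [measurable (raw)]:
  assumes [measurable]: "a \<in> borel_measurable (M \<Otimes>\<^sub>M M)" "b \<in> borel_measurable (M \<Otimes>\<^sub>M M)"
  shows "kernel_comp M a b \<in> borel_measurable (M \<Otimes>\<^sub>M M)"
  unfolding kernel_comp_def by measurable

lemma kernel_apply_comp:
  assumes [measurable]: "a \<in> borel_measurable (M \<Otimes>\<^sub>M M)" "b \<in> borel_measurable (M \<Otimes>\<^sub>M M)" "f \<in> borel_measurable M"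
    and x: "x \<in> space M"
  shows "kernel_apply M a (kernel_apply M b f) x = kernel_apply M (kernel_comp M a b) f x"
proof -
  note [measurable] = kernel_section_measurable[OF assms(1) x]
  have "kernel_apply M a (kernel_apply M b f) x = (\<integral>\<^sup>+z. (\<integral>\<^sup>+y. a (x, z) * (b (z, y) * f y) \<partial>M) \<partial>M)"
    unfolding kernel_apply_def
    by (intro nn_integral_cong nn_integral_cmult[symmetric] borel_measurable_times kernel_section_measurable) (use assms in auto)
  also have "\<dots> = (\<integral>\<^sup>+y. (\<integral>\<^sup>+z. a (x, z) * (b (z, y) * f y) \<partial>M) \<partial>M)"
    by (rule pair.Fubini'[symmetric]) measurable
  also have "\<dots> = kernel_apply M (kernel_comp M a b) f x"
    unfolding kernel_apply_def kernel_comp_def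
  proof (rule nn_integral_cong)
    fix y assume y: "y \<in> space M"
    note [measurable] = kernel_section_measurable(2)[OF assms(2) y]
    show "(\<integral>\<^sup>+z. a (x, z) * (b (z, y) * f y) \<partial>M) = (\<integral>\<^sup>+u. a (fst (x, y), u) * b (u, snd (x, y)) \<partial>M) * f y"
      by (subst nn_integral_multc[symmetric]) (auto simp: mult.assoc)
  qed
  finally show ?thesis .
qed

lemma represents_compose:
  assumes A: "represents M A a" and B: "represents M B b"
  shows "represents M (compose (L2 M) A B) (kernel_comp M a b)"
  unfolding represents_def
proof (intro conjI allI impI)
  note [measurable] = representsD(2)[OF A] representsD(2)[OF B]
  show "L2_operator M (compose (L2 M) A B)" by (rule L2_operator_compose[OF representsD(1)[OF A] representsD(1)[OF B]])
  show "kernel_comp M a b \<in> borel_measurable (M \<Otimes>\<^sub>M M)" by measurable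
  fix f assume f: "sq2 M f"
  note [measurable] = sq2_measurable[OF f]
  note Bf = representsD(3,4)[OF B f]
  note ABf = representsD(3,4)[OF A Bf(1)]
  have eq: "AE x in M. kernel_apply M (kernel_comp M a b) f x = kernel_apply M a (kernel_apply M b f) x"
    by (rule AE_I2) (simp add: kernel_apply_comp)
  show *: "sq2 M (kernel_apply M (kernel_comp M a b) f)"
    by (rule sq2_mono[OF ABf(1)]) (use eq in auto)
  show "compose (L2 M) A B (pos_class M f) = pos_class M (kernel_apply M (kernel_comp M a b) f)"
    using pos_class_cong[OF * ABf(1) eq] f by (simp add: compose_eq Bf ABf)
qed

text \<open>Where the integral converges, \<open>k\<close> is infinite only where \<open>f\<close> vanishes, so it is harmless that
  \<open>enn2real\<close> turns infinite values of \<open>k\<close> into zero.\<close>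

lemma integrable_kernel:
  assumes k [measurable]: "k \<in> borel_measurable (M \<Otimes>\<^sub>M M)" and f [measurable]: "f \<in> borel_measurable M"
    and x: "x \<in> space M" and fin: "kernel_apply M k (\<lambda>y. ennreal (cmod (f y))) x < \<infinity>"
  shows "integrable M (\<lambda>y. complex_of_real (enn2real (k (x, y))) * f y)"
    and "ennreal (cmod (\<integral>y. complex_of_real (enn2real (k (x, y))) * f y \<partial>M)) \<le> kernel_apply M k (\<lambda>y. ennreal (cmod (f y))) x"
proof -
  note [measurable] = kernel_section_measurable[OF k x]
  have le: "(\<integral>\<^sup>+y. ennreal (norm (complex_of_real (enn2real (k (x, y))) * f y)) \<partial>M) \<le> kernel_apply M k (\<lambda>y. ennreal (cmod (f y))) x"
    unfolding kernel_apply_def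
  proof (rule nn_integral_mono)
    fix y
    have "ennreal (enn2real (k (x, y))) \<le> k (x, y)" by (cases "k (x, y)") auto
    then show "ennreal (norm (complex_of_real (enn2real (k (x, y))) * f y)) \<le> k (x, y) * ennreal (cmod (f y))"
      by (simp add: norm_mult ennreal_mult mult_right_mono)
  qed
  show i: "integrable M (\<lambda>y. complex_of_real (enn2real (k (x, y))) * f y)"
    by (rule integrableI_bounded) (use le fin in \<open>auto intro: le_less_trans\<close>)
  show "ennreal (cmod (\<integral>y. complex_of_real (enn2real (k (x, y))) * f y \<partial>M)) \<le> kernel_apply M k (\<lambda>y. ennreal (cmod (f y))) x"
    by (rule order_trans[OF integral_norm_bound_ennreal[OF i] le])
qed

definition kernel_int :: "('a \<times> 'a \<Rightarrow> ennreal) \<Rightarrow> ('a \<Rightarrow> complex) \<Rightarrow> 'a \<Rightarrow> complex" where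
  "kernel_int k f x = (\<integral>y. complex_of_real (enn2real (k (x, y))) * f y \<partial>M)"

lemma kernel_int_pos:
  assumes k: "k \<in> borel_measurable (M \<Otimes>\<^sub>M M)" and f: "sq2 M f" and kf: "sq2 M (kernel_apply M k f)"
  shows "AE x in M. kernel_int k (\<lambda>y. complex_of_real (enn2real (f y))) x = of_real (enn2real (kernel_apply M k f x))"
  using sq2_finite[OF kf] AE_space
proof eventually_elim
  case (elim x)
  then show ?case unfolding kernel_int_def kernel_apply_def
    by (intro integral_enn2real_mult) (use kernel_section_measurable[OF k] f in \<open>auto simp: kernel_apply_def\<close>)
qed

lemma kernel_int_cong:
  assumes k: "k \<in> borel_measurable (M \<Otimes>\<^sub>M M)" and [measurable]: "f \<in> borel_measurable M" "g \<in> borel_measurable M"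
    and ae: "AE y in M. f y = g y" and x: "x \<in> space M"
  shows "kernel_int k f x = kernel_int k g x"
proof -
  note [measurable] = kernel_section_measurable[OF k x]
  show ?thesis unfolding kernel_int_def by (rule integral_cong_AE) (use ae in \<open>auto elim!: AE_mp\<close>)
qed

text \<open>The kernel formula for complex functions, obtained from the nonnegative ones by
  \<open>L2_span_induct\<close>.\<close>

lemma represents_apply:
  assumes A: "represents M A k" and F: "F \<in> L2 M" and f: "f \<in> F" and g: "g \<in> A F"
  shows "AE x in M. kernel_apply M k (\<lambda>y. ennreal (cmod (f y))) x < \<infinity> \<and> g x = kernel_int k f x"
proof -
  note k = representsD(2)[OF A] and L = representsD(1)[OF A]
  \<comment> \<open>Quantifying over all representatives makes the induction hypotheses available
    for the chosen ones. Finiteness concerns the modulus of f; it follows directly from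
    \<open>represents\<close> and stays outside the induction.\<close>
  have "\<forall>f\<in>F. \<forall>g\<in>A F. AE x in M. g x = kernel_int k f x"
    using F
  proof (induction rule: L2_span_induct)
    case (pos p)
    note kp = representsD(3,4)[OF A pos]
    note pk = sq2_sq_integrable(2)[OF pos] sq2_sq_integrable(2)[OF kp(1)]
    show ?case
    proof (intro ballI)
      fix f g assume f: "f \<in> pos_class M p" and g: "g \<in> A (pos_class M p)"
      have f': "f \<in> sq_integrable M" "AE x in M. complex_of_real (enn2real (p x)) = f x"
        using f pk unfolding pos_class_def by (auto simp: mem_L2_class)
      have g': "AE x in M. complex_of_real (enn2real (kernel_apply M k p x)) = g x"
      proof -
        have "g \<in> pos_class M (kernel_apply M k p)" using g kp(2) by simp
        then show ?thesis using pk unfolding pos_class_def by (auto simp: mem_L2_class)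
      qed
      show "AE x in M. g x = kernel_int k f x"
        using g' kernel_int_pos[OF k pos kp(1)] AE_space
      proof eventually_elim
        case (elim x)
        then show ?case
          using kernel_int_cong[OF k _ _ f'(2) elim(3)] sq_integrable_measurable[OF f'(1)] sq_integrable_measurable[OF pk(1)]
          by simp
      qed
    qed
  next
    case (lincomb F G c d)
    let ?H = "L2_lincomb M c F d G" and ?f = "L2_rep F" and ?g = "L2_rep G"
    note reps = L2_rep_sq[OF lincomb(1)] L2_rep_sq[OF lincomb(2)]
    note mem = L2_rep_in[OF lincomb(1)] L2_rep_in[OF lincomb(2)]
      L2_rep_in[OF L2_operator_in[OF L lincomb(1)]] L2_rep_in[OF L2_operator_in[OF L lincomb(2)]]
    have ae: "AE x in M. L2_rep (A F) x = kernel_int k ?f x" "AE x in M. L2_rep (A G) x = kernel_int k ?g x"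
      using lincomb(3,4) mem by auto
    have fin: "AE x in M. kernel_apply M k (\<lambda>y. ennreal (cmod (h y))) x < \<infinity>" if "h \<in> sq_integrable M" for h
      by (rule sq2_finite[OF representsD(3)[OF A sq2_cmod[OF that]]])
    show ?case
    proof (intro ballI)
      fix f g assume f: "f \<in> ?H" and g: "g \<in> A ?H"
      have f': "f \<in> sq_integrable M" "AE x in M. c * ?f x + d * ?g x = f x"
        using f unfolding L2_lincomb_def by (simp_all add: mem_L2_class sq_integrable_lincomb reps)
      have "g \<in> L2_lincomb M c (A F) d (A G)" using g L2_operator_lincomb[OF L lincomb(1,2)] by simp
      then have g': "AE x in M. c * L2_rep (A F) x + d * L2_rep (A G) x = g x"
        unfolding L2_lincomb_def
        by (simp add: mem_L2_class sq_integrable_lincomb L2_rep_sq L2_operator_in[OF L] lincomb)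
      show "AE x in M. g x = kernel_int k f x"
        using g' ae fin[OF reps(1)] fin[OF reps(2)] AE_space
      proof eventually_elim
        case (elim x)
        note i = integrable_kernel(1)[OF k sq_integrable_measurable[OF reps(1)] elim(6,4)]
          integrable_kernel(1)[OF k sq_integrable_measurable[OF reps(2)] elim(6,5)]
        have "kernel_int k f x = kernel_int k (\<lambda>x. c * ?f x + d * ?g x) x"
          by (rule kernel_int_cong[OF k _ _ _ elim(6)])
            (use f' sq_integrable_measurable sq_integrable_lincomb[OF reps] in auto)
        also have "\<dots> = (\<integral>y. c * (complex_of_real (enn2real (k (x, y))) * ?f y) + d * (complex_of_real (enn2real (k (x, y))) * ?g y) \<partial>M)"
          unfolding kernel_int_def by (simp add: algebra_simps)
        also have "\<dots> = c * kernel_int k ?f x + d * kernel_int k ?g x"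
          unfolding kernel_int_def using i by simp
        finally show ?case using elim by simp
      qed
    qed
  qed
  moreover have "f \<in> sq_integrable M" using L2_class_memD[OF F f] by simp
  then have "AE x in M. kernel_apply M k (\<lambda>y. ennreal (cmod (f y))) x < \<infinity>"
    using sq2_finite[OF representsD(3)[OF A sq2_cmod]] by blast
  ultimately show ?thesis using f g by auto
qed

lemma represents_has_kernel:
  assumes A: "represents M A k" shows "has_kernel M A (\<lambda>z. of_real (enn2real (k z)))"
  unfolding has_kernel_def
proof (intro conjI ballI)
  note [measurable] = representsD(2)[OF A]
  show "(\<lambda>z. complex_of_real (enn2real (k z))) \<in> borel_measurable (M \<Otimes>\<^sub>M M)" by measurable
  fix F f g assume F: "F \<in> L2 M" "f \<in> F" "g \<in> A F"
  have [measurable]: "f \<in> borel_measurable M" using L2_class_memD(1)[OF F(1,2)] by simp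
  show "AE x in M. integrable M (\<lambda>y. complex_of_real (enn2real (k (x, y))) * f y) \<and>
      g x = (\<integral>y. complex_of_real (enn2real (k (x, y))) * f y \<partial>M)"
    using represents_apply[OF A F] AE_space
    by eventually_elim (auto simp: kernel_int_def intro: integrable_kernel(1))
qed

text \<open>For a nonnegative function the complex integral agrees with the nonnegative one, which
  integrability makes finite almost everywhere; square-integrability is inherited from the image
  under A.\<close>

lemma has_kernel_represents:
  assumes A: "L2_operator M A" and a: "\<And>z. 0 \<le> a z" and k: "has_kernel M A (\<lambda>z. of_real (a z))"
  shows "represents M A (\<lambda>z. ennreal (a z))"
  unfolding represents_def
proof (intro conjI allI impI A)
  have "(\<lambda>z. complex_of_real (a z)) \<in> borel_measurable (M \<Otimes>\<^sub>M M)" using k by (simp add: has_kernel_def)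
  then have "(\<lambda>z. Re (complex_of_real (a z))) \<in> borel_measurable (M \<Otimes>\<^sub>M M)" by measurable
  then have am [measurable]: "a \<in> borel_measurable (M \<Otimes>\<^sub>M M)" by simp
  show m: "(\<lambda>z. ennreal (a z)) \<in> borel_measurable (M \<Otimes>\<^sub>M M)" by measurable
  fix f assume f: "sq2 M f"
  note [measurable] = sq2_measurable[OF f]
  let ?f = "\<lambda>x. complex_of_real (enn2real (f x))" and ?k = "kernel_apply M (\<lambda>z. ennreal (a z)) f"
  note Fin = pos_class_in[OF f]
  define g where "g = L2_rep (A (pos_class M f))"
  have g: "g \<in> A (pos_class M f)" "g \<in> sq_integrable M" "L2_class M g = A (pos_class M f)"
    unfolding g_def using L2_rep_in L2_rep_sq L2_operator_in[OF A Fin] by auto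
  have fF: "?f \<in> pos_class M f" using sq2_sq_integrable(2)[OF f] unfolding pos_class_def by (simp add: mem_L2_class)
  have ae: "AE x in M. integrable M (\<lambda>y. of_real (a (x, y)) * ?f y) \<and> g x = (\<integral>y. of_real (a (x, y)) * ?f y \<partial>M)"
    by (rule has_kernelD[OF k Fin fF g(1)])
  have eq: "AE x in M. ?k x < \<infinity> \<and> g x = of_real (enn2real (?k x))"
    using ae AE_space
  proof eventually_elim
    case (elim x)
    have i: "integrable M (\<lambda>y. a (x, y) * enn2real (f y))"
      using elim integrable_Re[of M "\<lambda>y. of_real (a (x, y)) * ?f y"] by simp
    have "?k x = (\<integral>\<^sup>+y. ennreal (a (x, y) * enn2real (f y)) \<partial>M)"
      unfolding kernel_apply_def
      by (rule nn_integral_cong_AE) (use sq2_finite[OF f] in \<open>auto elim!: AE_mp simp: ennreal_mult a less_top\<close>)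
    also have "\<dots> = ennreal (\<integral>y. a (x, y) * enn2real (f y) \<partial>M)"
      by (rule nn_integral_eq_integral[OF i]) (simp add: a)
    finally have kx: "?k x = ennreal (\<integral>y. a (x, y) * enn2real (f y) \<partial>M)" .
    have "g x = (\<integral>y. complex_of_real (a (x, y) * enn2real (f y)) \<partial>M)" using elim by simp
    also have "\<dots> = of_real (\<integral>y. a (x, y) * enn2real (f y) \<partial>M)" by (rule integral_complex_of_real)
    finally show ?case using kx by (simp add: a Bochner_Integration.integral_nonneg)
  qed
  have "(\<integral>\<^sup>+x. (?k x)\<^sup>2 \<partial>M) = (\<integral>\<^sup>+x. (ennreal (cmod (g x)))\<^sup>2 \<partial>M)"
    by (rule nn_integral_cong_AE) (use eq in \<open>auto elim!: AE_mp simp: less_top\<close>)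
  then show sq: "sq2 M ?k" using nn_integral_sq_class[OF g(2)] m by (simp add: sq2_def)
  show "A (pos_class M f) = pos_class M ?k"
    unfolding g(3)[symmetric] unfolding pos_class_def
    by (subst L2_class_eq_iff) (use eq g sq2_sq_integrable(2)[OF sq] in auto)
qed

text \<open>The modulus of an integral is at most the integral of moduli, and then both kernel and
  function are enlarged.\<close>

lemma represents_majorized:
  assumes X: "represents M X x" and Y: "represents M Y y"
    and le: "\<And>z. z \<in> space (M \<Otimes>\<^sub>M M) \<Longrightarrow> x z \<le> y z"
  shows "majorized M X Y"
  unfolding majorized_def
proof (intro ballI allI impI)
  fix F g assume F: "F \<in> L2 M" and g: "sq2 M g \<and> (AE x in M. ennreal (cmod (L2_rep F x)) \<le> g x)"
  note XF = L2_rep_in[OF L2_operator_in[OF representsD(1)[OF X] F]]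
  have "AE u in M. ennreal (cmod (L2_rep (X F) u)) \<le> kernel_apply M y g u"
    using represents_apply[OF X F L2_rep_in[OF F] XF] AE_space
  proof eventually_elim
    case (elim u)
    have "ennreal (cmod (L2_rep (X F) u)) \<le> kernel_apply M x (\<lambda>v. ennreal (cmod (L2_rep F v))) u"
      using elim integrable_kernel(2)[OF representsD(2)[OF X] sq_integrable_measurable[OF L2_rep_sq[OF F]]]
      by (simp add: kernel_int_def)
    also have "\<dots> \<le> kernel_apply M y g u"
      by (rule kernel_apply_mono) (use g le elim in \<open>auto simp: space_pair_measure\<close>)
    finally show ?case .
  qed
  then show "\<exists>h. sq2 M h \<and> Y (pos_class M g) = pos_class M h \<and> (AE x in M. ennreal (cmod (L2_rep (X F) x)) \<le> h x)"
    using g representsD(3,4)[OF Y] by blast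
qed

text \<open>Turns the kernels produced by means and transposition into actual operators: the bound
  makes the integrals finite almost everywhere and their values square-integrable.\<close>

lemma represents_exists:
  assumes k [measurable]: "k \<in> borel_measurable (M \<Otimes>\<^sub>M M)" and C: "kernel_bound M k C" "0 \<le> C"
  obtains A where "represents M A k" "bounded_operator M A" "op_norm M A \<le> C"
proof -
  have meas [measurable]: "kernel_int k f \<in> borel_measurable M" if "f \<in> sq_integrable M" for f
    unfolding kernel_int_def[abs_def] using sq_integrable_measurable[OF that] by measurable
  have sqk: "sq2 M (kernel_apply M k f)" if f: "sq2 M f" for f
    by (rule kernel_bound_sq2[OF C(1) _ f]) (use sq2_measurable[OF f] in measurable)
  have fin: "AE x in M. kernel_apply M k (\<lambda>y. ennreal (cmod (f y))) x < \<infinity>" if "f \<in> sq_integrable M" for f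
    by (rule sq2_finite[OF sqk[OF sq2_cmod[OF that]]])
  have le: "AE x in M. ennreal (cmod (kernel_int k f x)) \<le> kernel_apply M k (\<lambda>y. ennreal (cmod (f y))) x"
    if f: "f \<in> sq_integrable M" for f
    using fin[OF f] AE_space
    by eventually_elim (auto simp: kernel_int_def intro: integrable_kernel(2) k sq_integrable_measurable[OF f])
  have bd: "(\<integral>\<^sup>+x. (ennreal (cmod (kernel_int k f x)))\<^sup>2 \<partial>M) \<le> ennreal (C\<^sup>2) * ennreal ((L2_norm M (L2_class M f))\<^sup>2)"
    if f: "f \<in> sq_integrable M" for f
  proof -
    have "(\<integral>\<^sup>+x. (ennreal (cmod (kernel_int k f x)))\<^sup>2 \<partial>M) \<le> (\<integral>\<^sup>+x. (kernel_apply M k (\<lambda>y. ennreal (cmod (f y))) x)\<^sup>2 \<partial>M)"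
      by (rule nn_integral_mono_AE) (use le[OF f] in \<open>eventually_elim, simp add: power_mono\<close>)
    also have "\<dots> \<le> ennreal (C\<^sup>2) * (\<integral>\<^sup>+x. (ennreal (cmod (f x)))\<^sup>2 \<partial>M)"
      using C sq2_cmod[OF f] unfolding kernel_bound_def by blast
    finally show ?thesis by (simp add: nn_integral_sq_class[OF f])
  qed
  have sq: "kernel_int k f \<in> sq_integrable M" if f: "f \<in> sq_integrable M" for f
    by (rule sq_integrableI[OF meas[OF f]], rule le_less_trans[OF bd[OF f]]) (simp add: ennreal_mult_less_top)
  define A where "A = restrict (\<lambda>F. L2_class M (kernel_int k (L2_rep F))) (L2 M)"
  have A: "A (L2_class M f) = L2_class M (kernel_int k f)" if f: "f \<in> sq_integrable M" for f
  proof -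
    have "AE x in M. kernel_int k (L2_rep (L2_class M f)) x = kernel_int k f x"
      by (rule AE_I2, rule kernel_int_cong[OF k])
        (use L2_rep_class[OF f] f L2_rep_sq[OF L2_class_in[OF f]] sq_integrable_measurable in auto)
    then show ?thesis using f by (simp add: A_def L2_class_in L2_class_eq_iff sq L2_rep_sq)
  qed
  have LA: "L2_operator M A" unfolding L2_operator_def
  proof (intro conjI ballI allI)
    show "A \<in> L2 M \<rightarrow>\<^sub>E L2 M" unfolding A_def by (auto intro!: L2_class_in sq L2_rep_sq)
    fix F G c d assume FG: "F \<in> L2 M" "G \<in> L2 M"
    note r = L2_rep_sq[OF FG(1)] L2_rep_sq[OF FG(2)]
    have "AE x in M. kernel_int k (\<lambda>x. c * L2_rep F x + d * L2_rep G x) x = c * kernel_int k (L2_rep F) x + d * kernel_int k (L2_rep G) x"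
      using fin[OF r(1)] fin[OF r(2)] AE_space
    proof eventually_elim
      case (elim x)
      note i = integrable_kernel(1)[OF k sq_integrable_measurable[OF r(1)] elim(3,1)]
        integrable_kernel(1)[OF k sq_integrable_measurable[OF r(2)] elim(3,2)]
      have "kernel_int k (\<lambda>x. c * L2_rep F x + d * L2_rep G x) x
        = (\<integral>y. c * (complex_of_real (enn2real (k (x, y))) * L2_rep F y) + d * (complex_of_real (enn2real (k (x, y))) * L2_rep G y) \<partial>M)"
        unfolding kernel_int_def by (simp add: algebra_simps)
      also have "\<dots> = c * kernel_int k (L2_rep F) x + d * kernel_int k (L2_rep G) x"
        unfolding kernel_int_def using i by simp
      finally show ?case .
    qed
    then have "L2_class M (kernel_int k (\<lambda>x. c * L2_rep F x + d * L2_rep G x)) =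
       L2_class M (\<lambda>x. c * kernel_int k (L2_rep F) x + d * kernel_int k (L2_rep G) x)"
      by (simp add: L2_class_eq_iff sq sq_integrable_lincomb r)
    then show "A (L2_lincomb M c F d G) = L2_lincomb M c (A F) d (A G)"
      using A[OF r(1)] A[OF r(2)] A[OF sq_integrable_lincomb[OF r]] FG L2_lincomb_class[OF sq[OF r(1)] sq[OF r(2)], of c d]
      by (simp add: L2_lincomb_def)
  qed
  have rep: "represents M A k" unfolding represents_def
  proof (intro conjI allI impI LA k)
    fix f assume f: "sq2 M f"
    show sf: "sq2 M (kernel_apply M k f)" by (rule sqk[OF f])
    show "A (pos_class M f) = pos_class M (kernel_apply M k f)"
      unfolding pos_class_def A[OF sq2_sq_integrable(2)[OF f]]
      by (subst L2_class_eq_iff) (use kernel_int_pos[OF k f sf] sq sq2_sq_integrable(2) f sf in auto)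
  qed
  have nA: "L2_norm M (A F) \<le> C * L2_norm M F" if F: "F \<in> L2 M" for F
  proof -
    obtain f where f: "f \<in> sq_integrable M" "F = L2_class M f" using F by (rule L2_cases)
    have "ennreal ((L2_norm M (A F))\<^sup>2) \<le> ennreal ((C * L2_norm M F)\<^sup>2)"
      using bd[OF f(1)] unfolding f(2) A[OF f(1)] nn_integral_sq_class[OF sq[OF f(1)]]
      by (simp add: ennreal_mult[symmetric] power_mult_distrib)
    then have "(L2_norm M (A F))\<^sup>2 \<le> (C * L2_norm M F)\<^sup>2" by (simp add: ennreal_le_iff)
    then show ?thesis by (rule power2_le_imp_le) (use C in simp)
  qed
  show ?thesis by (rule that[OF rep bounded_operatorI[OF LA nA] op_norm_le[OF C(2) nA]])
qed

text \<open>The transposed kernel applied to \<open>g\<close> is tested against truncations of the result itself; the truncation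
  makes the test functions square-integrable.\<close>

lemma kernel_bound_transpose:
  assumes k [measurable]: "k \<in> borel_measurable (M \<Otimes>\<^sub>M M)" and C: "kernel_bound M k C"
  shows "kernel_bound M (kernel_transpose k) C"
  unfolding kernel_bound_def
proof (intro allI impI)
  fix g assume g: "sq2 M g"
  note [measurable] = sq2_measurable[OF g]
  let ?h = "kernel_apply M (kernel_transpose k) g" and ?G = "ennreal (C\<^sup>2) * (\<integral>\<^sup>+x. (g x)\<^sup>2 \<partial>M)"
  obtain S :: "nat \<Rightarrow> 'a set" where S: "range S \<subseteq> sets M" "(\<Union>i. S i) = space M" "\<And>i. emeasure M (S i) \<noteq> \<infinity>" "incseq S"
    using sigma_finite_incseq by blast
  have [measurable]: "S n \<in> sets M" for n using S(1) by auto
  let ?t = "\<lambda>n x. min (?h x) (of_nat n) * indicator (S n) x"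
  have sqt: "sq2 M (?t n)" for n
  proof -
    have "(\<integral>\<^sup>+x. (?t n x)\<^sup>2 \<partial>M) \<le> (\<integral>\<^sup>+x. (of_nat n)\<^sup>2 * indicator (S n) x \<partial>M)"
      by (intro nn_integral_mono) (auto simp: indicator_def intro!: power_mono)
    also have "\<dots> < \<infinity>" using S(3)[of n]
      by (simp add: nn_integral_cmult_indicator ennreal_mult_less_top of_nat_less_top less_top power_less_top_ennreal of_nat_less_top)
    finally show ?thesis by (simp add: sq2_def)
  qed
  have bound: "(\<integral>\<^sup>+x. (?t n x)\<^sup>2 \<partial>M) \<le> ?G" for n
  proof -
    note [measurable] = sq2_measurable[OF sqt[of n]]
    let ?I = "\<integral>\<^sup>+x. (?t n x)\<^sup>2 \<partial>M"
    \<comment> \<open>One truncated factor is enlarged to the full \<open>?h\<close>, which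
      Tonelli's theorem can unfold.\<close>
    have "?I \<le> (\<integral>\<^sup>+x. ?h x * ?t n x \<partial>M)"
      unfolding power2_eq_square by (intro nn_integral_mono mult_right_mono) (auto simp: indicator_def min_def)
    also have "\<dots> = (\<integral>\<^sup>+x. (\<integral>\<^sup>+y. k (y, x) * g y * ?t n x \<partial>M) \<partial>M)"
    proof (rule nn_integral_cong)
      fix x assume x: "x \<in> space M"
      note [measurable] = kernel_section_measurable[OF k x]
      show "?h x * ?t n x = (\<integral>\<^sup>+y. k (y, x) * g y * ?t n x \<partial>M)"
        by (subst nn_integral_multc) (auto simp: kernel_apply_def kernel_transpose_def)
    qed
    also have "\<dots> = (\<integral>\<^sup>+y. (\<integral>\<^sup>+x. k (y, x) * g y * ?t n x \<partial>M) \<partial>M)"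
      by (rule pair.Fubini'[symmetric]) measurable
    also have "\<dots> = (\<integral>\<^sup>+y. g y * kernel_apply M k (?t n) y \<partial>M)"
    proof (rule nn_integral_cong)
      fix y assume y: "y \<in> space M"
      note [measurable] = kernel_section_measurable[OF k y]
      show "(\<integral>\<^sup>+x. k (y, x) * g y * ?t n x \<partial>M) = g y * kernel_apply M k (?t n) y"
        unfolding kernel_apply_def[of M k "?t n"] by (subst nn_integral_cmult[symmetric]) (auto simp: ac_simps)
    qed
    finally have "?I\<^sup>2 \<le> (\<integral>\<^sup>+y. g y * kernel_apply M k (?t n) y \<partial>M)\<^sup>2" by (rule power_mono) simp
    also have "\<dots> \<le> (\<integral>\<^sup>+y. (g y)\<^sup>2 \<partial>M) * (\<integral>\<^sup>+y. (kernel_apply M k (?t n) y)\<^sup>2 \<partial>M)"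
      by (rule Cauchy_Schwarz_nn_integral) measurable
    also have "\<dots> \<le> (\<integral>\<^sup>+y. (g y)\<^sup>2 \<partial>M) * (ennreal (C\<^sup>2) * ?I)"
      using C sqt[of n] unfolding kernel_bound_def by (intro mult_left_mono) auto
    finally have II: "?I * ?I \<le> ?I * ?G" by (simp add: power2_eq_square ac_simps)
    \<comment> \<open>The gain from truncating: a finite \<open>?I\<close> can be cancelled from
      \<open>?I * ?I \<le> ?I * ?G\<close>.\<close>
    have "?I < \<infinity>" using sqt[of n] by (simp add: sq2_def)
    show ?thesis
    proof (cases "?I = 0")
      case False
      with II \<open>?I < \<infinity>\<close> show ?thesis by (subst (asm) ennreal_mult_le_mult_iff) auto
    qed simp
  qed
  \<comment> \<open>The sets S n exhaust the space and the cut-offs tend to infinity, so the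
    truncations converge pointwise and Fatou's lemma carries the bound over to
    \<open>?h\<close>.\<close>
  have "(?h x)\<^sup>2 = liminf (\<lambda>n. (?t n x)\<^sup>2)" if x: "x \<in> space M" for x
  proof -
    obtain N where N: "x \<in> S N" using x S(2) by auto
    have 1: "(\<lambda>n. min (?h x) (of_nat n)) \<longlonglongrightarrow> min (?h x) top"
      by (intro tendsto_min tendsto_const of_nat_tendsto_top_ennreal)
    have "\<forall>\<^sub>F n in sequentially. min (?h x) (of_nat n) = ?t n x"
      using eventually_ge_at_top[of N] by eventually_elim (use N S(4) in \<open>auto simp: indicator_def incseq_def\<close>)
    then have "(\<lambda>n. ?t n x) \<longlonglongrightarrow> ?h x" using 1 by (subst (asm) tendsto_cong) auto
    then have "(\<lambda>n. ?t n x * ?t n x) \<longlonglongrightarrow> ?h x * ?h x" by (intro tendsto_mult_ennreal) auto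
    then have "(\<lambda>n. (?t n x)\<^sup>2) \<longlonglongrightarrow> (?h x)\<^sup>2" by (simp only: power2_eq_square)
    then show ?thesis by (rule lim_imp_Liminf[OF sequentially_bot, symmetric])
  qed
  then have "(\<integral>\<^sup>+x. (?h x)\<^sup>2 \<partial>M) = (\<integral>\<^sup>+x. liminf (\<lambda>n. (?t n x)\<^sup>2) \<partial>M)"
    by (intro nn_integral_cong) auto
  also have "\<dots> \<le> liminf (\<lambda>n. \<integral>\<^sup>+x. (?t n x)\<^sup>2 \<partial>M)" by (rule nn_integral_liminf) measurable
  also have "\<dots> \<le> liminf (\<lambda>n::nat. ?G)" by (intro Liminf_mono always_eventually allI bound)
  also have "\<dots> = ?G" by (simp add: Liminf_const)
  finally show "(\<integral>\<^sup>+x. (?h x)\<^sup>2 \<partial>M) \<le> ?G" .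
qed

text \<open>Tonelli's theorem on nonnegative functions, then span induction in each of the two
  arguments.\<close>

lemma represents_is_adjoint:
  assumes A: "represents M A k" and B: "represents M B (kernel_transpose k)"
  shows "is_adjoint M A B"
proof -
  note k [measurable] = representsD(2)[OF A]
  note LA = representsD(1)[OF A] and LB = representsD(1)[OF B]
  have pp: "L2_inner M (A (pos_class M f)) (pos_class M g) = L2_inner M (pos_class M f) (B (pos_class M g))"
    if f: "sq2 M f" and g: "sq2 M g" for f g
  proof -
    note [measurable] = sq2_measurable[OF f] sq2_measurable[OF g]
    have "(\<integral>\<^sup>+x. kernel_apply M k f x * g x \<partial>M) = (\<integral>\<^sup>+x. (\<integral>\<^sup>+y. k (x, y) * f y * g x \<partial>M) \<partial>M)"
      unfolding kernel_apply_def
      by (intro nn_integral_cong nn_integral_multc[symmetric] borel_measurable_times)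
        (use kernel_section_measurable[OF k] in auto)
    also have "\<dots> = (\<integral>\<^sup>+y. (\<integral>\<^sup>+x. k (x, y) * f y * g x \<partial>M) \<partial>M)"
      by (rule pair.Fubini'[symmetric]) measurable
    also have "\<dots> = (\<integral>\<^sup>+y. f y * kernel_apply M (kernel_transpose k) g y \<partial>M)"
    proof (rule nn_integral_cong)
      fix y assume y: "y \<in> space M"
      note [measurable] = kernel_section_measurable[OF k y]
      show "(\<integral>\<^sup>+x. k (x, y) * f y * g x \<partial>M) = f y * kernel_apply M (kernel_transpose k) g y"
        unfolding kernel_apply_def kernel_transpose_def by (subst nn_integral_cmult[symmetric]) (auto simp: ac_simps)
    qed
    finally show ?thesis
      by (simp add: representsD(4)[OF A f] representsD(4)[OF B g] L2_inner_pos_class f g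
          representsD(3)[OF A f] representsD(3)[OF B g])
  qed
  have "L2_inner M (A F) G = L2_inner M F (B G)" if F: "F \<in> L2 M" and G: "G \<in> L2 M" for F G
    using F
  proof (induction rule: L2_span_induct)
    case (pos f)
    note f = pos
    show ?case using G
    proof (induction rule: L2_span_induct)
      case (pos g)
      show ?case by (rule pp[OF f pos])
    next
      case (lincomb G H c d)
      then show ?case
        by (simp add: L2_operator_lincomb[OF LB] L2_inner_lincomb_right L2_operator_in[OF LB] L2_operator_in[OF LA] f)
    qed
  next
    case (lincomb F H c d)
    then show ?case
      by (simp add: L2_operator_lincomb[OF LA] L2_inner_lincomb_left L2_operator_in[OF LB] L2_operator_in[OF LA] G)
  qed
  then show ?thesis using LB by (simp add: is_adjoint_def)
qed

text \<open>The transposed kernel is bounded and so belongs to some operator; that operator is an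
  adjoint, and adjoints are unique.\<close>

lemma represents_adjoint:
  assumes A: "represents M A k" and b: "bounded_operator M A" and B: "is_adjoint M A B"
  shows "represents M B (kernel_transpose k)"
proof -
  obtain B' where B': "represents M B' (kernel_transpose k)"
    by (rule represents_exists[OF kernel_transpose_measurable[OF representsD(2)[OF A]]
        kernel_bound_transpose[OF representsD(2)[OF A] represents_bound[OF A b order_refl]] op_norm_nonneg[OF b]])
  have "B = B'" by (rule is_adjoint_unique[OF B represents_is_adjoint[OF A B']])
  then show ?thesis using B' by simp
qed

section \<open>Hadamard weighted means of kernels\<close>

text \<open>Hoelder's inequality in the intermediate variable u, for fixed outer variables. All
  comparisons between means of words rest on it.\<close>

lemma kernel_comp_hadamard:
  assumes adm: "admissible M m \<alpha>"
    and a: "\<And>l. l \<in> {1..m} \<Longrightarrow> a l \<in> borel_measurable (M \<Otimes>\<^sub>M M)"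
    and b: "\<And>l. l \<in> {1..m} \<Longrightarrow> b l \<in> borel_measurable (M \<Otimes>\<^sub>M M)"
    and z: "z \<in> space (M \<Otimes>\<^sub>M M)"
  shows "kernel_comp M (hadamard m \<alpha> a) (hadamard m \<alpha> b) z \<le> hadamard m \<alpha> (\<lambda>l. kernel_comp M (a l) (b l)) z"
proof -
  have z': "fst z \<in> space M" "snd z \<in> space M" using z by (auto simp: space_pair_measure)
  have "kernel_comp M (hadamard m \<alpha> a) (hadamard m \<alpha> b) z =
    (\<integral>\<^sup>+u. (\<Prod>l\<in>{1..m}. epow (a l (fst z, u) * b l (u, snd z)) \<alpha>) \<partial>M)"
    unfolding kernel_comp_def hadamard_def by (simp add: epow_mult prod.distrib)
  also have "\<dots> \<le> (\<Prod>l\<in>{1..m}. epow (\<integral>\<^sup>+u. a l (fst z, u) * b l (u, snd z) \<partial>M) \<alpha>)"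
    by (rule nn_integral_Hadamard[OF adm])
      (use kernel_section_measurable(1)[OF a z'(1)] kernel_section_measurable(2)[OF b z'(2)] in measurable)
  finally show ?thesis by (simp add: hadamard_def kernel_comp_def)
qed

text \<open>Hoelder's inequality twice: in the inner variable for the application to f, then in the
  outer one for the squared norm.\<close>

lemma kernel_bound_hadamard_mean:
  assumes m: "0 < m" and a: "\<And>l. l \<in> {1..m} \<Longrightarrow> a l \<in> borel_measurable (M \<Otimes>\<^sub>M M)"
    and C: "\<And>l. l \<in> {1..m} \<Longrightarrow> kernel_bound M (a l) (C l)" "\<And>l. l \<in> {1..m} \<Longrightarrow> 0 \<le> C l"
  shows "kernel_bound M (hadamard m (1 / real m) a) (\<Prod>l\<in>{1..m}. C l powr (1 / real m))"
  unfolding kernel_bound_def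
proof (intro allI impI)
  let ?\<alpha> = "1 / real m"
  have adm: "admissible M m ?\<alpha>" using m by (simp add: admissible_def)
  fix f assume f: "sq2 M f"
  note fm [measurable] = sq2_measurable[OF f]
  \<comment> \<open>The weights add up to exactly one, so a factor can be distributed over the m
    powers and collected again.\<close>
  have one: "(\<Prod>l\<in>{1..m}. epow y ?\<alpha>) = y" for y
    using m by (simp add: epow_power_eq)
  have 1: "kernel_apply M (hadamard m ?\<alpha> a) f x \<le> (\<Prod>l\<in>{1..m}. epow (kernel_apply M (a l) f x) ?\<alpha>)" if x: "x \<in> space M" for x
  proof -
    have "hadamard m ?\<alpha> a (x, y) * f y = (\<Prod>l\<in>{1..m}. epow (a l (x, y) * f y) ?\<alpha>)" for y
      unfolding hadamard_def epow_mult prod.distrib one ..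
    then have "kernel_apply M (hadamard m ?\<alpha> a) f x = (\<integral>\<^sup>+y. (\<Prod>l\<in>{1..m}. epow (a l (x, y) * f y) ?\<alpha>) \<partial>M)"
      unfolding kernel_apply_def by simp
    also have "\<dots> \<le> (\<Prod>l\<in>{1..m}. epow (\<integral>\<^sup>+y. a l (x, y) * f y \<partial>M) ?\<alpha>)"
      by (rule nn_integral_Hadamard[OF adm]) (use kernel_section_measurable(1)[OF a x] in measurable)
    finally show ?thesis by (simp add: kernel_apply_def)
  qed
  have "(\<integral>\<^sup>+x. (kernel_apply M (hadamard m ?\<alpha> a) f x)\<^sup>2 \<partial>M) \<le> (\<integral>\<^sup>+x. (\<Prod>l\<in>{1..m}. epow ((kernel_apply M (a l) f x)\<^sup>2) ?\<alpha>) \<partial>M)"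
    by (intro nn_integral_mono order_trans[OF power_mono[OF 1]]) (auto simp: prod_power_distrib epow_power)
  also have "\<dots> \<le> (\<Prod>l\<in>{1..m}. epow (\<integral>\<^sup>+x. (kernel_apply M (a l) f x)\<^sup>2 \<partial>M) ?\<alpha>)"
    by (rule nn_integral_Hadamard[OF adm]) (use kernel_apply_measurable[OF a fm] in measurable)
  also have "\<dots> \<le> (\<Prod>l\<in>{1..m}. epow (ennreal ((C l)\<^sup>2) * (\<integral>\<^sup>+x. (f x)\<^sup>2 \<partial>M)) ?\<alpha>)"
    using C(1) f unfolding kernel_bound_def by (intro ennreal_prod_mono epow_mono) auto
  also have "\<dots> = (\<Prod>l\<in>{1..m}. epow (ennreal ((C l)\<^sup>2)) ?\<alpha>) * (\<integral>\<^sup>+x. (f x)\<^sup>2 \<partial>M)"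
    unfolding epow_mult prod.distrib one ..
  also have "(\<Prod>l\<in>{1..m}. epow (ennreal ((C l)\<^sup>2)) ?\<alpha>) = ennreal ((\<Prod>l\<in>{1..m}. C l powr ?\<alpha>)\<^sup>2)"
  proof -
    have "((C l)\<^sup>2) powr ?\<alpha> = (C l powr ?\<alpha>)\<^sup>2" if "l \<in> {1..m}" for l
      using C(2)[OF that] by (simp add: power2_eq_square powr_mult)
    then have "(\<Prod>l\<in>{1..m}. epow (ennreal ((C l)\<^sup>2)) ?\<alpha>) = (\<Prod>l\<in>{1..m}. ennreal ((C l powr ?\<alpha>)\<^sup>2))"
      by (intro prod.cong refl) (simp add: epow_ennreal)
    also have "\<dots> = ennreal (\<Prod>l\<in>{1..m}. (C l powr ?\<alpha>)\<^sup>2)" by (rule prod_ennreal) simp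
    finally show ?thesis by (simp add: prod_power_distrib)
  qed
  finally show "(\<integral>\<^sup>+x. (kernel_apply M (hadamard m ?\<alpha> a) f x)\<^sup>2 \<partial>M)
    \<le> ennreal ((\<Prod>l\<in>{1..m}. C l powr ?\<alpha>)\<^sup>2) * (\<integral>\<^sup>+x. (f x)\<^sup>2 \<partial>M)" .
qed

end

text \<open>Apply the kernel to the unit vector at y and keep only the coordinate x: matrix entries
  are bounded by the norm.\<close>

lemma kernel_bound_count_space:
  assumes k: "kernel_bound (count_space R) k C" and C: "0 \<le> C" and xy: "x \<in> R" "y \<in> R"
  shows "k (x, y) \<le> ennreal C"
proof -
  let ?f = "indicator {y} :: _ \<Rightarrow> ennreal"
  have i: "(\<integral>\<^sup>+u. g u * ?f u \<partial>count_space R) = g y" for g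
    using xy by (subst nn_integral_count_space'[of "{y}"]) auto
  have f2: "(\<integral>\<^sup>+u. (?f u)\<^sup>2 \<partial>count_space R) = 1"
    using i[of ?f] by (simp add: power2_eq_square)
  then have "sq2 (count_space R) ?f" by (simp add: sq2_def)
  then have "(\<integral>\<^sup>+u. (kernel_apply (count_space R) k ?f u)\<^sup>2 \<partial>count_space R) \<le> ennreal (C\<^sup>2)"
    using k f2 by (auto simp: kernel_bound_def)
  moreover have "(kernel_apply (count_space R) k ?f x)\<^sup>2 \<le> (\<integral>\<^sup>+u. (kernel_apply (count_space R) k ?f u)\<^sup>2 \<partial>count_space R)"
    by (rule nn_integral_ge_point[OF xy(1)])
  moreover have "kernel_apply (count_space R) k ?f x = k (x, y)"
    unfolding kernel_apply_def by (rule i)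
  ultimately have "(k (x, y))\<^sup>2 \<le> ennreal (C\<^sup>2)" by simp
  then show ?thesis using C by (cases "k (x, y)") (auto simp: ennreal_power ennreal_le_iff power_mono_iff abs_le_square_iff[symmetric] top_unique)
qed

context sigma_finite_measure
begin

text \<open>Split \<alpha> = \<beta> + 1 / m. Over counting measure the entries are at most C l, so
  the surplus exponent \<beta> yields the constant factor \<open>?P\<close>, and a mean with weights
  summing to one remains.\<close>

lemma kernel_bound_hadamard:
  assumes adm: "admissible M m \<alpha>" and a: "\<And>l. l \<in> {1..m} \<Longrightarrow> a l \<in> borel_measurable (M \<Otimes>\<^sub>M M)"
    and C: "\<And>l. l \<in> {1..m} \<Longrightarrow> kernel_bound M (a l) (C l)" "\<And>l. l \<in> {1..m} \<Longrightarrow> 0 \<le> C l"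
  shows "kernel_bound M (hadamard m \<alpha> a) (\<Prod>l\<in>{1..m}. C l powr \<alpha>)"
proof (cases "\<alpha> = 1 / real m")
  case True
  then show ?thesis using kernel_bound_hadamard_mean[of m a C] adm a C by (simp add: admissible_def)
next
  case False
  define \<beta> where "\<beta> = \<alpha> - 1 / real m"
  have m: "0 < m" and \<beta>: "0 < \<beta>" and \<alpha>: "\<alpha> = \<beta> + 1 / real m" using adm False by (auto simp: admissible_def \<beta>_def)
  obtain R where R: "M = count_space R" using adm False by (auto simp: admissible_def)
  let ?P = "\<Prod>l\<in>{1..m}. C l powr \<beta>" and ?Q = "\<Prod>l\<in>{1..m}. C l powr (1 / real m)" and ?h = "hadamard m (1 / real m) a"
  have le: "hadamard m \<alpha> a z \<le> ennreal ?P * ?h z" if z: "z \<in> R \<times> R" for z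
  proof -
    have "hadamard m \<alpha> a z = (\<Prod>l\<in>{1..m}. epow (a l z) \<beta>) * ?h z"
      unfolding hadamard_def \<alpha> prod.distrib[symmetric] using \<beta> by (simp add: epow_add)
    also have "(\<Prod>l\<in>{1..m}. epow (a l z) \<beta>) \<le> (\<Prod>l\<in>{1..m}. ennreal (C l powr \<beta>))"
    proof (rule ennreal_prod_mono)
      fix l assume l: "l \<in> {1..m}"
      have "a l z \<le> ennreal (C l)"
        using kernel_bound_count_space[of R "a l" "C l" "fst z" "snd z"] C[OF l] z R by auto
      then have "epow (a l z) \<beta> \<le> epow (ennreal (C l)) \<beta>" by (rule epow_mono) (use \<beta> in simp)
      then show "epow (a l z) \<beta> \<le> ennreal (C l powr \<beta>)" using C(2)[OF l] by (simp add: epow_ennreal)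
    qed
    also have "(\<Prod>l\<in>{1..m}. ennreal (C l powr \<beta>)) = ennreal ?P" by (rule prod_ennreal) simp
    finally show ?thesis by (simp add: mult_right_mono)
  qed
  show ?thesis unfolding kernel_bound_def
  proof (intro allI impI)
    fix f assume f: "sq2 M f"
    have hm: "?h \<in> borel_measurable (M \<Otimes>\<^sub>M M)" using a by measurable
    note [measurable] = sq2_measurable[OF f] kernel_apply_measurable[OF hm sq2_measurable[OF f]]
    have "kernel_apply M (hadamard m \<alpha> a) f x \<le> ennreal ?P * kernel_apply M ?h f x" if x: "x \<in> space M" for x
    proof -
      have "kernel_apply M (hadamard m \<alpha> a) f x \<le> (\<integral>\<^sup>+y. ennreal ?P * (?h (x, y) * f y) \<partial>M)"
        unfolding kernel_apply_def
      proof (rule nn_integral_mono)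
        fix y assume "y \<in> space M"
        then have "hadamard m \<alpha> a (x, y) \<le> ennreal ?P * ?h (x, y)" using x R by (intro le) auto
        then show "hadamard m \<alpha> a (x, y) * f y \<le> ennreal ?P * (?h (x, y) * f y)"
          by (simp add: mult_right_mono mult.assoc[symmetric])
      qed
      also have "\<dots> = ennreal ?P * kernel_apply M ?h f x"
        unfolding kernel_apply_def
        by (rule nn_integral_cmult) (use kernel_section_measurable(1)[OF hm x] in measurable)
      finally show ?thesis .
    qed
    then have "(\<integral>\<^sup>+x. (kernel_apply M (hadamard m \<alpha> a) f x)\<^sup>2 \<partial>M) \<le> (\<integral>\<^sup>+x. (ennreal ?P * kernel_apply M ?h f x)\<^sup>2 \<partial>M)"
      by (intro nn_integral_mono power_mono) auto
    also have "\<dots> = (ennreal ?P)\<^sup>2 * (\<integral>\<^sup>+x. (kernel_apply M ?h f x)\<^sup>2 \<partial>M)"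
      unfolding power_mult_distrib by (rule nn_integral_cmult) measurable
    also have "\<dots> \<le> (ennreal ?P)\<^sup>2 * (ennreal (?Q\<^sup>2) * (\<integral>\<^sup>+x. (f x)\<^sup>2 \<partial>M))"
      using kernel_bound_hadamard_mean[of m a C] m a C f unfolding kernel_bound_def by (intro mult_left_mono) auto
    also have "\<dots> = ennreal ((?P * ?Q)\<^sup>2) * (\<integral>\<^sup>+x. (f x)\<^sup>2 \<partial>M)"
      by (simp add: ennreal_power ennreal_mult prod_nonneg power_mult_distrib mult.assoc)
    also have "?P * ?Q = (\<Prod>l\<in>{1..m}. C l powr \<alpha>)" unfolding \<alpha> prod.distrib[symmetric] powr_add ..
    finally show "(\<integral>\<^sup>+x. (kernel_apply M (hadamard m \<alpha> a) f x)\<^sup>2 \<partial>M) \<le>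
      ennreal ((\<Prod>l\<in>{1..m}. C l powr \<alpha>)\<^sup>2) * (\<integral>\<^sup>+x. (f x)\<^sup>2 \<partial>M)" .
  qed
qed

end

section \<open>Hadamard weighted means of operators\<close>

text \<open>Unlike membership in \<open>kernel_hadamard\<close> it remembers the family of factors,
  which can then be permuted, adjoined and composed.\<close>

definition is_hadamard_mean :: "'a measure \<Rightarrow> nat \<Rightarrow> real \<Rightarrow> 'a L2_op \<Rightarrow> (nat \<Rightarrow> 'a L2_op) \<Rightarrow> bool" where
  "is_hadamard_mean M m \<alpha> C A \<longleftrightarrow> (\<exists>a. (\<forall>l\<in>{1..m}. bounded_operator M (A l) \<and> represents M (A l) (a l)) \<and>
     represents M C (hadamard m \<alpha> a))"

lemma is_hadamard_mean_cong:
  "(\<And>l. l \<in> {1..m} \<Longrightarrow> A l = B l) \<Longrightarrow> is_hadamard_mean M m \<alpha> C A \<longleftrightarrow> is_hadamard_mean M m \<alpha> C B"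
  unfolding is_hadamard_mean_def by simp

lemma is_hadamard_mean_op: "is_hadamard_mean M m \<alpha> C A \<Longrightarrow> L2_operator M C"
  by (auto simp: is_hadamard_mean_def represents_def)

lemma is_hadamard_mean_bounded_args: "is_hadamard_mean M m \<alpha> C A \<Longrightarrow> l \<in> {1..m} \<Longrightarrow> bounded_operator M (A l)"
  by (auto simp: is_hadamard_mean_def)

text \<open>The product of the powers is commutative. This freedom aligns the factors of different
  means before they are multiplied.\<close>

lemma is_hadamard_mean_reindex:
  assumes C: "is_hadamard_mean M m \<alpha> C A" and \<sigma>: "bij_betw \<sigma> {1..m} {1..m}"
  shows "is_hadamard_mean M m \<alpha> C (\<lambda>l. A (\<sigma> l))"
proof -
  obtain a where a: "\<And>l. l \<in> {1..m} \<Longrightarrow> bounded_operator M (A l) \<and> represents M (A l) (a l)"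
    and Ca: "represents M C (hadamard m \<alpha> a)"
    using C unfolding is_hadamard_mean_def by blast
  have "hadamard m \<alpha> (\<lambda>l. a (\<sigma> l)) = hadamard m \<alpha> a"
    unfolding hadamard_def[abs_def] by (rule ext) (rule prod.reindex_bij_betw[OF \<sigma>])
  then show ?thesis unfolding is_hadamard_mean_def using a Ca bij_betwE[OF \<sigma>]
    by (intro exI[of _ "\<lambda>l. a (\<sigma> l)"]) auto
qed

lemma hadamard_transpose: "hadamard m \<alpha> (\<lambda>l. kernel_transpose (a l)) = kernel_transpose (hadamard m \<alpha> a)"
  by (simp add: hadamard_def[abs_def] kernel_transpose_def)

context sigma_finite_measure
begin

lemma hadamard_mean_bounded:
  assumes adm: "admissible M m \<alpha>"
    and a: "\<And>l. l \<in> {1..m} \<Longrightarrow> bounded_operator M (A l) \<and> represents M (A l) (a l)"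
  obtains C where "represents M C (hadamard m \<alpha> a)" "bounded_operator M C"
    "op_norm M C \<le> (\<Prod>l\<in>{1..m}. op_norm M (A l) powr \<alpha>)"
proof -
  have am: "\<And>l. l \<in> {1..m} \<Longrightarrow> a l \<in> borel_measurable (M \<Otimes>\<^sub>M M)" using a representsD(2) by blast
  have kb: "kernel_bound M (hadamard m \<alpha> a) (\<Prod>l\<in>{1..m}. op_norm M (A l) powr \<alpha>)"
  proof (rule kernel_bound_hadamard[OF adm am])
    fix l assume "l \<in> {1..m}"
    note al = a[OF this]
    show "kernel_bound M (a l) (op_norm M (A l))" by (rule represents_bound) (use al in auto)
    show "0 \<le> op_norm M (A l)" using al by simp
  qed
  have nn: "0 \<le> (\<Prod>l\<in>{1..m}. op_norm M (A l) powr \<alpha>)" by (simp add: prod_nonneg)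
  show ?thesis by (rule represents_exists[OF hadamard_measurable[OF am] kb nn]) (assumption, rule that)
qed

text \<open>The kernel determines the operator, so C is the bounded one constructed in
  \<open>hadamard_mean_bounded\<close>.\<close>

lemma is_hadamard_mean_bounded:
  assumes adm: "admissible M m \<alpha>" and C: "is_hadamard_mean M m \<alpha> C A"
  shows "bounded_operator M C" "op_norm M C \<le> (\<Prod>l\<in>{1..m}. op_norm M (A l) powr \<alpha>)"
proof -
  obtain a where a: "\<And>l. l \<in> {1..m} \<Longrightarrow> bounded_operator M (A l) \<and> represents M (A l) (a l)"
    and Ca: "represents M C (hadamard m \<alpha> a)"
    using C unfolding is_hadamard_mean_def by blast
  obtain C' where C': "represents M C' (hadamard m \<alpha> a)" "bounded_operator M C'"
    "op_norm M C' \<le> (\<Prod>l\<in>{1..m}. op_norm M (A l) powr \<alpha>)"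
    using hadamard_mean_bounded[OF adm a] .
  have "C = C'" by (rule represents_unique[OF Ca C'(1)])
  then show "bounded_operator M C" "op_norm M C \<le> (\<Prod>l\<in>{1..m}. op_norm M (A l) powr \<alpha>)" using C' by auto
qed

lemma is_hadamard_mean_adjoint:
  assumes adm: "admissible M m \<alpha>" and C: "is_hadamard_mean M m \<alpha> C A" and C': "is_adjoint M C C'"
    and A': "\<And>l. l \<in> {1..m} \<Longrightarrow> is_adjoint M (A l) (A' l)"
  shows "is_hadamard_mean M m \<alpha> C' A'"
proof -
  obtain a where a: "\<And>l. l \<in> {1..m} \<Longrightarrow> bounded_operator M (A l) \<and> represents M (A l) (a l)"
    and Ca: "represents M C (hadamard m \<alpha> a)"
    using C unfolding is_hadamard_mean_def by blast
  have "represents M C' (hadamard m \<alpha> (\<lambda>l. kernel_transpose (a l)))"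
    unfolding hadamard_transpose
    by (rule represents_adjoint[OF Ca is_hadamard_mean_bounded(1)[OF adm C] C'])
  moreover have "bounded_operator M (A' l) \<and> represents M (A' l) (kernel_transpose (a l))" if l: "l \<in> {1..m}" for l
    using is_adjoint_bounded(1)[OF _ A'[OF l]] represents_adjoint[OF _ _ A'[OF l]] a[OF l] by auto
  ultimately show ?thesis unfolding is_hadamard_mean_def by (intro exI[of _ "\<lambda>l. kernel_transpose (a l)"]) auto
qed

text \<open>Induction on the word with \<open>kernel_comp_hadamard\<close> at each letter. It starts
  at words of length one, since the identity need not have a kernel.\<close>

lemma is_hadamard_mean_list_prod:
  assumes adm: "admissible M m \<alpha>" and L: "list_all2 (is_hadamard_mean M m \<alpha>) Cs As" and ne: "Cs \<noteq> []"
  shows "\<exists>D. is_hadamard_mean M m \<alpha> D (\<lambda>l. op_list_prod M (map (\<lambda>A. A l) As)) \<and> majorized M (op_list_prod M Cs) D"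
  using L ne
proof (induction rule: list_all2_induct)
  case (Cons C Cs A As)
  obtain a where a: "\<And>l. l \<in> {1..m} \<Longrightarrow> bounded_operator M (A l) \<and> represents M (A l) (a l)"
    and Ca: "represents M C (hadamard m \<alpha> a)"
    using Cons.hyps(1) unfolding is_hadamard_mean_def by blast
  have CC: "majorized M C C" by (rule represents_majorized[OF Ca Ca]) simp
  show ?case
  proof (cases "Cs = []")
    case True
    then have As: "As = []" using Cons.hyps by simp
    have "is_hadamard_mean M m \<alpha> C (\<lambda>l. op_list_prod M (map (\<lambda>A. A l) [A]))"
      using Cons.hyps(1) by (subst is_hadamard_mean_cong[of m _ A])
        (simp_all add: op_list_prod_single bounded_operatorD[OF is_hadamard_mean_bounded_args])
    then show ?thesis using CC True As op_list_prod_single[OF representsD(1)[OF Ca]] by auto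
  next
    case False
    then obtain D where D: "is_hadamard_mean M m \<alpha> D (\<lambda>l. op_list_prod M (map (\<lambda>A. A l) As))"
      "majorized M (op_list_prod M Cs) D" using Cons.IH by auto
    let ?P = "\<lambda>l. op_list_prod M (map (\<lambda>A. A l) As)"
    obtain p where p: "\<And>l. l \<in> {1..m} \<Longrightarrow> bounded_operator M (?P l) \<and> represents M (?P l) (p l)"
      and Dp: "represents M D (hadamard m \<alpha> p)"
      using D(1) unfolding is_hadamard_mean_def by blast
    have ap: "bounded_operator M (compose (L2 M) (A l) (?P l)) \<and> represents M (compose (L2 M) (A l) (?P l)) (kernel_comp M (a l) (p l))"
      if "l \<in> {1..m}" for l
      using bounded_operator_compose(1)[of M "A l" "?P l"] represents_compose[of "A l" "a l" "?P l" "p l"] a[OF that] p[OF that]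
      by simp
    \<comment> \<open>The compositions are bounded, so their mean is again an operator; its kernel
      dominates that of C composed with D.\<close>
    obtain E where E: "represents M E (hadamard m \<alpha> (\<lambda>l. kernel_comp M (a l) (p l)))"
      by (rule hadamard_mean_bounded[OF adm ap]) (assumption, rule that)
    have "is_hadamard_mean M m \<alpha> E (\<lambda>l. compose (L2 M) (A l) (?P l))"
      unfolding is_hadamard_mean_def
      by (intro exI[of _ "\<lambda>l. kernel_comp M (a l) (p l)"] conjI ballI E ap[THEN conjunct1] ap[THEN conjunct2])
    moreover have "majorized M (compose (L2 M) C D) E"
    proof (rule represents_majorized[OF represents_compose[OF Ca Dp] E], rule kernel_comp_hadamard[OF adm])
      show "a l \<in> borel_measurable (M \<Otimes>\<^sub>M M)" if "l \<in> {1..m}" for l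
        by (rule representsD(2)[OF conjunct2[OF a[OF that]]])
      show "p l \<in> borel_measurable (M \<Otimes>\<^sub>M M)" if "l \<in> {1..m}" for l
        by (rule representsD(2)[OF conjunct2[OF p[OF that]]])
    qed
    moreover have "L2_operator M (op_list_prod M Cs)"
    proof (rule L2_operator_list_prod)
      fix X assume "X \<in> set Cs"
      then obtain i where "i < length Cs" "X = Cs ! i" by (auto simp: in_set_conv_nth)
      then have "is_hadamard_mean M m \<alpha> X (As ! i)" using Cons.hyps(2) by (simp add: list_all2_conv_all_nth)
      then show "L2_operator M X" by (rule is_hadamard_mean_op)
    qed
    then have "majorized M (compose (L2 M) C (op_list_prod M Cs)) (compose (L2 M) C D)"
      by (rule majorized_compose[OF CC D(2)])
    ultimately show ?thesis by (intro exI[of _ E]) (auto simp: op_list_prod_Cons intro: majorized_trans)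
  qed
qed simp

text \<open>For the norm this is the product estimate. For the spectral radius the n-th power of C
  is dominated by the mean of the n-th powers of the factors; the norm estimate for that mean and
  Gelfand's formula finish the argument.\<close>

lemma is_hadamard_mean_size:
  assumes w: "size_function M w" and adm: "admissible M m \<alpha>" and C: "is_hadamard_mean M m \<alpha> C A"
    and s: "\<And>l. l \<in> {1..m} \<Longrightarrow> w (A l) \<le> s" "0 \<le> s"
  shows "w C \<le> s powr (\<alpha> * m)"
proof -
  have \<alpha>: "0 < \<alpha>" by (rule admissible_pos[OF adm])
  have m: "0 < m" using adm by (simp add: admissible_def)
  have prod: "(\<Prod>l\<in>{1..m}. f l powr \<alpha>) \<le> t powr (\<alpha> * m)" if "\<And>l. l \<in> {1..m} \<Longrightarrow> 0 \<le> f l \<and> f l \<le> t" for f t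
  proof -
    have "0 \<le> t" using that[of 1] m by auto
    have "(\<Prod>l\<in>{1..m}. f l powr \<alpha>) \<le> (\<Prod>l\<in>{1..m}. t powr \<alpha>)"
      using that \<alpha> by (intro prod_mono) (auto intro!: powr_mono2)
    also have "\<dots> = (t powr \<alpha>) ^ m" by simp
    also have "\<dots> = t powr (\<alpha> * m)" using m \<open>0 \<le> t\<close>
      by (cases "t = 0") (auto simp: powr_powr[symmetric] powr_realpow)
    finally show ?thesis .
  qed
  note bA = is_hadamard_mean_bounded_args[OF C]
  note bC = is_hadamard_mean_bounded[OF adm C]
  consider "w = op_norm M" | "w = op_spectral_radius M" using w by (auto simp: size_function_def)
  then show ?thesis
  proof cases
    case 1
    have "op_norm M C \<le> (\<Prod>l\<in>{1..m}. op_norm M (A l) powr \<alpha>)" by (rule bC(2))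
    also have "\<dots> \<le> s powr (\<alpha> * m)" by (rule prod) (use s bA 1 in auto)
    finally show ?thesis by (simp add: 1)
  next
    case 2
    let ?\<rho> = "op_spectral_radius M"
    have \<alpha>m: "0 < \<alpha> * m" using \<alpha> m by simp
    \<comment> \<open>Taking the root first lets t approach s itself.\<close>
    have "?\<rho> C powr (1 / (\<alpha> * m)) \<le> s"
    proof (rule dense_ge)
      fix t assume t: "s < t"
      then have t0: "0 < t" using s by simp
      have "\<forall>l\<in>{1..m}. \<exists>K. \<forall>n. op_norm M (op_power M (A l) n) \<le> K * t ^ n"
      proof
        fix l assume l: "l \<in> {1..m}"
        have "?\<rho> (A l) < t" using s(1)[OF l] t 2 by simp
        from op_norm_power_bound[OF bA[OF l] this] show "\<exists>K. \<forall>n. op_norm M (op_power M (A l) n) \<le> K * t ^ n" by metis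
      qed
      then obtain K where K: "\<And>l n. l \<in> {1..m} \<Longrightarrow> op_norm M (op_power M (A l) n) \<le> K l * t ^ n" by metis
      define L where "L = (\<Sum>l\<in>{1..m}. \<bar>K l\<bar>)"
      have "0 \<le> L" unfolding L_def by (rule sum_nonneg) simp
      have KL: "op_norm M (op_power M (A l) n) \<le> L * t ^ n" if l: "l \<in> {1..m}" for l n
      proof -
        have "K l \<le> L" unfolding L_def using member_le_sum[of l "{1..m}" "\<lambda>l. \<bar>K l\<bar>"] l by fastforce
        then show ?thesis using K[OF l, of n] t0 by (meson mult_right_mono order_trans zero_le_power less_imp_le)
      qed
      have "?\<rho> C \<le> t powr (\<alpha> * m)"
      proof (rule op_spectral_radius_leI[OF bC(1)])
        fix n :: nat assume n: "n > 0"
        have "list_all2 (is_hadamard_mean M m \<alpha>) (replicate n C) (replicate n A)"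
          using C by (simp add: list_all2_conv_all_nth)
        then obtain D where D: "is_hadamard_mean M m \<alpha> D (\<lambda>l. op_list_prod M (map (\<lambda>A. A l) (replicate n A)))"
          "majorized M (op_power M C n) D"
          using is_hadamard_mean_list_prod[OF adm] n by (metis replicate_empty less_numeral_extra(3))
        then have D1: "is_hadamard_mean M m \<alpha> D (\<lambda>l. op_power M (A l) n)" by (simp add: map_replicate)
        note bD = is_hadamard_mean_bounded[OF adm D1]
        have "op_norm M (op_power M C n) \<le> op_norm M D"
          by (rule majorized_op_norm(2)[OF D(2) bounded_operatorD[OF bounded_operator_power[OF bC(1)]] bD(1)])
        also have "\<dots> \<le> (\<Prod>l\<in>{1..m}. op_norm M (op_power M (A l) n) powr \<alpha>)" by (rule bD(2))
        also have "\<dots> \<le> (L * t ^ n) powr (\<alpha> * m)"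
          by (rule prod) (intro conjI KL op_norm_nonneg bounded_operator_power bA)
        also have "\<dots> = L powr (\<alpha> * m) * (t powr (\<alpha> * m)) ^ n"
          using t0 \<open>0 \<le> L\<close> by (simp add: powr_mult powr_realpow[symmetric] powr_powr mult.commute)
        finally show "op_norm M (op_power M C n) \<le> L powr (\<alpha> * m) * (t powr (\<alpha> * m)) ^ n" .
      qed (use t0 in simp)
      then have "?\<rho> C powr (1 / (\<alpha> * m)) \<le> (t powr (\<alpha> * m)) powr (1 / (\<alpha> * m))"
        by (intro powr_mono2) (use bC \<alpha>m in auto)
      also have "\<dots> = t" using t0 \<alpha>m by (auto simp: powr_powr)
      finally show "?\<rho> C powr (1 / (\<alpha> * m)) \<le> t" .
    qed
    then have "(?\<rho> C powr (1 / (\<alpha> * m))) powr (\<alpha> * m) \<le> s powr (\<alpha> * m)"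
      by (intro powr_mono2) (use \<alpha>m in auto)
    moreover have "(?\<rho> C powr (1 / (\<alpha> * m))) powr (\<alpha> * m) = ?\<rho> C"
      using \<alpha>m op_spectral_radius_nonneg[OF bC(1)] by (auto simp: powr_powr)
    ultimately show ?thesis by (simp add: 2)
  qed
qed

lemma enn2real_prod: "enn2real (\<Prod>i\<in>I. f i) = (\<Prod>i\<in>I. enn2real (f i))"
  by (induction I rule: infinite_finite_induct) (auto simp: enn2real_mult)

lemma mem_kernel_hadamardI:
  assumes C: "is_hadamard_mean M m \<alpha> C A" and A: "\<And>l. l \<in> {1..m} \<Longrightarrow> A l \<in> \<Psi> l"
  shows "C \<in> kernel_hadamard M m (\<lambda>_. \<alpha>) \<Psi>"
proof -
  obtain a where a: "\<And>l. l \<in> {1..m} \<Longrightarrow> bounded_operator M (A l) \<and> represents M (A l) (a l)"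
    and Ca: "represents M C (hadamard m \<alpha> a)"
    using C unfolding is_hadamard_mean_def by blast
  have 1: "has_kernel M (A l) (\<lambda>z. of_real (enn2real (a l z)))" if "l \<in> {1..m}" for l
    using a[OF that] by (intro represents_has_kernel) simp
  have 2: "has_kernel M C (\<lambda>z. of_real (\<Prod>l=1..m. enn2real (a l z) powr \<alpha>))"
    using represents_has_kernel[OF Ca] by (simp only: hadamard_def enn2real_prod enn2real_epow)
  show ?thesis unfolding kernel_hadamard_def mem_Collect_eq
    using is_hadamard_mean_op[OF C] 1 2 A
    by (intro conjI exI[of _ A] exI[of _ "\<lambda>l z. enn2real (a l z)"] ballI allI) auto
qed

lemma mem_kernel_hadamardD:
  assumes C: "C \<in> kernel_hadamard M m (\<lambda>_. \<alpha>) \<Psi>" and b: "\<And>l. l \<in> {1..m} \<Longrightarrow> bounded_ops M (\<Psi> l)"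
  shows "\<exists>A. is_hadamard_mean M m \<alpha> C A \<and> (\<forall>l\<in>{1..m}. A l \<in> \<Psi> l)"
proof -
  obtain A a where L: "L2_operator M C"
    and A: "\<forall>j\<in>{1..m}. A j \<in> \<Psi> j \<and> (\<forall>z. 0 \<le> a j z) \<and> has_kernel M (A j) (\<lambda>z. of_real (a j z))"
    and k: "has_kernel M C (\<lambda>z. of_real (\<Prod>j=1..m. a j z powr \<alpha>))"
    using C unfolding kernel_hadamard_def mem_Collect_eq by (elim conjE exE)
  have bA: "bounded_operator M (A l)" if "l \<in> {1..m}" for l
    using bounded_opsD[OF b[OF that]] A that by blast
  have 1: "represents M (A l) (\<lambda>z. ennreal (a l z))" if l: "l \<in> {1..m}" for l
    by (rule has_kernel_represents[OF bounded_operatorD[OF bA[OF l]]]) (use A l in auto)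
  have "represents M C (\<lambda>z. ennreal (\<Prod>j=1..m. a j z powr \<alpha>))"
    by (rule has_kernel_represents[OF L _ k]) (auto intro: prod_nonneg)
  moreover have "(\<lambda>z. ennreal (\<Prod>j=1..m. a j z powr \<alpha>)) = hadamard m \<alpha> (\<lambda>l z. ennreal (a l z))"
  proof
    fix z
    have "(\<Prod>l\<in>{1..m}. epow (ennreal (a l z)) \<alpha>) = (\<Prod>l\<in>{1..m}. ennreal (a l z powr \<alpha>))"
    proof (rule prod.cong[OF refl])
      fix l assume "l \<in> {1..m}"
      then have "0 \<le> a l z" using A by blast
      then show "epow (ennreal (a l z)) \<alpha> = ennreal (a l z powr \<alpha>)" by (rule epow_ennreal)
    qed
    also have "\<dots> = ennreal (\<Prod>j=1..m. a j z powr \<alpha>)" by (rule prod_ennreal) simp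
    finally show "ennreal (\<Prod>j=1..m. a j z powr \<alpha>) = hadamard m \<alpha> (\<lambda>l z. ennreal (a l z)) z"
      by (simp add: hadamard_def)
  qed
  ultimately have "is_hadamard_mean M m \<alpha> C A"
    unfolding is_hadamard_mean_def using bA 1 by (intro exI[of _ "\<lambda>l z. ennreal (a l z)"]) auto
  then show ?thesis using A by (intro exI[of _ A]) blast
qed

lemma kernel_hadamard_bounded:
  assumes adm: "admissible M m \<alpha>" and b: "\<And>l. l \<in> {1..m} \<Longrightarrow> bounded_ops M (\<Psi> l)"
  shows "bounded_ops M (kernel_hadamard M m (\<lambda>_. \<alpha>) \<Psi>)"
proof -
  have "\<forall>l\<in>{1..m}. \<exists>C. \<forall>A\<in>\<Psi> l. bounded_operator M A \<and> op_norm M A \<le> C"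
    using b unfolding bounded_ops_def by blast
  then obtain B where B: "\<And>l A. l \<in> {1..m} \<Longrightarrow> A \<in> \<Psi> l \<Longrightarrow> bounded_operator M A \<and> op_norm M A \<le> B l" by metis
  show ?thesis
  proof (rule bounded_opsI)
    fix C assume "C \<in> kernel_hadamard M m (\<lambda>_. \<alpha>) \<Psi>"
    from mem_kernel_hadamardD[OF this b]
    obtain A where A: "is_hadamard_mean M m \<alpha> C A" "\<And>l. l \<in> {1..m} \<Longrightarrow> A l \<in> \<Psi> l" by blast
    have "op_norm M C \<le> (\<Prod>l\<in>{1..m}. op_norm M (A l) powr \<alpha>)" by (rule is_hadamard_mean_bounded(2)[OF adm A(1)])
    also have "\<dots> \<le> (\<Prod>l\<in>{1..m}. B l powr \<alpha>)"
      using B A(2) admissible_pos[OF adm] by (intro prod_mono) (auto intro!: powr_mono2)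
    finally show "bounded_operator M C \<and> op_norm M C \<le> (\<Prod>l\<in>{1..m}. B l powr \<alpha>)"
      using is_hadamard_mean_bounded(1)[OF adm A(1)] by simp
  qed
qed

lemma hadamard_list_prod_in:
  assumes adm: "admissible M m \<alpha>" and ne: "Cs \<noteq> []"
    and C: "list_all2 (is_hadamard_mean M m \<alpha>) Cs As"
    and A: "\<And>l. l \<in> {1..m} \<Longrightarrow> list_all2 (\<in>) (map (\<lambda>A. A l) As) (\<Phi> l)"
  obtains D where "D \<in> kernel_hadamard M m (\<lambda>_. \<alpha>) (\<lambda>l. ops_prod M (\<Phi> l))" "majorized M (op_list_prod M Cs) D"
    "is_hadamard_mean M m \<alpha> D (\<lambda>l. op_list_prod M (map (\<lambda>A. A l) As))"
proof -
  obtain D where D: "is_hadamard_mean M m \<alpha> D (\<lambda>l. op_list_prod M (map (\<lambda>A. A l) As))" "majorized M (op_list_prod M Cs) D"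
    using is_hadamard_mean_list_prod[OF adm C ne] by blast
  have "D \<in> kernel_hadamard M m (\<lambda>_. \<alpha>) (\<lambda>l. ops_prod M (\<Phi> l))"
    by (rule mem_kernel_hadamardI[OF D(1)]) (use A in \<open>auto simp: ops_prod_eq\<close>)
  then show ?thesis using that D by blast
qed

section \<open>The chain of inequalities\<close>

text \<open>A word over the means is dominated by the mean of the letterwise words, the l-th of
  which is a word over \<open>\<Omega> l\<close>; then \<open>is_hadamard_mean_size\<close> applies
  with a constant common to all l.\<close>

lemma weighted_radius_hadamard_le:
  assumes w: "size_function M w" and adm: "admissible M m \<alpha>"
    and b: "\<And>l. l \<in> {1..m} \<Longrightarrow> bounded_ops M (\<Omega> l)"
    and r: "\<And>l. l \<in> {1..m} \<Longrightarrow> weighted_radius M w (\<Omega> l) \<le> r" "0 \<le> r"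
  shows "weighted_radius M w (kernel_hadamard M m (\<lambda>_. \<alpha>) \<Omega>) \<le> r powr (\<alpha> * m)"
proof -
  let ?H = "kernel_hadamard M m (\<lambda>_. \<alpha>) \<Omega>"
  have bH: "bounded_ops M ?H" by (rule kernel_hadamard_bounded[OF adm b])
  have \<alpha>m: "0 < \<alpha> * m" using admissible_pos[OF adm] adm by (simp add: admissible_def)
  have "weighted_radius M w ?H powr (1 / (\<alpha> * m)) \<le> r"
  proof (rule dense_ge)
    fix t assume t: "r < t"
    then have t0: "0 < t" using r by simp
    have "\<forall>l\<in>{1..m}. \<exists>C. 0 \<le> C \<and> (\<forall>k A. A \<in> ops_power M (\<Omega> l) k \<longrightarrow> w A \<le> C * t ^ k)"
    proof
      fix l assume l: "l \<in> {1..m}"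
      have "weighted_radius M w (\<Omega> l) < t" using r(1)[OF l] t by simp
      from weighted_radius_bound[OF w b[OF l] this]
      show "\<exists>C. 0 \<le> C \<and> (\<forall>k A. A \<in> ops_power M (\<Omega> l) k \<longrightarrow> w A \<le> C * t ^ k)" by metis
    qed
    then obtain K where K: "\<And>l. l \<in> {1..m} \<Longrightarrow> 0 \<le> K l"
      "\<And>l k A. l \<in> {1..m} \<Longrightarrow> A \<in> ops_power M (\<Omega> l) k \<Longrightarrow> w A \<le> K l * t ^ k" by metis
    define L where "L = (\<Sum>l\<in>{1..m}. K l)"
    have L0: "0 \<le> L" unfolding L_def by (rule sum_nonneg) (use K in simp)
    have KL: "w A \<le> L * t ^ k" if l: "l \<in> {1..m}" and A: "A \<in> ops_power M (\<Omega> l) k" for l k A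
    proof -
      have "K l \<le> L" unfolding L_def by (rule member_le_sum) (use l K in auto)
      then show ?thesis using K(2)[OF l A] t0 by (meson mult_right_mono order_trans zero_le_power less_imp_le)
    qed
    have "weighted_radius M w ?H \<le> t powr (\<alpha> * m)"
    proof (rule weighted_radius_le[OF w bH])
      fix k X assume k: "k > 0" and "X \<in> ops_power M ?H k"
      then obtain Cs where Cs: "X = op_list_prod M Cs" "length Cs = k" "set Cs \<subseteq> ?H" by (auto simp: ops_power_eq)
      have "\<exists>A. is_hadamard_mean M m \<alpha> C A \<and> (\<forall>l\<in>{1..m}. A l \<in> \<Omega> l)" if "C \<in> set Cs" for C
        by (rule mem_kernel_hadamardD[OF subsetD[OF Cs(3) that] b])
      then obtain f where f: "\<And>C. C \<in> set Cs \<Longrightarrow> is_hadamard_mean M m \<alpha> C (f C) \<and> (\<forall>l\<in>{1..m}. f C l \<in> \<Omega> l)" by metis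
      let ?As = "map f Cs"
      have l2: "list_all2 (is_hadamard_mean M m \<alpha>) Cs ?As" using f by (auto simp: list_all2_conv_all_nth)
      have ne: "Cs \<noteq> []" using Cs(2) k by auto
      obtain D where D: "is_hadamard_mean M m \<alpha> D (\<lambda>l. op_list_prod M (map (\<lambda>A. A l) ?As))" "majorized M (op_list_prod M Cs) D"
        using is_hadamard_mean_list_prod[OF adm l2 ne] by blast
      have LX: "L2_operator M X" unfolding Cs(1)
        by (rule L2_operator_list_prod) (use bounded_operatorD[OF bounded_opsD[OF bH subsetD[OF Cs(3)]]] in blast)
      have "w X \<le> w D" unfolding Cs(1)
        by (rule majorized_size[OF w D(2) LX[unfolded Cs(1)] is_hadamard_mean_bounded(1)[OF adm D(1)]])
      also have "\<dots> \<le> (L * t ^ k) powr (\<alpha> * m)"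
      proof (rule is_hadamard_mean_size[OF w adm D(1)])
        fix l assume l: "l \<in> {1..m}"
        have "op_list_prod M (map (\<lambda>A. A l) ?As) \<in> ops_power M (\<Omega> l) k"
          unfolding ops_power_eq using Cs(2) f l by (intro CollectI exI[of _ "map (\<lambda>A. A l) ?As"]) auto
        then show "w (op_list_prod M (map (\<lambda>A. A l) ?As)) \<le> L * t ^ k" by (rule KL[OF l])
      qed (use L0 t0 in simp)
      also have "\<dots> = L powr (\<alpha> * m) * (t powr (\<alpha> * m)) ^ k"
        using t0 L0 by (simp add: powr_mult powr_realpow[symmetric] powr_powr mult.commute)
      finally show "w X \<le> L powr (\<alpha> * m) * (t powr (\<alpha> * m)) ^ k" .
    qed (use t0 in simp)
    then have "weighted_radius M w ?H powr (1 / (\<alpha> * m)) \<le> (t powr (\<alpha> * m)) powr (1 / (\<alpha> * m))"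
      by (intro powr_mono2) (use weighted_radius_nonneg[OF w bH] \<alpha>m in auto)
    also have "\<dots> = t" using t0 \<alpha>m by (auto simp: powr_powr)
    finally show "weighted_radius M w ?H powr (1 / (\<alpha> * m)) \<le> t" .
  qed
  then have "(weighted_radius M w ?H powr (1 / (\<alpha> * m))) powr (\<alpha> * m) \<le> r powr (\<alpha> * m)"
    by (intro powr_mono2) (use \<alpha>m in auto)
  moreover have "(weighted_radius M w ?H powr (1 / (\<alpha> * m))) powr (\<alpha> * m) = weighted_radius M w ?H"
    using \<alpha>m weighted_radius_nonneg[OF w bH] by (auto simp: powr_powr)
  ultimately show ?thesis by simp
qed

end

section \<open>Blocks, cyclic shifts and the pairing of indices\<close>

lemma split_into_blocks:
  "length xs = m * k \<Longrightarrow> \<exists>xss. concat xss = xs \<and> length xss = k \<and> (\<forall>ys\<in>set xss. length ys = m)"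
proof (induction k arbitrary: xs)
  case (Suc k)
  then have "length (drop m xs) = m * k" by simp
  from Suc.IH[OF this] obtain xss where "concat xss = drop m xs" "length xss = k" "\<forall>ys\<in>set xss. length ys = m"
    by blast
  then show ?case using Suc.prems by (intro exI[of _ "take m xs # xss"]) auto
qed simp

text \<open>The entry at position i, counted from 0, of the list l, ..., m, 1, ..., l - 1. As a
  function of l, with i fixed, it is a rotation of {1..m}.\<close>

definition cyclic_index :: "nat \<Rightarrow> nat \<Rightarrow> nat \<Rightarrow> nat" where
  "cyclic_index m i l = (l - 1 + i) mod m + 1"

lemma cyclic_index_eq:
  "i < m \<Longrightarrow> l \<in> {1..m} \<Longrightarrow> cyclic_index m i l = (if l + i \<le> m then l + i else l + i - m)"
  unfolding cyclic_index_def by (auto simp: le_mod_geq mod_if)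

lemma bij_cyclic_index:
  assumes "i < m" shows "bij_betw (cyclic_index m i) {1..m} {1..m}"
proof -
  have inj: "inj_on (cyclic_index m i) {1..m}"
    using assms by (auto simp: inj_on_def cyclic_index_eq split: if_splits)
  moreover have "cyclic_index m i ` {1..m} \<subseteq> {1..m}"
    using assms by (auto simp: cyclic_index_eq)
  ultimately show ?thesis by (simp add: bij_betw_def endo_inj_surj)
qed

lemma nth_cyclic:
  assumes "i < m" "l \<in> {1..m}"
  shows "([l..<m + 1] @ [1..<l]) ! i = cyclic_index m i l"
  using assms by (auto simp: nth_append cyclic_index_eq)

text \<open>The argument of \<tau> in the adjoint factor of \<open>adjoint_prods\<close>. It runs
  through the odd and then the even numbers, \<open>right_index\<close> the other way round; for
  even m each exhausts {1..m}.\<close>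

definition left_index :: "nat \<Rightarrow> nat \<Rightarrow> nat" where
  "left_index m j = (if j \<le> m div 2 then 2 * j - 1 else 2 * (j - m div 2))"

definition right_index :: "nat \<Rightarrow> nat \<Rightarrow> nat" where
  "right_index m j = (if j \<le> m div 2 then 2 * j else 2 * (j - m div 2) - 1)"

lemma bij_left_index: assumes "even m" shows "bij_betw (left_index m) {1..m} {1..m}"
proof -
  obtain h where h: "m = 2 * h" using assms by auto
  have "inj_on (left_index m) {1..m}"
    unfolding inj_on_def left_index_def h by (auto split: if_splits) presburger+
  moreover have "left_index m ` {1..m} \<subseteq> {1..m}"
    by (auto simp: left_index_def h)
  ultimately show ?thesis by (simp add: bij_betw_def endo_inj_surj)
qed

lemma bij_right_index: assumes "even m" shows "bij_betw (right_index m) {1..m} {1..m}"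
proof -
  obtain h where h: "m = 2 * h" using assms by auto
  have "inj_on (right_index m) {1..m}"
    unfolding inj_on_def right_index_def h by (auto split: if_splits) presburger+
  moreover have "right_index m ` {1..m} \<subseteq> {1..m}"
    by (auto simp: right_index_def h)
  ultimately show ?thesis by (simp add: bij_betw_def endo_inj_surj)
qed

lemma adjoint_prods_eq:
  "adjoint_prods M m \<tau> \<Psi> j =
    ops_prod M [ops_adjoint M (\<Psi> (\<tau> (left_index m j))), \<Psi> (\<tau> (right_index m j))]"
  by (auto simp: adjoint_prods_def left_index_def right_index_def Let_def)

text \<open>The adjoint of a product reverses the factors, and the adjoint of an adjoint is the
  operator itself. Each inclusion also needs one adjoint to exist, hence boundedness of both
  sets.\<close>

lemma ops_adjoint_prod:
  assumes X: "bounded_ops M X" and Y: "bounded_ops M Y"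
  shows "ops_adjoint M (ops_prod M [ops_adjoint M X, Y]) = ops_prod M [ops_adjoint M Y, X]"
proof -
  have pair: "ops_prod M [P, Q] = ops_comp M P Q" if "bounded_ops M Q" for P Q
  proof -
    have "ops_prod M [Q] = Q"
      using bounded_opsD[OF that] by (force simp: ops_prod_eq list_all2_Cons2 op_list_prod_single bounded_operatorD)
    then show ?thesis by (simp add: ops_prod_Cons[of M P])
  qed
  have adj: "is_adjoint M (compose (L2 M) A' B) (compose (L2 M) B' A)"
    if "A \<in> X" "is_adjoint M A A'" "B \<in> Y" "is_adjoint M B B'" for A A' B B'
  proof (rule is_adjoint_compose)
    show "is_adjoint M A' A" by (rule is_adjoint_sym[OF bounded_operatorD[OF bounded_opsD[OF X that(1)]] that(2)])
    show "is_adjoint M B B'" by (rule that)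
    show "L2_operator M A'" using that(2) by (simp add: is_adjoint_def)
    show "L2_operator M B" by (rule bounded_operatorD[OF bounded_opsD[OF Y that(3)]])
  qed
  show ?thesis unfolding pair[OF Y] pair[OF X]
  proof (intro set_eqI iffI)
    fix Z assume "Z \<in> ops_adjoint M (ops_comp M (ops_adjoint M X) Y)"
    then obtain A A' B where Z: "A \<in> X" "is_adjoint M A A'" "B \<in> Y" "is_adjoint M (compose (L2 M) A' B) Z"
      by (auto simp: ops_adjoint_eq ops_comp_def)
    obtain B' where B': "is_adjoint M B B'" using is_adjoint_exists[OF bounded_opsD[OF Y Z(3)]] .
    have "Z = compose (L2 M) B' A" by (rule is_adjoint_unique[OF Z(4) adj[OF Z(1-3) B']])
    then show "Z \<in> ops_comp M (ops_adjoint M Y) X" using Z B' by (auto simp: ops_adjoint_eq ops_comp_def)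
  next
    fix Z assume "Z \<in> ops_comp M (ops_adjoint M Y) X"
    then obtain B B' A where Z: "B \<in> Y" "is_adjoint M B B'" "A \<in> X" "Z = compose (L2 M) B' A"
      by (auto simp: ops_adjoint_eq ops_comp_def)
    obtain A' where A': "is_adjoint M A A'" using is_adjoint_exists[OF bounded_opsD[OF X Z(3)]] .
    have "is_adjoint M (compose (L2 M) A' B) Z" unfolding Z(4) by (rule adj[OF Z(3) A' Z(1,2)])
    then show "Z \<in> ops_adjoint M (ops_comp M (ops_adjoint M X) Y)" using Z A'
      by (auto simp: ops_adjoint_eq ops_comp_def)
  qed
qed

section \<open>The three inequalities for fixed sets and permutations\<close>

context sigma_finite_measure
begin

context
  fixes m :: nat and \<alpha> :: real and \<tau> \<nu> :: "nat \<Rightarrow> nat" and \<Psi> :: "nat \<Rightarrow> 'a L2_op set" and w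
  assumes adm: "admissible M m \<alpha>" and m: "even m" and \<tau>: "\<tau> permutes {1..m}" and \<nu>: "\<nu> permutes {1..m}"
    and b\<Psi>: "\<And>j. j \<in> {1..m} \<Longrightarrow> bounded_ops M (\<Psi> j)" and w: "size_function M w"
begin

private abbreviation "S \<equiv> adjoint_prods M m \<tau> \<Psi>"
private abbreviation "\<Omega> \<equiv> cyclic_prods M m \<nu> S"
private abbreviation "H \<equiv> kernel_hadamard M m (\<lambda>_. \<alpha>)"

lemma index_in:
  assumes "j \<in> {1..m}"
  shows "\<tau> (left_index m j) \<in> {1..m}" "\<tau> (right_index m j) \<in> {1..m}" "\<nu> j \<in> {1..m}"
  using assms bij_betwE[OF bij_left_index[OF m]] bij_betwE[OF bij_right_index[OF m]]
    permutes_in_image[OF \<tau>] permutes_in_image[OF \<nu>] by blast+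

lemma bounded_S: "j \<in> {1..m} \<Longrightarrow> bounded_ops M (S j)"
proof -
  assume j: "j \<in> {1..m}"
  have "bounded_ops M \<Phi>"
    if "\<Phi> \<in> set [ops_adjoint M (\<Psi> (\<tau> (left_index m j))), \<Psi> (\<tau> (right_index m j))]" for \<Phi>
    using that ops_adjoint_bounded[OF b\<Psi>[OF index_in(1)[OF j]]] b\<Psi>[OF index_in(2)[OF j]] by auto
  then show ?thesis unfolding adjoint_prods_eq by (rule ops_prod_bounded)
qed

lemma bounded_S_\<nu>: "j \<in> {1..m} \<Longrightarrow> bounded_ops M (S (\<nu> j))"
  by (rule bounded_S[OF index_in(3)])

lemma bounded_\<Omega>: "i \<in> {1..m} \<Longrightarrow> bounded_ops M (\<Omega> i)"
  unfolding cyclic_prods_def by (rule ops_prod_bounded) (use bounded_S_\<nu> in auto)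

lemma bounded_HS: "bounded_ops M (H S)"
  by (rule kernel_hadamard_bounded[OF adm bounded_S])

lemma bounded_H\<Omega>: "bounded_ops M (H \<Omega>)"
  by (rule kernel_hadamard_bounded[OF adm bounded_\<Omega>])

text \<open>Shifting j by m / 2 interchanges the left and the right index.\<close>

lemma adjoint_prods_adjoint:
  assumes "j \<in> {1..m div 2}" shows "S (m div 2 + j) = ops_adjoint M (S j)"
proof -
  have j: "j \<in> {1..m}" using assms by auto
  have "left_index m (m div 2 + j) = right_index m j" "right_index m (m div 2 + j) = left_index m j"
    using assms by (auto simp: left_index_def right_index_def)
  then show ?thesis unfolding adjoint_prods_eq using index_in[OF j] b\<Psi> by (simp add: ops_adjoint_prod)
qed

text \<open>For C in the mean, the product of its adjoint with C is dominated by some D in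
  \<open>H S\<close>; the squared norm of C is then at most the spectral radius of D, which lies
  below the radius of the set.\<close>

lemma norm_hadamard_le: "ops_norm M (H \<Psi>) \<le> weighted_radius M w (H S) powr (1 / 2)"
  unfolding ops_norm_def
proof (rule Sup_nonneg_least)
  fix x assume "x \<in> op_norm M ` H \<Psi>"
  then obtain C where C: "C \<in> H \<Psi>" "x = op_norm M C" by auto
  obtain A where A: "is_hadamard_mean M m \<alpha> C A" "\<And>l. l \<in> {1..m} \<Longrightarrow> A l \<in> \<Psi> l"
    using mem_kernel_hadamardD[OF C(1) b\<Psi>] by blast
  note bC = is_hadamard_mean_bounded(1)[OF adm A(1)]
  obtain C' where C': "is_adjoint M C C'" using is_adjoint_exists[OF bC] .
  have "\<forall>l\<in>{1..m}. \<exists>B. is_adjoint M (A l) B"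
    using is_adjoint_exists is_hadamard_mean_bounded_args[OF A(1)] by metis
  then obtain A' where A': "\<And>l. l \<in> {1..m} \<Longrightarrow> is_adjoint M (A l) (A' l)" by metis
  have bl: "bij_betw (\<lambda>l. \<tau> (left_index m l)) {1..m} {1..m}"
    using bij_betw_trans[OF bij_left_index[OF m] permutes_imp_bij[OF \<tau>]] by (simp add: o_def)
  have br: "bij_betw (\<lambda>l. \<tau> (right_index m l)) {1..m} {1..m}"
    using bij_betw_trans[OF bij_right_index[OF m] permutes_imp_bij[OF \<tau>]] by (simp add: o_def)
  \<comment> \<open>The factors of the adjoint are listed by left indices and those of C by right
    indices, so that at position l an element of \<open>S l\<close> appears in the product.\<close>
  have h1: "is_hadamard_mean M m \<alpha> C' (\<lambda>l. A' (\<tau> (left_index m l)))"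
    by (rule is_hadamard_mean_reindex[OF is_hadamard_mean_adjoint[OF adm A(1) C' A'] bl])
  have h2: "is_hadamard_mean M m \<alpha> C (\<lambda>l. A (\<tau> (right_index m l)))"
    by (rule is_hadamard_mean_reindex[OF A(1) br])
  obtain D where D: "D \<in> H (\<lambda>l. ops_prod M [ops_adjoint M (\<Psi> (\<tau> (left_index m l))), \<Psi> (\<tau> (right_index m l))])"
    "majorized M (op_list_prod M [C', C]) D"
  proof (rule hadamard_list_prod_in[OF adm, of "[C', C]" "[\<lambda>l. A' (\<tau> (left_index m l)), \<lambda>l. A (\<tau> (right_index m l))]"])
    fix l assume l: "l \<in> {1..m}"
    show "list_all2 (\<in>) (map (\<lambda>A. A l) [\<lambda>l. A' (\<tau> (left_index m l)), \<lambda>l. A (\<tau> (right_index m l))])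
       [ops_adjoint M (\<Psi> (\<tau> (left_index m l))), \<Psi> (\<tau> (right_index m l))]"
      using index_in[OF l] A(2) A' by (auto simp: ops_adjoint_eq)
  qed (use h1 h2 in auto)
  have D': "D \<in> H S" using D(1) unfolding adjoint_prods_eq .
  note bD = bounded_opsD[OF bounded_HS D']
  have LC: "L2_operator M C" and LC': "L2_operator M C'" using bC C' by (auto simp: bounded_operatorD is_adjoint_def)
  have maj: "majorized M (compose (L2 M) C' C) D"
    using D(2) by (simp add: op_list_prod_Cons[of M C'] op_list_prod_single[OF LC])
  have "(op_norm M C)\<^sup>2 \<le> op_spectral_radius M D"
  proof (rule op_norm_sq_le_spectral_radius[OF bC C' bD])
    fix n :: nat
    show "op_norm M (op_power M (compose (L2 M) C' C) n) \<le> op_norm M (op_power M D n)"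
      by (rule majorized_op_norm(2)[OF majorized_power[OF maj L2_operator_compose[OF LC' LC]]
        L2_operator_list_prod bounded_operator_power[OF bD]]) (use L2_operator_compose[OF LC' LC] in auto)
  qed
  also have "\<dots> \<le> weighted_radius M w (H S)" by (rule op_spectral_radius_le_weighted[OF w bounded_HS D'])
  finally have "op_norm M C \<le> sqrt (weighted_radius M w (H S))" by (rule real_le_rsqrt)
  then show "x \<le> weighted_radius M w (H S) powr (1 / 2)"
    using C(2) weighted_radius_nonneg[OF w bounded_HS] by (simp add: powr_half_sqrt)
qed simp

text \<open>In each of the m means the factors are rotated by a different amount, so that reading
  one fixed position across the block spells the cyclic word defining \<Omega>.\<close>

lemma block_majorized:
  assumes B: "length B = m" "set B \<subseteq> H S"
  shows "\<exists>D. D \<in> H \<Omega> \<and> majorized M (op_list_prod M B) D"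
proof -
  have m0: "0 < m" using adm by (simp add: admissible_def)
  have "\<exists>A. is_hadamard_mean M m \<alpha> (B ! i) A \<and> (\<forall>l\<in>{1..m}. A l \<in> S l)" if "i < m" for i
  proof -
    have "B ! i \<in> H S" using B that by (metis nth_mem subsetD)
    from mem_kernel_hadamardD[OF this bounded_S] show ?thesis .
  qed
  then obtain A where A: "\<And>i. i < m \<Longrightarrow> is_hadamard_mean M m \<alpha> (B ! i) (A i)"
    "\<And>i l. i < m \<Longrightarrow> l \<in> {1..m} \<Longrightarrow> A i l \<in> S l" by metis
  \<comment> \<open>At position l the i-th mean contributes its factor from the i-th set of the
    cyclic product starting at l.\<close>
  let ?\<sigma> = "\<lambda>i l. \<nu> (cyclic_index m i l)"
  let ?As = "map (\<lambda>i l. A i (?\<sigma> i l)) [0..<m]"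
  have bij: "bij_betw (?\<sigma> i) {1..m} {1..m}" if "i < m" for i
    using bij_betw_trans[OF bij_cyclic_index[OF that] permutes_imp_bij[OF \<nu>]] by (simp add: o_def)
  have l2: "list_all2 (is_hadamard_mean M m \<alpha>) B ?As"
    using B(1) is_hadamard_mean_reindex[OF A(1) bij] by (simp add: list_all2_conv_all_nth)
  have ne: "B \<noteq> []" using B(1) m0 by auto
  obtain D where "D \<in> H (\<lambda>l. ops_prod M (map (\<lambda>i. S (\<nu> i)) ([l..<m + 1] @ [1..<l])))" "majorized M (op_list_prod M B) D"
  proof (rule hadamard_list_prod_in[OF adm ne l2, of "\<lambda>l. map (\<lambda>i. S (\<nu> i)) ([l..<m + 1] @ [1..<l])"])
    fix l assume l: "l \<in> {1..m}"
    show "list_all2 (\<in>) (map (\<lambda>A. A l) ?As) (map (\<lambda>i. S (\<nu> i)) ([l..<m + 1] @ [1..<l]))"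
      unfolding list_all2_conv_all_nth
    proof (intro conjI allI impI)
      show "length (map (\<lambda>A. A l) ?As) = length (map (\<lambda>i. S (\<nu> i)) ([l..<m + 1] @ [1..<l]))" using l by auto
      fix i assume "i < length (map (\<lambda>A. A l) ?As)"
      then have i: "i < m" by simp
      have "?\<sigma> i l \<in> {1..m}" using bij_betwE[OF bij[OF i]] l by blast
      then have "A i (?\<sigma> i l) \<in> S (?\<sigma> i l)" by (rule A(2)[OF i])
      moreover have "map (\<lambda>i. S (\<nu> i)) ([l..<m + 1] @ [1..<l]) ! i = S (?\<sigma> i l)"
        using nth_cyclic[OF i l] i l by (subst nth_map) auto
      ultimately show "map (\<lambda>A. A l) ?As ! i \<in> map (\<lambda>i. S (\<nu> i)) ([l..<m + 1] @ [1..<l]) ! i"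
        using i by simp
    qed
  qed
  then show ?thesis unfolding cyclic_prods_def by blast
qed

text \<open>A word of length m * k over \<open>H S\<close> is cut into k blocks, each dominated by
  an element of \<open>H \<Omega>\<close>; control of lengths divisible by m is enough by
  \<open>weighted_radius_le_multiple\<close>.\<close>

lemma radius_hadamard_power_le:
  "weighted_radius M w (H S) ^ m \<le> weighted_radius M w (H \<Omega>)"
proof (rule dense_ge)
  have m0: "0 < m" using adm by (simp add: admissible_def)
  fix t assume t: "weighted_radius M w (H \<Omega>) < t"
  then have t0: "0 < t" using weighted_radius_nonneg[OF w bounded_H\<Omega>] by simp
  obtain K where K: "0 \<le> K" "\<And>k A. A \<in> ops_power M (H \<Omega>) k \<Longrightarrow> w A \<le> K * t ^ k"
    using weighted_radius_bound[OF w bounded_H\<Omega> t] by metis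
  show "weighted_radius M w (H S) ^ m \<le> t"
  proof (rule weighted_radius_le_multiple[OF w bounded_HS t0 m0])
    fix k X assume "k > 0" and "X \<in> ops_power M (H S) (m * k)"
    then obtain Cs where Cs: "X = op_list_prod M Cs" "length Cs = m * k" "set Cs \<subseteq> H S" by (auto simp: ops_power_eq)
    obtain Css where Css: "concat Css = Cs" "length Css = k" "\<forall>B\<in>set Css. length B = m"
      using split_into_blocks[OF Cs(2)] by blast
    have sub: "set B \<subseteq> H S" if "B \<in> set Css" for B
      using that Cs(3) unfolding Css(1)[symmetric] set_concat by (meson UN_upper order_trans)
    have "\<forall>B\<in>set Css. \<exists>D. D \<in> H \<Omega> \<and> majorized M (op_list_prod M B) D"
    proof
      fix B assume B: "B \<in> set Css"
      then have "length B = m" using Css(3) by blast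
      then show "\<exists>D. D \<in> H \<Omega> \<and> majorized M (op_list_prod M B) D" by (rule block_majorized[OF _ sub[OF B]])
    qed
    from bchoice[OF this] obtain f
      where f: "\<And>B. B \<in> set Css \<Longrightarrow> f B \<in> H \<Omega> \<and> majorized M (op_list_prod M B) (f B)" by blast
    have L: "L2_operator M A" if "B \<in> set Css" "A \<in> set B" for A B
      by (rule bounded_operatorD[OF bounded_opsD[OF bounded_HS subsetD[OF sub[OF that(1)] that(2)]]])
    have X: "X = op_list_prod M (map (op_list_prod M) Css)"
      unfolding Cs(1) Css(1)[symmetric] by (rule op_list_prod_concat) (use L in blast)
    have maj: "majorized M X (op_list_prod M (map f Css))"
      unfolding X by (rule majorized_list_prod) (use f L in \<open>auto simp: list_all2_conv_all_nth intro!: L2_operator_list_prod\<close>)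
    have fin: "op_list_prod M (map f Css) \<in> ops_power M (H \<Omega>) k"
      unfolding ops_power_eq using Css(2) f by (intro CollectI exI[of _ "map f Css"]) auto
    have LX: "L2_operator M X" unfolding X by (rule L2_operator_list_prod) (use L in \<open>auto intro!: L2_operator_list_prod\<close>)
    have bf: "bounded_operator M (op_list_prod M (map f Css))"
      by (rule bounded_operator_list_prod) (use f bounded_opsD[OF bounded_H\<Omega>] in auto)
    have "w X \<le> w (op_list_prod M (map f Css))" by (rule majorized_size[OF w maj LX bf])
    also have "\<dots> \<le> K * t ^ k" by (rule K(2)[OF fin])
    finally show "w X \<le> K * t ^ k" .
  qed
qed

text \<open>Each \<open>\<Omega> i\<close> is a rotation of the full product, so all of them share
  one bound r in \<open>weighted_radius_hadamard_le\<close>.\<close>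

lemma radius_cyclic_hadamard_le:
  "weighted_radius M w (H \<Omega>) \<le> weighted_radius M w (ops_prod M (map (\<lambda>l. S (\<nu> l)) [1..<m + 1])) powr (\<alpha> * m)"
proof (rule weighted_radius_hadamard_le[OF w adm bounded_\<Omega>])
  have bP: "bounded_ops M (ops_prod M (map (\<lambda>l. S (\<nu> l)) [1..<m + 1]))"
    by (rule ops_prod_bounded) (use bounded_S_\<nu> in auto)
  show "0 \<le> weighted_radius M w (ops_prod M (map (\<lambda>l. S (\<nu> l)) [1..<m + 1]))"
    by (rule weighted_radius_nonneg[OF w bP])
  fix i assume i: "i \<in> {1..m}"
  have "[1..<m + 1] = [1..<i] @ [i..<m + 1]"
    using upt_add_eq_append[of 1 i "m + 1 - i"] i by auto
  then have "map (\<lambda>l. S (\<nu> l)) [1..<m + 1] = map (\<lambda>l. S (\<nu> l)) [1..<i] @ map (\<lambda>l. S (\<nu> l)) [i..<m + 1]"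
    by (metis map_append)
  moreover have "weighted_radius M w (\<Omega> i) \<le>
      weighted_radius M w (ops_prod M (map (\<lambda>l. S (\<nu> l)) [1..<i] @ map (\<lambda>l. S (\<nu> l)) [i..<m + 1]))"
    unfolding cyclic_prods_def map_append
    by (rule weighted_radius_cyclic[OF w]) (use bounded_S_\<nu> i in auto)
  ultimately show "weighted_radius M w (\<Omega> i) \<le> weighted_radius M w (ops_prod M (map (\<lambda>l. S (\<nu> l)) [1..<m + 1]))"
    by (simp only:)
qed

lemma radius_chain:
  "ops_norm M (H \<Psi>) \<le> weighted_radius M w (H S) powr (1 / 2)"
  "weighted_radius M w (H S) powr (1 / 2) \<le> weighted_radius M w (H \<Omega>) powr (1 / (2 * real m))"
  "weighted_radius M w (H \<Omega>) powr (1 / (2 * real m))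
     \<le> weighted_radius M w (ops_prod M (map (\<lambda>l. S (\<nu> l)) [1..<m + 1])) powr (\<alpha> / 2)"
proof -
  have m0: "0 < m" using adm by (simp add: admissible_def)
  note nHS = weighted_radius_nonneg[OF w bounded_HS] and nH\<Omega> = weighted_radius_nonneg[OF w bounded_H\<Omega>]
  show "ops_norm M (H \<Psi>) \<le> weighted_radius M w (H S) powr (1 / 2)" by (rule norm_hadamard_le)
  have "weighted_radius M w (H S) powr (1 / 2) = (weighted_radius M w (H S) ^ m) powr (1 / (2 * real m))"
    using m0 nHS by (cases "weighted_radius M w (H S) = 0") (simp_all add: powr_realpow[symmetric] powr_powr)
  also have "\<dots> \<le> weighted_radius M w (H \<Omega>) powr (1 / (2 * real m))"
    by (intro powr_mono2 radius_hadamard_power_le) (use nHS in auto)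
  finally show "weighted_radius M w (H S) powr (1 / 2) \<le> weighted_radius M w (H \<Omega>) powr (1 / (2 * real m))" .
  let ?P = "weighted_radius M w (ops_prod M (map (\<lambda>l. S (\<nu> l)) [1..<m + 1]))"
  have "weighted_radius M w (H \<Omega>) powr (1 / (2 * real m)) \<le> (?P powr (\<alpha> * m)) powr (1 / (2 * real m))"
    by (intro powr_mono2 radius_cyclic_hadamard_le) (use nH\<Omega> in auto)
  also have "\<dots> = ?P powr (\<alpha> / 2)" using m0 by (simp add: powr_powr)
  finally show "weighted_radius M w (H \<Omega>) powr (1 / (2 * real m)) \<le> ?P powr (\<alpha> / 2)" .
qed

end

end

section \<open>Matrices as kernels on counting measure\<close>

text \<open>Unordered summability of complex families is absolute summability.\<close>

lemma integrable_count_space_iff: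
  fixes f :: "'b \<Rightarrow> complex"
  shows "integrable (count_space R) f \<longleftrightarrow> f summable_on R"
  using abs_summable_equivalent[of f R] summable_on_iff_abs_summable_on_complex[of f R]
  by (simp add: abs_summable_on_def)

lemma integral_count_space_eq_infsum:
  fixes f :: "'b \<Rightarrow> complex"
  assumes "f summable_on R" shows "integral\<^sup>L (count_space R) f = infsum f R"
  using infsetsum_infsum[of f R] assms integrable_count_space_iff[of R f]
  by (simp add: abs_summable_on_def infsetsum_def)

text \<open>Counting measure has no nonempty null subsets of R, so almost everywhere means
  everywhere; countability makes every function on R times R measurable.\<close>

lemma has_matrix_iff_has_kernel:
  assumes R: "countable R" and a: "\<And>i k. i \<in> R \<Longrightarrow> k \<in> R \<Longrightarrow> a' (i, k) = a i k"
  shows "has_matrix R A a \<longleftrightarrow> has_kernel (count_space R) A (\<lambda>z. of_real (a' z))"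
proof -
  have m: "(\<lambda>z. complex_of_real (a' z)) \<in> borel_measurable (count_space R \<Otimes>\<^sub>M count_space R)"
    unfolding pair_measure_countable[OF R R] by simp
  have iff: "(\<lambda>k. of_real (a i k) * f k) summable_on R \<and> x = (\<Sum>\<^sub>\<infinity>k\<in>R. of_real (a i k) * f k) \<longleftrightarrow>
     integrable (count_space R) (\<lambda>k. of_real (a' (i, k)) * f k) \<and> x = (\<integral>k. of_real (a' (i, k)) * f k \<partial>count_space R)"
    if "i \<in> R" for i x and f :: "nat \<Rightarrow> complex"
  proof -
    have 1: "(\<lambda>k. of_real (a i k) * f k) summable_on R \<longleftrightarrow> (\<lambda>k. of_real (a' (i, k)) * f k) summable_on R"
      using a[OF that] by (intro summable_on_cong) auto
    have 2: "(\<Sum>\<^sub>\<infinity>k\<in>R. of_real (a i k) * f k) = (\<Sum>\<^sub>\<infinity>k\<in>R. of_real (a' (i, k)) * f k)"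
      using a[OF that] by (intro infsum_cong) auto
    show ?thesis unfolding 1 2 integrable_count_space_iff
      using integral_count_space_eq_infsum[of "\<lambda>k. of_real (a' (i, k)) * f k" R] by auto
  qed
  show ?thesis unfolding has_matrix_def has_kernel_def AE_count_space using m iff by simp
qed

lemma matrix_hadamard_eq_kernel_hadamard:
  assumes R: "countable R"
  shows "matrix_hadamard R m \<alpha> \<Psi> = kernel_hadamard (count_space R) m \<alpha> \<Psi>"
proof (intro set_eqI iffI)
  fix C assume "C \<in> matrix_hadamard R m \<alpha> \<Psi>"
  then obtain A a where L: "L2_operator (count_space R) C"
    and A: "\<forall>j\<in>{1..m}. A j \<in> \<Psi> j \<and> nonneg_matrix R (a j) \<and> has_matrix R (A j) (a j)"
    and C: "has_matrix R C (\<lambda>i k. \<Prod>j=1..m. a j i k powr \<alpha> j)"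
    unfolding matrix_hadamard_def mem_Collect_eq by (elim conjE exE)
  \<comment> \<open>Entries outside R are unconstrained in a matrix, whereas kernels are nonnegative
    everywhere; they are reset to 0.\<close>
  define a' where "a' j = (\<lambda>(i, k). if i \<in> R \<and> k \<in> R \<and> j \<in> {1..m} then a j i k else 0)" for j
  have a': "a' j (i, k) = a j i k" if "i \<in> R" "k \<in> R" "j \<in> {1..m}" for i j k using that by (simp add: a'_def)
  have "has_kernel (count_space R) (A j) (\<lambda>z. of_real (a' j z))" if "j \<in> {1..m}" for j
    using has_matrix_iff_has_kernel[OF R, of "a' j" "a j"] a' that A by blast
  moreover have "has_kernel (count_space R) C (\<lambda>z. of_real (\<Prod>j=1..m. a' j z powr \<alpha> j))"
    by (rule has_matrix_iff_has_kernel[OF R, THEN iffD1, OF _ C]) (simp add: a')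
  moreover have "0 \<le> a' j z" for j z using A by (auto simp: a'_def nonneg_matrix_def split: prod.split)
  ultimately show "C \<in> kernel_hadamard (count_space R) m \<alpha> \<Psi>"
    unfolding kernel_hadamard_def mem_Collect_eq using L A
    by (intro conjI exI[of _ A] exI[of _ a'] ballI allI) auto
next
  fix C assume "C \<in> kernel_hadamard (count_space R) m \<alpha> \<Psi>"
  then obtain A a where L: "L2_operator (count_space R) C"
    and A: "\<forall>j\<in>{1..m}. A j \<in> \<Psi> j \<and> (\<forall>z. 0 \<le> a j z) \<and> has_kernel (count_space R) (A j) (\<lambda>z. of_real (a j z))"
    and C: "has_kernel (count_space R) C (\<lambda>z. of_real (\<Prod>j=1..m. a j z powr \<alpha> j))"
    unfolding kernel_hadamard_def mem_Collect_eq by (elim conjE exE)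
  have "has_matrix R (A j) (\<lambda>i k. a j (i, k))" if "j \<in> {1..m}" for j
    using has_matrix_iff_has_kernel[OF R, of "a j" "\<lambda>i k. a j (i, k)"] that A by blast
  moreover have "has_matrix R C (\<lambda>i k. \<Prod>j=1..m. a j (i, k) powr \<alpha> j)"
    by (rule has_matrix_iff_has_kernel[OF R, THEN iffD2, OF _ C]) simp
  ultimately show "C \<in> matrix_hadamard R m \<alpha> \<Psi>"
    unfolding matrix_hadamard_def mem_Collect_eq using L A
    by (intro conjI exI[of _ A] exI[of _ "\<lambda>j i k. a j (i, k)"] ballI allI) (auto simp: nonneg_matrix_def)
qed

lemma radius_chain_all:
  assumes M: "sigma_finite_measure M" and adm: "admissible M m \<alpha>" and m: "even m"
    and \<tau>: "\<tau> permutes {1..m}" and \<nu>: "\<nu> permutes {1..m}"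
    and b: "\<forall>j\<in>{1..m}. bounded_op_set M (\<Psi> j) \<and> (\<forall>A\<in>\<Psi> j. L2_operator M A)"
  defines "S \<equiv> adjoint_prods M m \<tau> \<Psi>"
  defines "\<Omega> \<equiv> cyclic_prods M m \<nu> S" and "H \<equiv> kernel_hadamard M m (\<lambda>_. \<alpha>)"
  shows "(\<forall>j\<in>{1..m div 2}. S (m div 2 + j) = ops_adjoint M (S j)) \<and>
    (\<forall>r\<in>{gen_spectral_radius M, joint_spectral_radius M}.
       ops_norm M (H \<Psi>) \<le> r (H S) powr (1 / 2) \<and>
       r (H S) powr (1 / 2) \<le> r (H \<Omega>) powr (1 / (2 * real m)) \<and>
       r (H \<Omega>) powr (1 / (2 * real m)) \<le> r (ops_prod M (map (\<lambda>l. S (\<nu> l)) [1..<m + 1])) powr (\<alpha> / 2))"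
proof -
  interpret sigma_finite_measure M by (rule M)
  have b\<Psi>: "\<And>j. j \<in> {1..m} \<Longrightarrow> bounded_ops M (\<Psi> j)" using b by (auto intro!: bounded_opsI_set)
  have wn: "size_function M (op_norm M)" and ws: "size_function M (op_spectral_radius M)"
    by (simp_all add: size_function_def)
  note ctx = adm m \<tau> \<nu> b\<Psi>
  have bP: "bounded_ops M (ops_prod M (map (\<lambda>l. S (\<nu> l)) [1..<m + 1]))"
    unfolding S_def by (rule ops_prod_bounded) (use bounded_S_\<nu>[OF ctx wn] in auto)
  \<comment> \<open>The conversion holds for bounded sets, and the three sets whose radius occurs in
    the chain are bounded.\<close>
  have joint: "joint_spectral_radius M \<Phi> = weighted_radius M (op_norm M) \<Phi>"
    if "\<Phi> \<in> {H S, H \<Omega>, ops_prod M (map (\<lambda>l. S (\<nu> l)) [1..<m + 1])}" for \<Phi>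
    using that bP bounded_HS[OF ctx wn] bounded_H\<Omega>[OF ctx wn]
    by (intro joint_spectral_radius_eq) (auto simp: S_def \<Omega>_def H_def)
  show ?thesis
    using adjoint_prods_adjoint[OF ctx wn] radius_chain[OF ctx wn] radius_chain[OF ctx ws] joint
    by (simp add: gen_spectral_radius_eq S_def \<Omega>_def H_def)
qed

theorem theorem3p8:
  fixes m :: nat and \<tau> \<nu> :: "nat \<Rightarrow> nat"
  assumes "m > 0" and "even m"
    and "\<tau> permutes {1..m}" and "\<nu> permutes {1..m}"
  shows
    "(\<forall>(M :: 'a measure) \<Psi>.
        sigma_finite_measure M \<and> space M \<noteq> {} \<and>
        (\<forall>j\<in>{1..m}. bounded_op_set M (\<Psi> j) \<and> (\<forall>A\<in>\<Psi> j. positive_kernel_operator M A)) \<longrightarrow>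
        (let S = adjoint_prods M m \<tau> \<Psi>;
             \<Omega> = cyclic_prods M m \<nu> S;
             H = kernel_hadamard M m (\<lambda>_. 1 / real m)
         in (\<forall>j\<in>{1..m div 2}. S (m div 2 + j) = ops_adjoint M (S j)) \<and>
            (\<forall>r\<in>{gen_spectral_radius M, joint_spectral_radius M}.
               ops_norm M (H \<Psi>) \<le> r (H S) powr (1 / 2) \<and>
               r (H S) powr (1 / 2) \<le> r (H \<Omega>) powr (1 / (2 * real m)) \<and>
               r (H \<Omega>) powr (1 / (2 * real m))
                 \<le> r (ops_prod M (map (\<lambda>l. S (\<nu> l)) [1..<m + 1])) powr (1 / (2 * real m)))))
     \<and>
     (\<forall>(R :: nat set) (\<alpha> :: real) \<Psi>.
        (R = {1..} \<or> (\<exists>N\<ge>1. R = {1..N})) \<and> \<alpha> \<ge> 1 / real m \<and>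
        (\<forall>j\<in>{1..m}. bounded_op_set (count_space R) (\<Psi> j) \<and>
                     (\<forall>A\<in>\<Psi> j. nonneg_matrix_operator R A)) \<longrightarrow>
        (let M = count_space R;
             S = adjoint_prods M m \<tau> \<Psi>;
             \<Omega> = cyclic_prods M m \<nu> S;
             H = matrix_hadamard R m (\<lambda>_. \<alpha>)
         in (\<forall>j\<in>{1..m div 2}. S (m div 2 + j) = ops_adjoint M (S j)) \<and>
            (\<forall>r\<in>{gen_spectral_radius M, joint_spectral_radius M}.
               ops_norm M (H \<Psi>) \<le> r (H S) powr (1 / 2) \<and>
               r (H S) powr (1 / 2) \<le> r (H \<Omega>) powr (1 / (2 * real m)) \<and>
               r (H \<Omega>) powr (1 / (2 * real m))
                 \<le> r (ops_prod M (map (\<lambda>l. S (\<nu> l)) [1..<m + 1])) powr (\<alpha> / 2))))"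
proof (rule conjI; intro allI impI)
  fix M :: "'a measure" and \<Psi>
  assume asm: "sigma_finite_measure M \<and> space M \<noteq> {} \<and>
    (\<forall>j\<in>{1..m}. bounded_op_set M (\<Psi> j) \<and> (\<forall>A\<in>\<Psi> j. positive_kernel_operator M A))"
  have "admissible M m (1 / real m)" using assms(1) by (simp add: admissible_def)
  note chain = radius_chain_all[OF conjunct1[OF asm] this assms(2-4)]
  show "let S = adjoint_prods M m \<tau> \<Psi>; \<Omega> = cyclic_prods M m \<nu> S; H = kernel_hadamard M m (\<lambda>_. 1 / real m)
     in (\<forall>j\<in>{1..m div 2}. S (m div 2 + j) = ops_adjoint M (S j)) \<and>
        (\<forall>r\<in>{gen_spectral_radius M, joint_spectral_radius M}.
           ops_norm M (H \<Psi>) \<le> r (H S) powr (1 / 2) \<and>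
           r (H S) powr (1 / 2) \<le> r (H \<Omega>) powr (1 / (2 * real m)) \<and>
           r (H \<Omega>) powr (1 / (2 * real m))
             \<le> r (ops_prod M (map (\<lambda>l. S (\<nu> l)) [1..<m + 1])) powr (1 / (2 * real m)))"
    \<comment> \<open>For \<alpha> = 1 / m the last exponent \<alpha> / 2 is 1 / (2 m).\<close>
    using chain[of \<Psi>] asm unfolding Let_def
    by (simp add: positive_kernel_operator_def positive_operator_def mult.commute)
next
  fix R :: "nat set" and \<alpha> :: real and \<Psi>
  assume asm: "(R = {1..} \<or> (\<exists>N\<ge>1. R = {1..N})) \<and> \<alpha> \<ge> 1 / real m \<and>
    (\<forall>j\<in>{1..m}. bounded_op_set (count_space R) (\<Psi> j) \<and> (\<forall>A\<in>\<Psi> j. nonneg_matrix_operator R A))"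
  have adm: "admissible (count_space R) m \<alpha>" using assms(1) asm by (auto simp: admissible_def)
  have sf: "sigma_finite_measure (count_space R)"
    by (rule sigma_finite_measure_count_space_countable) simp
  have R: "countable R" by simp
  have "\<forall>j\<in>{1..m}. bounded_op_set (count_space R) (\<Psi> j) \<and> (\<forall>A\<in>\<Psi> j. L2_operator (count_space R) A)"
    using asm by (auto simp: nonneg_matrix_operator_def)
  from radius_chain_all[OF sf adm assms(2-4) this]
  show "let M = count_space R; S = adjoint_prods M m \<tau> \<Psi>; \<Omega> = cyclic_prods M m \<nu> S; H = matrix_hadamard R m (\<lambda>_. \<alpha>)
     in (\<forall>j\<in>{1..m div 2}. S (m div 2 + j) = ops_adjoint M (S j)) \<and>
        (\<forall>r\<in>{gen_spectral_radius M, joint_spectral_radius M}.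
           ops_norm M (H \<Psi>) \<le> r (H S) powr (1 / 2) \<and>
           r (H S) powr (1 / 2) \<le> r (H \<Omega>) powr (1 / (2 * real m)) \<and>
           r (H \<Omega>) powr (1 / (2 * real m))
             \<le> r (ops_prod M (map (\<lambda>l. S (\<nu> l)) [1..<m + 1])) powr (\<alpha> / 2))"
    unfolding Let_def matrix_hadamard_eq_kernel_hadamard[OF R] .
qed

end
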